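(* Let $d\ge 3$ and $n>d$. Let $z$ and $t$ be linearly independent vectors in $\mathbb{R}^d$, and let $\mu_1,\dots,\mu_n$ be Gaussian distributions in $\mathbb{R}^d$ of standard deviation $\sigma$ centered at points each of norm at most $1$. If $a_1,\dots,a_n$ have density $\prod_{i=1}^n\mu_i(a_i)$, then \[ \mathbb{E}_{a_1,\dots,a_n}\big[\,|\mathrm{Shadow}_{t,z}(a_1,\dots,a_n)|\,\big]\le \mathcal{D}(n,d,\sigma),\qquad \mathcal{D}(n,d,\sigma)=\frac{58{,}888{,}678\, n d^3}{\min\big(\sigma,\,1/(3\sqrt{d\ln n})\big)^6}. \]
   Context: For a vector $q$ and points $a_1,\dots,a_n\in\mathbb{R}^d$, $\mathrm{optSimp}(q;a_1,\dots,a_n)$ is the set of $d$-subsets $I\subseteq\{1,\dots,n\}$ such that the $a_i$, $i\in I$, are linearly independent, $\mathrm{conv}(a_i:i\in I)$ is a facet of $\mathrm{conv}(0,a_1,\dots,a_n)$, and $q\in\mathrm{cone}(a_i:i\in I)=\{\sum_{i\in I}\lambda_ia_i:\lambda_i\ge0\}$. For linearly independent $t,z$, $\mathrm{Shadow}_{t,z}(a_1,\dots,a_n)=\bigcup_{q\in\mathrm{span}(t,z)}\mathrm{optSimp}(q;a_1,\dots,a_n)$, a set of $d$-subsets; $|\cdot|$ is its cardinality. A Gaussian distribution of standard deviation $\sigma$ centered at $c$ has density $(2\pi\sigma^2)^{-d/2}e^{-\|x-c\|^2/2\sigma^2}$.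
   Formalization: The union defining Shadow is taken over nonzero q in span(t,z) only: q = 0 lies in every cone, so including it would count all facets, and the bound then fails for large d (e.g. all centers 0, n = 2d, where the expected number of facets is at least 2^d/(2d+1)). *)

theory Defs
  imports "HOL-Analysis.Analysis"
begin

definition gaussian_pdf :: "real \<Rightarrow> real ^ 'd \<Rightarrow> real ^ 'd \<Rightarrow> real" where
  "gaussian_pdf \<sigma> c x =
     (2 * pi * \<sigma>\<^sup>2) powr (- real CARD('d) / 2) * exp (- (norm (x - c))\<^sup>2 / (2 * \<sigma>\<^sup>2))"

definition gaussian_points :: "nat \<Rightarrow> real \<Rightarrow> (nat \<Rightarrow> real ^ 'd) \<Rightarrow> (nat \<Rightarrow> real ^ 'd) measure" where
  "gaussian_points n \<sigma> c =
     density (\<Pi>\<^sub>M i\<in>{1..n}. lborel) (\<lambda>a. ennreal (\<Prod>i\<in>{1..n}. gaussian_pdf \<sigma> (c i) (a i)))"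

(* Linear independence of a family: the vectors are pairwise distinct and form an independent set. *)
definition lin_indep_family :: "(nat \<Rightarrow> real ^ 'd) \<Rightarrow> nat set \<Rightarrow> bool" where
  "lin_indep_family a I \<longleftrightarrow> inj_on a I \<and> independent (a ` I)"

definition cone_of :: "(nat \<Rightarrow> real ^ 'd) \<Rightarrow> nat set \<Rightarrow> (real ^ 'd) set" where
  "cone_of a I = {(\<Sum>i\<in>I. l i *\<^sub>R a i) | l. \<forall>i\<in>I. 0 \<le> l i}"

definition optSimp :: "real ^ 'd \<Rightarrow> nat \<Rightarrow> (nat \<Rightarrow> real ^ 'd) \<Rightarrow> nat set set" where
  "optSimp q n a =
     {I. I \<subseteq> {1..n} \<and> card I = CARD('d) \<and> lin_indep_family a I \<and>
         (convex hull (a ` I)) facet_of (convex hull (insert 0 (a ` {1..n}))) \<and>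
         q \<in> cone_of a I}"

(* The union ranges over the directions of the plane, i.e. over its nonzero vectors.  Since 0 lies in
   every cone, optSimp 0 n a consists of all facets with linearly independent vertices; admitting
   q = 0 would make the shadow independent of t and z. *)
definition Shadow :: "real ^ 'd \<Rightarrow> real ^ 'd \<Rightarrow> nat \<Rightarrow> (nat \<Rightarrow> real ^ 'd) \<Rightarrow> nat set set" where
  "Shadow t z n a = (\<Union>q \<in> span {t, z} - {0}. optSimp q n a)"

definition shadow_bound :: "nat \<Rightarrow> nat \<Rightarrow> real \<Rightarrow> real" where
  "shadow_bound n d \<sigma> =
     58888678 * real n * real d ^ 3 / (min \<sigma> (1 / (3 * sqrt (real d * ln (real n))))) ^ 6"

end

theory Submission
  imports Defs "HOL-Probability.Probability"
begin

text \<open>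
  Choose orthonormal coordinates in which the plane is spanned by a horizontal axis \<open>k1\<close> and a vertical
  axis \<open>k2\<close>.  A facet of slope at most 1 lying above all points covers an interval (its chord) of the
  horizontal line, and chords of distinct facets are disjoint, so the sum of all chord lengths is at most
  twice the sum of the horizontal coordinates, whose expectation is under control.  Hence it suffices that
  the expected chord length of a facet is bounded below relative to the probability that the facet occurs.
  Parametrise the vertices of a facet by their supporting hyperplane and their projections along \<open>k2\<close>;
  the Jacobian is the volume of the projected simplex, and it is proportional to the longest chord.  With the
  hyperplane fixed, the other points impose no further condition, and (i) contracting the vertices towards
  their barycentre moves the line away from the boundary of the simplex at bounded cost in density, while
  (ii) the Jacobian, as a linear function of the horizontal coordinates, is unlikely to be small.
  Reflecting and exchanging the two axes covers all facets that meet the plane.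
\<close>

section \<open>Lebesgue integration on matrices, row by row\<close>

text \<open>The d vertices of a facet form one matrix, rows being frame coordinates and columns
  vertices, so that each analytic step integrates some rows with the others frozen: row
  \<open>k2\<close> for the passage to hyperplane coordinates, all rows except \<open>k2\<close> for
  the move away from the boundary, row \<open>k1\<close> for the anti-concentration.

  The obstacle is that only the slope along \<open>k1\<close> is controlled. The slopes in the other
  directions are arbitrary, so moving the projected vertices under a fixed hyperplane might change
  their heights without bound. What saves the estimate is that the facet meets the plane: the height
  at the meeting point controls the intercept. Slope at most 1 also keeps the shift in the
  anti-concentration step of size comparable to \<sigma>.

  Densities are compared pointwise only within distance \<rho> of the centres; \<rho> is so large
  that in each frame the tails of all (n choose d) candidates add up to at most 1. The estimates
  give 580 n d^3 / s^4, where s < 1 is the minimum in \<open>shadow_bound\<close>, and this implies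
  the bound with s^6.\<close>

lemma prod_Basis_vec:
  fixes g :: "'b::euclidean_space ^ 'n \<Rightarrow> 'c::comm_monoid_mult"
  shows "prod g Basis = (\<Prod>i\<in>UNIV. \<Prod>b\<in>Basis. g (axis i b))"
proof -
  have inj: "inj_on (\<lambda>(i, b). axis i b :: 'b ^ 'n) (UNIV \<times> Basis)"
    by (auto simp: inj_on_def axis_eq_axis nonzero_Basis)
  have "(Basis :: ('b ^ 'n) set) = (\<lambda>(i, b). axis i b) ` (UNIV \<times> Basis)"
    by (auto simp: Basis_vec_def image_iff)
  then have "prod g Basis = (\<Prod>p\<in>UNIV \<times> Basis. g (case p of (i, b) \<Rightarrow> axis i b))"
    using prod.reindex[OF inj, of g] by (simp add: comp_def)
  also have "\<dots> = (\<Prod>i\<in>UNIV. \<Prod>b\<in>Basis. g (axis i b))"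
    by (subst prod.cartesian_product) (auto intro!: prod.cong)
  finally show ?thesis .
qed

lemma vec_lambda_measurable_PiM:
  "(\<lambda>f. \<chi> i. (f i :: 'b::euclidean_space)) \<in> borel_measurable (Pi\<^sub>M (UNIV :: 'n::finite set) (\<lambda>_. borel))"
proof (subst borel_measurable_euclidean_space, safe)
  fix b :: "'b ^ 'n" assume "b \<in> Basis"
  then obtain i u where "b = axis i u" by (auto simp: Basis_vec_def)
  then show "(\<lambda>f. (\<chi> i. f i) \<bullet> b) \<in> borel_measurable (Pi\<^sub>M UNIV (\<lambda>_. borel))"
    by (simp add: inner_axis)
qed

lemma mem_box_vec:
  fixes l u Z :: "'b::euclidean_space ^ 'n"
  shows "Z \<in> box l u \<longleftrightarrow> (\<forall>i. Z $ i \<in> box (l $ i) (u $ i))"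
  by (force simp: box_def Basis_vec_def inner_axis)

text \<open>Boxes determine Lebesgue measure, and the preimage of a box is a product of boxes. The
  bijection is arbitrary because the vertices of a facet are numbered by a set of naturals, whereas
  matrices are indexed by a finite type.\<close>

lemma distr_PiM_lborel_bij:
  assumes f: "bij_betw f (UNIV :: 'n::finite set) I"
  shows "distr (Pi\<^sub>M I (\<lambda>_. lborel)) borel (\<lambda>a. \<chi> j. a (f j)) = (lborel :: ('b::euclidean_space ^ 'n) measure)"
proof (rule lborel_eqI[symmetric])
  interpret product_sigma_finite "\<lambda>_. lborel :: 'b measure" ..
  have fin: "finite I" using f bij_betw_finite finite by blast
  have fI: "f j \<in> I" for j using f by (auto simp: bij_betw_def)
  have [measurable]: "(\<lambda>a. \<chi> j. a (f j)) \<in> Pi\<^sub>M I (\<lambda>_. lborel :: 'b measure) \<rightarrow>\<^sub>M (borel :: ('b ^ 'n) measure)"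
  proof -
    have "(\<lambda>a. \<lambda>j\<in>UNIV. a (f j)) \<in> Pi\<^sub>M I (\<lambda>_. lborel :: 'b measure) \<rightarrow>\<^sub>M Pi\<^sub>M (UNIV :: 'n set) (\<lambda>_. borel)"
      using fI by (intro measurable_restrict) (auto intro: measurable_component_singleton)
    from measurable_compose[OF this vec_lambda_measurable_PiM] show ?thesis by simp
  qed
  fix l u :: "'b ^ 'n" assume le: "\<And>b. b \<in> Basis \<Longrightarrow> l \<bullet> b \<le> u \<bullet> b"
  have le': "l $ i \<bullet> b \<le> u $ i \<bullet> b" if "b \<in> Basis" for i b
    using le[of "axis i b"] that by (simp add: inner_axis axis_in_Basis_iff)
  define g where "g = inv_into UNIV f"
  have g: "f (g i) = i" if "i \<in> I" for i using f that by (simp add: g_def bij_betw_def f_inv_into_f)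
  have g': "g (f j) = j" for j using f by (simp add: g_def bij_betw_def)
  have "(\<lambda>a. \<chi> j. a (f j)) -` box l u \<inter> space (Pi\<^sub>M I (\<lambda>_. lborel)) = Pi\<^sub>E I (\<lambda>i. box (l $ g i) (u $ g i))"
  proof (intro set_eqI iffI)
    fix a assume "a \<in> (\<lambda>a. \<chi> j. a (f j)) -` box l u \<inter> space (Pi\<^sub>M I (\<lambda>_. lborel))"
    then have e: "a \<in> extensional I" and b: "a (f j) \<in> box (l $ j) (u $ j)" for j
      by (simp_all add: mem_box_vec space_PiM PiE_iff)
    have "a i \<in> box (l $ g i) (u $ g i)" if "i \<in> I" for i
      using b[of "g i"] g[OF that] by simp
    with e show "a \<in> Pi\<^sub>E I (\<lambda>i. box (l $ g i) (u $ g i))"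
      by (simp add: PiE_iff)
  next
    fix a assume a: "a \<in> Pi\<^sub>E I (\<lambda>i. box (l $ g i) (u $ g i))"
    have "a (f j) \<in> box (l $ j) (u $ j)" for j
      using PiE_mem[OF a fI[of j]] g' by simp
    then show "a \<in> (\<lambda>a. \<chi> j. a (f j)) -` box l u \<inter> space (Pi\<^sub>M I (\<lambda>_. lborel))"
      using a by (simp add: mem_box_vec space_PiM PiE_iff)
  qed
  then have "emeasure (distr (Pi\<^sub>M I (\<lambda>_. lborel)) borel (\<lambda>a. \<chi> j. a (f j))) (box l u)
     = emeasure (Pi\<^sub>M I (\<lambda>_. lborel)) (Pi\<^sub>E I (\<lambda>i. box (l $ g i) (u $ g i)))"
    by (simp add: emeasure_distr)
  also have "\<dots> = (\<Prod>i\<in>I. emeasure lborel (box (l $ g i) (u $ g i)))"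
    using fin by (rule emeasure_PiM) auto
  also have "\<dots> = (\<Prod>i\<in>I. ennreal (\<Prod>b\<in>Basis. (u $ g i - l $ g i) \<bullet> b))"
    using le' by (intro prod.cong) (auto simp: emeasure_lborel_box)
  also have "\<dots> = (\<Prod>j\<in>UNIV. ennreal (\<Prod>b\<in>Basis. (u $ j - l $ j) \<bullet> b))"
    by (subst prod.reindex_bij_betw[OF f, symmetric]) (simp add: g')
  also have "\<dots> = ennreal (\<Prod>j\<in>UNIV. \<Prod>b\<in>Basis. (u $ j - l $ j) \<bullet> b)"
    using le' by (intro prod_ennreal prod_nonneg) (simp add: inner_diff_left)
  also have "(\<Prod>j\<in>UNIV. \<Prod>b\<in>Basis. (u $ j - l $ j) \<bullet> b) = (\<Prod>b\<in>Basis. (u - l) \<bullet> b)"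
    by (subst prod_Basis_vec) (simp add: inner_axis)
  finally show "emeasure (distr (Pi\<^sub>M I (\<lambda>_. lborel)) borel (\<lambda>a. \<chi> j. a (f j))) (box l u)
     = ennreal (\<Prod>b\<in>Basis. (u - l) \<bullet> b)" .
qed simp

section \<open>Integrating one row at a time\<close>

definition row_update :: "'b ^ 'n \<Rightarrow> 'n \<Rightarrow> 'b \<Rightarrow> 'b ^ 'n" where
  "row_update Z k r = (\<chi> i. if i = k then r else Z $ i)"

lemma row_update_nth: "row_update Z k r $ i = (if i = k then r else Z $ i)"
  by (simp add: row_update_def)

lemma row_update_same [simp]: "row_update Z k r $ k = r"
  by (simp add: row_update_def)

lemma row_update_other [simp]: "i \<noteq> k \<Longrightarrow> row_update Z k r $ i = Z $ i"
  by (simp add: row_update_def)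

lemma row_update_twice [simp]: "row_update (row_update Z k r) k s = row_update Z k s"
  by (simp add: row_update_def vec_eq_iff)

lemma row_update_triv [simp]: "row_update Z k (Z $ k) = Z"
  by (simp add: row_update_def vec_eq_iff)

lemma row_update_commute: "i \<noteq> k \<Longrightarrow> row_update (row_update Z i r) k s = row_update (row_update Z k s) i r"
  by (simp add: row_update_def vec_eq_iff)

lemma borel_measurable_vec_nth [measurable]: "(\<lambda>Z :: 'b::euclidean_space ^ 'n. Z $ i) \<in> borel_measurable borel"
  by (intro borel_measurable_continuous_onI continuous_intros)

lemma borel_measurable_vec_nth_comp [measurable (raw)]:
  fixes F :: "'a \<Rightarrow> 'b::euclidean_space ^ 'n"
  shows "F \<in> borel_measurable M \<Longrightarrow> (\<lambda>x. F x $ i) \<in> borel_measurable M"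
  by (rule measurable_compose[OF _ borel_measurable_vec_nth])

lemma borel_measurable_vec_lambda [measurable (raw)]:
  fixes F :: "'n::finite \<Rightarrow> 'a \<Rightarrow> 'b::euclidean_space"
  assumes "\<And>i. F i \<in> borel_measurable M"
  shows "(\<lambda>x. \<chi> i. F i x) \<in> borel_measurable M"
proof (subst borel_measurable_euclidean_space, safe)
  fix b :: "'b ^ 'n" assume "b \<in> Basis"
  then obtain i u where "b = axis i u" by (auto simp: Basis_vec_def)
  then show "(\<lambda>x. (\<chi> i. F i x) \<bullet> b) \<in> borel_measurable M"
    using assms by (simp add: inner_axis)
qed

lemma borel_measurable_row_update [measurable (raw)]:
  fixes F :: "'a \<Rightarrow> 'b::euclidean_space ^ 'n"
  assumes "F \<in> borel_measurable M" "G \<in> borel_measurable M"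
  shows "(\<lambda>x. row_update (F x) k (G x)) \<in> borel_measurable M"
  unfolding row_update_def using assms by (intro borel_measurable_vec_lambda) auto

text \<open>Tonelli in the form used throughout: two integrals over matrices are compared by
  comparing the integrals over row \<open>k\<close>, for every choice of the other rows.\<close>

lemma nn_integral_row_mono:
  fixes G H :: "'b::euclidean_space ^ 'n \<Rightarrow> ennreal"
  assumes [measurable]: "G \<in> borel_measurable borel" "H \<in> borel_measurable borel"
    and le: "\<And>Z. (\<integral>\<^sup>+x. G (row_update Z k x) \<partial>lborel) \<le> (\<integral>\<^sup>+x. H (row_update Z k x) \<partial>lborel)"
  shows "(\<integral>\<^sup>+Z. G Z \<partial>lborel) \<le> (\<integral>\<^sup>+Z. H Z \<partial>lborel)"
proof -
  interpret product_sigma_finite "\<lambda>_. lborel :: 'b measure" ..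
  let ?S = "UNIV - {k} :: 'n set"
  have vm [measurable]: "(\<lambda>f. \<chi> i. (f i :: 'b)) \<in> Pi\<^sub>M UNIV (\<lambda>_. lborel) \<rightarrow>\<^sub>M (borel :: ('b ^ 'n) measure)"
    using vec_lambda_measurable_PiM by (simp cong: measurable_cong_sets sets_PiM_cong)
  have split: "(\<integral>\<^sup>+Z. G Z \<partial>lborel) = (\<integral>\<^sup>+f. (\<integral>\<^sup>+x. G (row_update (\<chi> i. f i) k x) \<partial>lborel) \<partial>Pi\<^sub>M ?S (\<lambda>_. lborel))"
    if [measurable]: "G \<in> borel_measurable borel" for G :: "'b ^ 'n \<Rightarrow> ennreal"
  proof -
    have "(\<integral>\<^sup>+Z. G Z \<partial>lborel) = (\<integral>\<^sup>+f. G (\<chi> i. f i) \<partial>Pi\<^sub>M UNIV (\<lambda>_. lborel))"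
      by (subst distr_PiM_lborel_bij[of "\<lambda>x. x" UNIV, symmetric]) (auto simp: nn_integral_distr bij_betw_def)
    also have "UNIV = insert k ?S" by auto
    also have "(\<integral>\<^sup>+f. G (\<chi> i. f i) \<partial>Pi\<^sub>M (insert k ?S) (\<lambda>_. lborel))
        = (\<integral>\<^sup>+f. (\<integral>\<^sup>+x. G (\<chi> i. (f(k := x)) i) \<partial>lborel) \<partial>Pi\<^sub>M ?S (\<lambda>_. lborel))"
    proof (rule product_nn_integral_insert)
      have "insert k ?S = UNIV" by auto
      then show "(\<lambda>f. G (\<chi> i. f i)) \<in> borel_measurable (Pi\<^sub>M (insert k ?S) (\<lambda>_. lborel))" by simp
    qed auto
    finally show ?thesis by (simp add: row_update_def fun_upd_def cong: if_cong)
  qed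
  show ?thesis unfolding split[OF assms(1)] split[OF assms(2)]
    by (intro nn_integral_mono le)
qed

lemma nn_integral_row_cong:
  fixes G H :: "'b::euclidean_space ^ 'n \<Rightarrow> ennreal"
  assumes "G \<in> borel_measurable borel" "H \<in> borel_measurable borel"
    and "\<And>Z. (\<integral>\<^sup>+x. G (row_update Z k x) \<partial>lborel) = (\<integral>\<^sup>+x. H (row_update Z k x) \<partial>lborel)"
  shows "(\<integral>\<^sup>+Z. G Z \<partial>lborel) = (\<integral>\<^sup>+Z. H Z \<partial>lborel)"
  using assms by (intro antisym nn_integral_row_mono[of _ _ k]) auto

section \<open>Linear changes of variables\<close>

lemma nn_integral_lborel_translation:
  fixes g :: "'b::euclidean_space \<Rightarrow> ennreal"
  assumes [measurable]: "g \<in> borel_measurable borel"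
  shows "(\<integral>\<^sup>+x. g (x + v) \<partial>lborel) = (\<integral>\<^sup>+x. g x \<partial>lborel)"
proof -
  have "(\<integral>\<^sup>+x. g x \<partial>lborel) = (\<integral>\<^sup>+x. g x \<partial>distr lborel borel ((+) v))"
    by (simp add: lborel_distr_plus)
  then show ?thesis by (simp add: nn_integral_distr add.commute)
qed

text \<open>Induction over products of elementary maps. The guard
  \<open>det (matrix f) \<noteq> 0\<close> is part of the claim because the induction also visits
  maps with a zero row; for a composition, a nonzero determinant makes both factors
  nonsingular.\<close>

lemma nn_integral_linear_subst_aux:
  fixes f :: "real ^ 'n \<Rightarrow> real ^ 'n"
  assumes "linear f"
  shows "\<forall>g \<in> borel_measurable borel. det (matrix f) \<noteq> 0 \<longrightarrow>
    (\<integral>\<^sup>+x. g x \<partial>lborel) = ennreal \<bar>det (matrix f)\<bar> * (\<integral>\<^sup>+x. g (f x) \<partial>lborel)"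
  using assms
proof (rule induct_linear_elementary, goal_cases)
  case (1 f h)
  note comp = 1
  have [measurable]: "f \<in> borel_measurable borel" "h \<in> borel_measurable borel"
    using comp by (auto intro!: borel_measurable_continuous_onI linear_continuous_on simp: linear_conv_bounded_linear)
  show ?case
  proof (intro ballI impI)
    fix g :: "real ^ 'n \<Rightarrow> ennreal"
    assume [measurable]: "g \<in> borel_measurable borel" and d: "det (matrix (f \<circ> h)) \<noteq> 0"
    have m: "matrix (f \<circ> h) = matrix f ** matrix h" using comp by (simp add: matrix_compose)
    have df: "det (matrix f) \<noteq> 0" and dh: "det (matrix h) \<noteq> 0" using d by (auto simp: m det_mul)
    have "(\<integral>\<^sup>+x. g x \<partial>lborel) = ennreal \<bar>det (matrix f)\<bar> * (\<integral>\<^sup>+x. g (f x) \<partial>lborel)"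
      using df by (intro comp(3)[rule_format]) auto
    also have "(\<integral>\<^sup>+x. g (f x) \<partial>lborel) = ennreal \<bar>det (matrix h)\<bar> * (\<integral>\<^sup>+x. g (f (h x)) \<partial>lborel)"
      using dh by (intro comp(4)[rule_format, of "\<lambda>x. g (f x)"]) auto
    finally show "(\<integral>\<^sup>+x. g x \<partial>lborel) = ennreal \<bar>det (matrix (f \<circ> h))\<bar> * (\<integral>\<^sup>+x. g ((f \<circ> h) x) \<partial>lborel)"
      by (simp add: m det_mul abs_mult ennreal_mult mult.assoc)
  qed
next
  case (2 f i)
  note zeroes = 2
  have "det (matrix f) = 0"
    by (rule det_zero_row(1)[of i]) (use zeroes in \<open>simp add: row_def matrix_def vec_eq_iff\<close>)
  then show ?case by simp
next
  case (3 c)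
  have mat: "matrix (\<lambda>x::real^'n. \<chi> i. c i * x $ i) $ i $ j = (if i = j then c i else 0)" for i j
    by (simp add: matrix_def axis_def)
  have det: "det (matrix (\<lambda>x::real^'n. \<chi> i. c i * x $ i)) = (\<Prod>i\<in>UNIV. c i)"
    by (subst det_diagonal) (auto simp: mat)
  show ?case unfolding det
  proof (intro ballI impI)
    fix g :: "real ^ 'n \<Rightarrow> ennreal"
    assume [measurable]: "g \<in> borel_measurable borel" and d: "(\<Prod>i\<in>UNIV. c i) \<noteq> 0"
    \<comment> \<open>\<open>lborel_affine_euclidean\<close> takes its scaling factors as a function
      of basis vectors; \<open>C\<close> is the one with value \<open>c i\<close> at
      \<open>axis i 1\<close>.\<close>
    define C :: "real ^ 'n \<Rightarrow> real" where "C b = (\<Sum>i\<in>UNIV. c i * b $ i)" for b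
    have C: "C (axis i 1) = c i" for i by (simp add: C_def axis_def if_distrib cong: if_cong)
    have T: "(\<lambda>x. 0 + (\<Sum>j\<in>Basis. (C j * (x \<bullet> j)) *\<^sub>R j)) = (\<lambda>x. \<chi> i. c i * x $ i)"
    proof
      fix x :: "real ^ 'n"
      have B: "(Basis :: (real ^ 'n) set) = range (\<lambda>i. axis i 1)" by (auto simp: Basis_vec_def)
      have "(\<Sum>j\<in>Basis. (C j * (x \<bullet> j)) *\<^sub>R j) = (\<Sum>i\<in>UNIV. (c i * x $ i) *\<^sub>R axis i 1)"
        unfolding B by (subst sum.reindex) (auto simp: inj_on_def axis_eq_axis C inner_axis)
      also have "\<dots> = (\<chi> i. c i * x $ i)"
        by (simp add: vec_eq_iff axis_def if_distrib cong: if_cong)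
      finally show "0 + (\<Sum>j\<in>Basis. (C j * (x \<bullet> j)) *\<^sub>R j) = (\<chi> i. c i * x $ i)" by simp
    qed
    have C0: "C j \<noteq> 0" if "j \<in> Basis" for j
      using that d by (auto simp: Basis_vec_def C)
    have "(\<Prod>j\<in>Basis. \<bar>C j\<bar>) = \<bar>\<Prod>i\<in>UNIV. c i\<bar>"
      by (subst prod_Basis_vec) (simp add: C abs_prod)
    then have "lborel = density (distr lborel borel (\<lambda>x. \<chi> i. c i * x $ i)) (\<lambda>_. ennreal \<bar>\<Prod>i\<in>UNIV. c i\<bar>)"
      using lborel_affine_euclidean[of C 0, OF C0] unfolding T by (simp add: prod_ennreal)
    then have "(\<integral>\<^sup>+x. g x \<partial>lborel) = (\<integral>\<^sup>+x. g x \<partial>density (distr lborel borel (\<lambda>x. \<chi> i. c i * x $ i)) (\<lambda>_. ennreal \<bar>\<Prod>i\<in>UNIV. c i\<bar>))"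
      by (rule arg_cong)
    also have "\<dots> = ennreal \<bar>\<Prod>i\<in>UNIV. c i\<bar> * (\<integral>\<^sup>+x. g (\<chi> i. c i * x $ i) \<partial>lborel)"
      by (simp add: nn_integral_density nn_integral_distr nn_integral_cmult)
    finally show "(\<integral>\<^sup>+x. g x \<partial>lborel) = ennreal \<bar>\<Prod>i\<in>UNIV. c i\<bar> * (\<integral>\<^sup>+x. g (\<chi> i. c i * x $ i) \<partial>lborel)" .
  qed
next
  case (4 m n)
  let ?h = "\<lambda>x::real^'n. \<chi> i. x $ Transposition.transpose m n i"
  have "matrix ?h = (\<chi> i. mat 1 $ Transposition.transpose m n i)"
    by (auto simp: vec_eq_iff matrix_def axis_def mat_def)
  then have det: "\<bar>det (matrix ?h)\<bar> = 1"
    by (simp add: det_permute_rows permutes_swap_id sign_swap_id abs_mult \<open>m \<noteq> n\<close>)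
  have b: "bij_betw (Transposition.transpose m n) (UNIV::'n set) UNIV" by simp
  have "distr lborel borel ?h = lborel"
  proof -
    have "distr (distr (Pi\<^sub>M UNIV (\<lambda>_. lborel)) borel (\<lambda>a. \<chi> j. a j)) borel ?h
        = distr (Pi\<^sub>M (UNIV :: 'n set) (\<lambda>_. lborel :: real measure)) borel (\<lambda>a. \<chi> j. a (Transposition.transpose m n j))"
      by (subst distr_distr) (auto simp: comp_def)
    then show ?thesis
      using distr_PiM_lborel_bij[OF b, where 'b=real] distr_PiM_lborel_bij[of "\<lambda>x. x" "UNIV::'n set", where 'b=real]
      by (simp add: bij_betw_def)
  qed
  then have *: "(\<integral>\<^sup>+x. g x \<partial>lborel) = (\<integral>\<^sup>+x. g x \<partial>distr lborel borel ?h)" for g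
    by simp
  show ?case
  proof (intro ballI impI)
    fix g :: "real ^ 'n \<Rightarrow> ennreal"
    assume [measurable]: "g \<in> borel_measurable borel"
    show "(\<integral>\<^sup>+x. g x \<partial>lborel) = ennreal \<bar>det (matrix ?h)\<bar> * (\<integral>\<^sup>+x. g (?h x) \<partial>lborel)"
      by (subst *) (simp add: nn_integral_distr det)
  qed
next
  case (5 m n)
  let ?h = "\<lambda>x::real^'n. \<chi> i. if i = m then x $ m + x $ n else x $ i"
  have "matrix ?h = (\<chi> i. if i = m then row m (mat 1) + 1 *s row n (mat 1) else row i (mat 1))"
    by (auto simp: vec_eq_iff matrix_def axis_def mat_def row_def)
  then have det: "det (matrix ?h) = 1"
    using det_row_operation[OF \<open>m \<noteq> n\<close>, of "mat 1 :: real^'n^'n" 1] by simp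
  show ?case unfolding det
  proof (intro ballI impI)
    fix g :: "real ^ 'n \<Rightarrow> ennreal"
    assume [measurable]: "g \<in> borel_measurable borel"
    have "(\<integral>\<^sup>+x. g x \<partial>lborel) = (\<integral>\<^sup>+x. g (?h x) \<partial>lborel)"
    proof (rule nn_integral_row_cong[where k=m])
      fix Z :: "real ^ 'n"
      \<comment> \<open>While only coordinate \<open>m\<close> is integrated, coordinate
        \<open>n\<close> is a constant, so the shear is a translation.\<close>
      have "?h (row_update Z m x) = row_update Z m (x + Z $ n)" for x
        using \<open>m \<noteq> n\<close> by (auto simp: vec_eq_iff row_update_nth)
      then show "(\<integral>\<^sup>+x. g (row_update Z m x) \<partial>lborel) = (\<integral>\<^sup>+x. g (?h (row_update Z m x)) \<partial>lborel)"
        using nn_integral_lborel_translation[of "\<lambda>x. g (row_update Z m x)" "Z $ n"] by simp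
    qed measurable
    then show "(\<integral>\<^sup>+x. g x \<partial>lborel) = ennreal \<bar>1\<bar> * (\<integral>\<^sup>+x. g (?h x) \<partial>lborel)" by simp
  qed
qed

lemma nn_integral_linear_subst:
  fixes A :: "real ^ 'n ^ 'n"
  assumes "g \<in> borel_measurable borel" "det A \<noteq> 0"
  shows "(\<integral>\<^sup>+x. g x \<partial>lborel) = ennreal \<bar>det A\<bar> * (\<integral>\<^sup>+x. g (A *v x) \<partial>lborel)"
  using nn_integral_linear_subst_aux[of "(*v) A"] assms by simp

text \<open>Each transformed row contributes its own factor. \<open>S\<close> is the set of all rows
  but one when a projected simplex is moved, and the set of all rows when points are expressed in a
  frame.\<close>

lemma nn_integral_rows_linear_subst:
  fixes A :: "real ^ 'n ^ 'n" and G :: "real ^ 'n ^ 'm \<Rightarrow> ennreal"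
  assumes G: "G \<in> borel_measurable borel" and A: "det A \<noteq> 0"
  shows "(\<integral>\<^sup>+Z. G Z \<partial>lborel) = ennreal (\<bar>det A\<bar> ^ card S) * (\<integral>\<^sup>+Z. G (\<chi> i. if i \<in> S then A *v Z $ i else Z $ i) \<partial>lborel)"
proof -
  have [measurable]: "(\<lambda>x. A *v x) \<in> borel_measurable borel"
    by (intro borel_measurable_continuous_onI linear_continuous_on) (simp add: linear_conv_bounded_linear[symmetric])
  have "finite S" by simp
  then show ?thesis using G
  proof (induction S arbitrary: G rule: finite_induct)
    case empty
    then show ?case by simp
  next
    case (insert k S)
    note insert.prems[measurable]
    let ?T = "\<lambda>S Z :: real ^ 'n ^ 'm. \<chi> i. if i \<in> S then A *v Z $ i else Z $ i"
    have [measurable]: "?T S \<in> borel_measurable borel" for S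
    proof (rule borel_measurable_vec_lambda)
      show "(\<lambda>Z :: real ^ 'n ^ 'm. if i \<in> S then A *v Z $ i else Z $ i) \<in> borel_measurable borel" for i
        by (cases "i \<in> S") simp_all
    qed
    have "(\<integral>\<^sup>+Z. G Z \<partial>lborel) = ennreal (\<bar>det A\<bar> ^ card S) * (\<integral>\<^sup>+Z. G (?T S Z) \<partial>lborel)"
      by (rule insert.IH) measurable
    also have "(\<integral>\<^sup>+Z. G (?T S Z) \<partial>lborel) = (\<integral>\<^sup>+Z. ennreal \<bar>det A\<bar> * G (?T (insert k S) Z) \<partial>lborel)"
    proof (rule nn_integral_row_cong[where k=k])
      fix Z :: "real ^ 'n ^ 'm"
      have "?T S (row_update Z k (A *v x)) = ?T (insert k S) (row_update Z k x)" for x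
        using insert by (auto simp: vec_eq_iff row_update_nth)
      then show "(\<integral>\<^sup>+x. G (?T S (row_update Z k x)) \<partial>lborel) = (\<integral>\<^sup>+x. ennreal \<bar>det A\<bar> * G (?T (insert k S) (row_update Z k x)) \<partial>lborel)"
        using nn_integral_linear_subst[of "\<lambda>x. G (?T S (row_update Z k x))", OF _ A]
        by (simp add: nn_integral_cmult)
    qed measurable
    also have "\<dots> = ennreal \<bar>det A\<bar> * (\<integral>\<^sup>+Z. G (?T (insert k S) Z) \<partial>lborel)"
      by (simp add: nn_integral_cmult)
    finally show ?case
      unfolding card_insert_disjoint[OF insert.hyps] by (simp only: power_Suc2 ennreal_mult abs_ge_zero zero_le_power mult.assoc)
  qed
qed

section \<open>Hyperplane coordinates for the points of a facet\<close>

lemma borel_measurable_det [measurable (raw)]: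
  fixes F :: "'a \<Rightarrow> real ^ 'n ^ 'n"
  assumes [measurable]: "F \<in> borel_measurable M"
  shows "(\<lambda>x. det (F x)) \<in> borel_measurable M"
  unfolding det_def by measurable

lemma borel_measurable_matrix_vector_mult [measurable (raw)]:
  fixes F :: "'a \<Rightarrow> real ^ 'n ^ 'm"
  assumes [measurable]: "F \<in> borel_measurable M" "G \<in> borel_measurable M"
  shows "(\<lambda>x. F x *v G x) \<in> borel_measurable M"
  unfolding matrix_vector_mult_def by measurable

lemma borel_measurable_vector_matrix_mult [measurable (raw)]:
  fixes F :: "'a \<Rightarrow> real ^ 'n ^ 'm"
  assumes [measurable]: "F \<in> borel_measurable M" "G \<in> borel_measurable M"
  shows "(\<lambda>x. G x v* F x) \<in> borel_measurable M"
  unfolding vector_matrix_mult_def by measurable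

lemma borel_measurable_transpose [measurable (raw)]:
  fixes F :: "'a \<Rightarrow> real ^ 'n ^ 'm"
  assumes [measurable]: "F \<in> borel_measurable M"
  shows "(\<lambda>x. transpose (F x)) \<in> borel_measurable M"
  unfolding transpose_def by measurable

text \<open>With row \<open>k\<close> replaced by ones, the columns are homogeneous coordinates of
  the vertices projected along axis \<open>k\<close>. Up to sign this is therefore (d-1)! times the
  volume of the projected simplex.\<close>

definition base_det :: "'d \<Rightarrow> real ^ 'd ^ 'd \<Rightarrow> real" where
  "base_det k Z = det (row_update Z k 1)"

text \<open>An affine function of the horizontal coordinates is coded by one vector
  \<open>F\<close>: \<open>F $ k\<close> is the intercept and the other entries are the slopes. The
  result lists its values at the projected vertices.\<close>

definition heights :: "'d \<Rightarrow> real ^ 'd ^ 'd \<Rightarrow> real ^ 'd \<Rightarrow> real ^ 'd" where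
  "heights k Z F = F v* row_update Z k 1"

text \<open>The inverse coordinate change: row \<open>k\<close>, read as coefficients of a
  hyperplane, is turned back into the heights of the vertices on it.\<close>

definition graph_config :: "'d \<Rightarrow> real ^ 'd ^ 'd \<Rightarrow> real ^ 'd ^ 'd" where
  "graph_config k Z = row_update Z k (heights k Z (Z $ k))"

text \<open>Cramer's rule for the affine function interpolating the vertices. The explicit formula
  makes measurability immediate.\<close>

definition hyperplane_coeffs :: "'d \<Rightarrow> real ^ 'd ^ 'd \<Rightarrow> real ^ 'd" where
  "hyperplane_coeffs k Z =
     (\<chi> c. det (\<chi> i j. if j = c then Z $ k $ i else transpose (row_update Z k 1) $ i $ j) / base_det k Z)"

lemma base_det_row_update [simp]: "base_det k (row_update Z k x) = base_det k Z"
  by (simp add: base_det_def)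

lemma heights_row_update [simp]: "heights k (row_update Z k x) = heights k Z"
  by (rule ext) (simp add: heights_def)

lemma graph_config_row_update: "graph_config k (row_update Z k x) = row_update Z k (heights k Z x)"
  by (simp add: graph_config_def)

lemma graph_config_other [simp]: "c \<noteq> k \<Longrightarrow> graph_config k Z $ c = Z $ c"
  by (simp add: graph_config_def)

lemma heights_sum: "heights k Z F = F $ k *\<^sub>R 1 + (\<Sum>c\<in>-{k}. F $ c *\<^sub>R Z $ c)"
proof -
  have "heights k Z F = (\<Sum>c\<in>UNIV. F $ c *\<^sub>R row_update Z k 1 $ c)"
    by (simp add: heights_def vector_matrix_mult_def vec_eq_iff mult.commute)
  also have "\<dots> = F $ k *\<^sub>R 1 + (\<Sum>c\<in>UNIV - {k}. F $ c *\<^sub>R row_update Z k 1 $ c)"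
    by (subst sum.remove[of _ k]) auto
  also have "(\<Sum>c\<in>UNIV - {k}. F $ c *\<^sub>R row_update Z k 1 $ c) = (\<Sum>c\<in>-{k}. F $ c *\<^sub>R Z $ c)"
    by (rule sum.cong) auto
  finally show ?thesis .
qed

lemma heights_eq_iff:
  assumes "base_det k Z \<noteq> 0"
  shows "heights k Z F = Z $ k \<longleftrightarrow> F = hyperplane_coeffs k Z"
  using cramer[of "transpose (row_update Z k 1)" F "Z $ k"] assms
  by (simp add: heights_def hyperplane_coeffs_def base_det_def)

lemma base_det_measurable [measurable]: "base_det k \<in> borel_measurable borel"
  unfolding base_det_def[abs_def] by measurable

lemma heights_measurable [measurable]: "heights k Z \<in> borel_measurable borel"
  unfolding heights_def[abs_def] by measurable

lemma graph_config_measurable [measurable]: "graph_config k \<in> borel_measurable borel"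
  unfolding graph_config_def[abs_def] heights_def by measurable

lemma borel_measurable_if_const [measurable (raw)]:
  assumes "f \<in> borel_measurable M" "g \<in> borel_measurable M"
  shows "(\<lambda>x. if P then f x else g x) \<in> borel_measurable M"
  using assms by auto

lemma hyperplane_coeffs_measurable [measurable]: "hyperplane_coeffs k \<in> borel_measurable borel"
  unfolding hyperplane_coeffs_def[abs_def] by measurable

text \<open>With the other rows frozen, the heights are a linear function of the coefficients, with
  matrix \<open>transpose (row_update Z k 1)\<close>. Its determinant is the Jacobian, and this does
  not involve the hyperplane: conditions on the hyperplane and on the projected vertices decouple.
  Configurations with zero determinant contribute nothing to either side.\<close>

lemma nn_integral_hyperplane_coordinates:
  fixes g :: "real ^ 'd ^ 'd \<Rightarrow> ennreal"
  assumes [measurable]: "g \<in> borel_measurable borel" "Q \<in> sets borel"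
  shows "(\<integral>\<^sup>+Z. indicator {Z. base_det k Z \<noteq> 0 \<and> hyperplane_coeffs k Z \<in> Q} Z * g Z \<partial>lborel)
    = (\<integral>\<^sup>+Z. ennreal \<bar>base_det k Z\<bar> * indicator Q (Z $ k) * g (graph_config k Z) \<partial>lborel)"
proof (rule nn_integral_row_cong[where k=k])
  fix Z :: "real ^ 'd ^ 'd"
  let ?I = "indicator {Z. base_det k Z \<noteq> 0 \<and> hyperplane_coeffs k Z \<in> Q} :: _ \<Rightarrow> ennreal"
  let ?A = "transpose (row_update Z k 1)"
  show "(\<integral>\<^sup>+x. ?I (row_update Z k x) * g (row_update Z k x) \<partial>lborel)
     = (\<integral>\<^sup>+x. ennreal \<bar>base_det k (row_update Z k x)\<bar> * indicator Q (row_update Z k x $ k)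
              * g (graph_config k (row_update Z k x)) \<partial>lborel)"
  proof (cases "base_det k Z = 0")
    case False
    then have d: "det ?A \<noteq> 0" by (simp add: base_det_def)
    have A: "?A *v F = heights k Z F" for F by (simp add: heights_def)
    have c: "hyperplane_coeffs k (row_update Z k (heights k Z F)) = F" for F
      using heights_eq_iff[of k "row_update Z k (heights k Z F)" F] False by simp
    have "(\<integral>\<^sup>+x. ?I (row_update Z k x) * g (row_update Z k x) \<partial>lborel)
      = ennreal \<bar>det ?A\<bar> * (\<integral>\<^sup>+F. ?I (row_update Z k (?A *v F)) * g (row_update Z k (?A *v F)) \<partial>lborel)"
      by (rule nn_integral_linear_subst[OF _ d]) measurable
    also have "\<dots> = ennreal \<bar>det ?A\<bar> * (\<integral>\<^sup>+F. indicator Q F * g (graph_config k (row_update Z k F)) \<partial>lborel)"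
      using False by (simp add: A c indicator_def graph_config_row_update del: transpose_matrix_vector)
    finally show ?thesis
      by (simp add: base_det_def mult.assoc nn_integral_cmult)
  qed simp
qed measurable

section \<open>Moving the line away from the boundary of the projected simplex\<close>

text \<open>Acts on the list of values of one coordinate at the d vertices: the mean shrinks by the
  factor 1 - \<eta>, while differences are kept. Applied to every horizontal coordinate it
  translates the whole projected simplex, taking its barycentre b to (1 - \<eta>) b.\<close>

definition contraction :: "real \<Rightarrow> real ^ 'n ^ 'n" where
  "contraction \<eta> = (\<chi> i j. (if i = j then 1 else 0) - \<eta> / CARD('n))"

definition mean :: "real ^ 'n \<Rightarrow> real" where
  "mean z = (\<Sum>j\<in>UNIV. z $ j) / CARD('n)"

lemma contraction_mult: "contraction \<eta> *v z = z - (\<eta> * mean z) *\<^sub>R 1"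
  by (simp add: vec_eq_iff matrix_vector_mult_def contraction_def mean_def left_diff_distrib sum_subtractf
      sum_distrib_left sum_divide_distrib if_distrib[of "\<lambda>x. x * _"] cong: if_cong)

text \<open>In the coordinates given by \<open>P\<close>, where coordinate \<open>k\<close> is
  replaced by the sum of all coordinates, the map becomes \<open>N\<close>. This differs from the
  identity only in column \<open>k\<close>, so its determinant is its diagonal entry 1 -
  \<eta>.\<close>

lemma det_contraction: "det (contraction \<eta> :: real ^ 'n ^ 'n) = 1 - \<eta>"
proof -
  fix k :: 'n
  define P :: "real ^ 'n ^ 'n" where "P = row_update (mat 1) k 1"
  define N :: "real ^ 'n ^ 'n" where
    "N = (\<chi> i j. if j = k then (if i = k then 1 - \<eta> else - \<eta> / CARD('n)) else mat 1 $ i $ j)"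
  have dN: "det N = 1 - \<eta>"
    using cramer_lemma[where A="mat 1" and k=k and x="\<chi> i. if i = k then 1 - \<eta> else - \<eta> / CARD('n)"]
    by (simp add: N_def cong: if_cong)
  have dP: "det P = 1"
  proof -
    have "P = transpose (\<chi> i j. if j = k then (1 :: real ^ 'n) $ i else mat 1 $ i $ j)"
      by (simp add: P_def vec_eq_iff transpose_def row_update_def mat_def)
    then show ?thesis
      using cramer_lemma[where A="mat 1" and k=k and x="1 :: real ^ 'n"] by (simp add: det_transpose cong: if_cong)
  qed
  have "P ** contraction \<eta> = N ** P"
  proof -
    have "(P ** contraction \<eta>) $ i $ j = (N ** P) $ i $ j" for i j
    proof (cases "i = k")
      case True
      then have "(P ** contraction \<eta>) $ i $ j = 1 - \<eta>"
        by (simp add: P_def matrix_matrix_mult_def contraction_def sum_subtractf)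
      moreover have "(N ** P) $ i $ j = 1 - \<eta>"
        using True by (simp add: P_def N_def matrix_matrix_mult_def row_update_nth mat_def
            if_distrib[of "\<lambda>x. x * _"] if_distrib[of "\<lambda>x. x $ _"] cong: if_cong)
      ultimately show ?thesis by simp
    next
      case False
      then have "(P ** contraction \<eta>) $ i $ j = (if i = j then 1 else 0) - \<eta> / CARD('n)"
        by (simp add: P_def matrix_matrix_mult_def contraction_def mat_def if_distrib[of "\<lambda>x. x * _"] cong: if_cong)
      moreover have "(N ** P) $ i $ j = (if i = j then 1 else 0) - \<eta> / CARD('n)"
      proof -
        have "(N ** P) $ i $ j = (\<Sum>l\<in>UNIV. (if l = k then - \<eta> / CARD('n) else if i = l then 1 else 0) * P $ l $ j)"
          using False by (simp add: N_def matrix_matrix_mult_def mat_def cong: if_cong)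
        also have "\<dots> = - \<eta> / CARD('n) * P $ k $ j + (\<Sum>l\<in>UNIV - {k}. (if i = l then P $ l $ j else 0))"
          by (subst sum.remove[of _ k]) (simp_all add: if_distrib[of "\<lambda>x. x * _"] cong: if_cong)
        also have "(\<Sum>l\<in>UNIV - {k}. (if i = l then P $ l $ j else 0)) = P $ i $ j"
          using False by simp
        finally show ?thesis
          using False by (simp add: P_def mat_def)
      qed
      ultimately show ?thesis by simp
    qed
    then show ?thesis by (simp add: vec_eq_iff)
  qed
  then have "det P * det (contraction \<eta> :: real ^ 'n ^ 'n) = det N * det P"
    by (metis det_mul)
  then show ?thesis by (simp add: dN dP)
qed

text \<open>Row \<open>k\<close> is exempt because it holds the coefficients of the hyperplane,
  which stays fixed while the projected vertices move.\<close>

definition contract_base :: "'d \<Rightarrow> real \<Rightarrow> real ^ 'd ^ 'd \<Rightarrow> real ^ 'd ^ 'd" where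
  "contract_base k \<eta> Z = (\<chi> c. if c \<in> -{k} then contraction \<eta> *v Z $ c else Z $ c)"

lemma contract_base_nth:
  "contract_base k \<eta> Z $ c = (if c = k then Z $ k else Z $ c - (\<eta> * mean (Z $ c)) *\<^sub>R 1)"
  by (simp add: contract_base_def contraction_mult)

text \<open>A translation preserves volume. In terms of the matrix, multiples of the all-ones row
  \<open>k\<close> are added to the other rows, and \<open>E\<close> records these row
  operations.\<close>

lemma base_det_contract_base:
  fixes Z :: "real ^ 'd ^ 'd"
  shows "base_det k (contract_base k \<eta> Z) = base_det k Z"
proof -
  define E :: "real ^ 'd ^ 'd" where
    "E = (\<chi> i j. if j = k then (if i = k then 1 else - \<eta> * mean (Z $ i)) else mat 1 $ i $ j)"
  have "det E = 1" 
    using cramer_lemma[where A="mat 1" and k=k and x="\<chi> c. if c = k then 1 else - \<eta> * mean (Z $ c)"]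
    by (simp add: E_def cong: if_cong)
  moreover have "row_update (contract_base k \<eta> Z) k 1 = E ** row_update Z k 1"
  proof -
    have "(E ** row_update Z k 1) $ c $ j = row_update (contract_base k \<eta> Z) k 1 $ c $ j" for c j
    proof -
      let ?R = "row_update Z k 1"
      have "(E ** ?R) $ c $ j = (\<Sum>l\<in>UNIV. E $ c $ l * ?R $ l $ j)"
        by (simp add: matrix_matrix_mult_def)
      also have "\<dots> = E $ c $ k + (\<Sum>l\<in>UNIV - {k}. (if c = l then ?R $ l $ j else 0))"
        by (subst sum.remove[of _ k]) (simp_all add: E_def mat_def if_distrib[of "\<lambda>x. x * _"] cong: if_cong)
      also have "(\<Sum>l\<in>UNIV - {k}. (if c = l then ?R $ l $ j else 0)) = (if c = k then 0 else Z $ c $ j)"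
        by (subst sum.delta') auto
      finally show ?thesis
        by (cases "c = k") (auto simp: E_def contract_base_nth)
    qed
    then show ?thesis by (simp add: vec_eq_iff)
  qed
  ultimately show ?thesis by (simp add: base_det_def det_mul)
qed

text \<open>The \<open>k1\<close>-axis meets the projected simplex at a point with all barycentric
  coordinates at least \<epsilon>. Row \<open>k2\<close> does not occur, so the property is
  unaffected by a change of heights or a passage to hyperplane coordinates.\<close>

definition balanced :: "'d \<Rightarrow> 'd \<Rightarrow> real \<Rightarrow> real ^ 'd ^ 'd \<Rightarrow> bool" where
  "balanced k1 k2 \<epsilon> Z \<longleftrightarrow>
     (\<exists>l :: real ^ 'd. (\<forall>j. \<epsilon> \<le> l $ j) \<and> (\<Sum>j\<in>UNIV. l $ j) = 1 \<and> (\<forall>c. c \<noteq> k1 \<longrightarrow> c \<noteq> k2 \<longrightarrow> l \<bullet> Z $ c = 0))"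

lemma balanced_cong:
  assumes "\<And>c. c \<noteq> k1 \<Longrightarrow> c \<noteq> k2 \<Longrightarrow> Z $ c = Z' $ c"
  shows "balanced k1 k2 \<epsilon> Z \<longleftrightarrow> balanced k1 k2 \<epsilon> Z'"
  unfolding balanced_def using assms by (simp cong: conj_cong imp_cong)

text \<open>Mix the old weights with the uniform ones in the ratio 1 - \<eta> to \<eta>. The uniform
  part contributes \<eta> b, with b the barycentre, and this cancels the translation by -\<eta>
  b.\<close>

lemma balanced_contract_base:
  assumes "balanced k1 k2 0 Z" "0 \<le> \<eta>" "\<eta> \<le> 1"
  shows "balanced k1 k2 (\<eta> / CARD('d)) (contract_base k2 \<eta> Z :: real ^ 'd ^ 'd)"
proof -
  obtain l :: "real ^ 'd" where l: "\<And>j. 0 \<le> l $ j" "(\<Sum>j\<in>UNIV. l $ j) = 1"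
    "\<And>c. c \<noteq> k1 \<Longrightarrow> c \<noteq> k2 \<Longrightarrow> l \<bullet> Z $ c = 0"
    using assms(1) by (auto simp: balanced_def)
  define l' where "l' = (1 - \<eta>) *\<^sub>R l + (\<eta> / CARD('d)) *\<^sub>R 1"
  have "\<eta> / CARD('d) \<le> l' $ j" for j
    using l assms by (simp add: l'_def)
  moreover have s: "(\<Sum>j\<in>UNIV. l' $ j) = 1"
    by (simp add: l'_def sum.distrib sum_distrib_left[symmetric] l(2))
  moreover have "l' \<bullet> contract_base k2 \<eta> Z $ c = 0" if "c \<noteq> k1" "c \<noteq> k2" for c
  proof -
    have m: "1 \<bullet> z = CARD('d) * mean z" for z :: "real ^ 'd"
      by (simp add: inner_vec_def mean_def)
    have "l' \<bullet> 1 = 1" using s by (simp add: inner_vec_def)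
    then show ?thesis
      using that l(3)[OF that]
      by (simp add: contract_base_nth inner_diff_right) (simp add: l'_def inner_add_left m)
  qed
  ultimately show ?thesis unfolding balanced_def by blast
qed

text \<open>Projection along a compact factor preserves closedness. This gives measurability of the
  two conditions that are stated with an existential quantifier, \<open>balanced\<close> and the
  cone condition of the shadow.\<close>

lemma closed_compact_ex:
  fixes C :: "('a::metric_space \<times> 'b::metric_space) set"
  assumes "compact K" "closed C"
  shows "closed {x. \<exists>y\<in>K. (x, y) \<in> C}"
proof -
  have "closed (fst ` (C \<inter> (UNIV \<times> K)))"
    unfolding closed_sequential_limits
  proof safe
    fix f :: "nat \<Rightarrow> 'a" and l assume f: "\<forall>n. f n \<in> fst ` (C \<inter> UNIV \<times> K)" and lim: "f \<longlonglongrightarrow> l"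
    then have "\<exists>y. \<forall>n. y n \<in> K \<and> (f n, y n) \<in> C" by (intro choice) fastforce
    then obtain y where y: "\<And>n. y n \<in> K" "\<And>n. (f n, y n) \<in> C" by auto
    then obtain r y0 where r: "strict_mono r" "y0 \<in> K" "(y \<circ> r) \<longlonglongrightarrow> y0"
      using assms(1) unfolding compact_def by metis
    have "(\<lambda>n. (f (r n), y (r n))) \<longlonglongrightarrow> (l, y0)"
      using r lim by (intro tendsto_Pair) (auto simp: o_def intro: LIMSEQ_subseq_LIMSEQ[unfolded o_def])
    then have "(l, y0) \<in> C"
      using assms(2) y(2) by (metis (no_types, lifting) closed_sequentially)
    then show "l \<in> fst ` (C \<inter> UNIV \<times> K)" using r(2) by force
  qed
  moreover have "fst ` (C \<inter> (UNIV \<times> K)) = {x. \<exists>y\<in>K. (x, y) \<in> C}" by force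
  ultimately show ?thesis by simp
qed

lemma closed_balanced:
  assumes "0 \<le> \<epsilon>"
  shows "closed {Z :: real ^ 'd ^ 'd. balanced k1 k2 \<epsilon> Z}"
proof -
  define K where "K = {l :: real ^ 'd. (\<forall>j. \<epsilon> \<le> l $ j) \<and> (\<Sum>j\<in>UNIV. l $ j) = 1}"
  have "closed K"
    unfolding K_def by (intro closed_Collect_conj closed_Collect_all closed_Collect_le closed_Collect_eq continuous_intros)
  moreover have "K \<subseteq> cbox 0 1"
  proof
    fix l assume l: "l \<in> K"
    have "l $ j \<le> (\<Sum>j\<in>UNIV. l $ j)" for j
      using l assms by (intro member_le_sum) (auto simp: K_def intro: order_trans)
    then show "l \<in> cbox 0 1" using l assms by (auto simp: K_def mem_box_cart intro: order_trans)
  qed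
  ultimately have "compact K" by (metis bounded_cbox bounded_subset compact_eq_bounded_closed)
  moreover have "closed {p :: (real ^ 'd ^ 'd) \<times> (real ^ 'd). \<forall>c. c \<noteq> k1 \<longrightarrow> c \<noteq> k2 \<longrightarrow> snd p \<bullet> (fst p $ c) = 0}"
    by (intro closed_Collect_all closed_Collect_imp closed_Collect_eq continuous_intros) auto
  ultimately have "closed {Z. \<exists>l\<in>K. (Z, l) \<in> {p :: (real ^ 'd ^ 'd) \<times> (real ^ 'd). \<forall>c. c \<noteq> k1 \<longrightarrow> c \<noteq> k2 \<longrightarrow> snd p \<bullet> (fst p $ c) = 0}}"
    by (rule closed_compact_ex)
  then show ?thesis by (simp add: balanced_def K_def Bex_def conj_assoc)
qed

lemma balanced_measurable:
  "0 \<le> \<epsilon> \<Longrightarrow> {Z :: real ^ 'd ^ 'd. balanced k1 k2 \<epsilon> Z} \<in> sets borel"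
  by (intro borel_closed closed_balanced)

section \<open>The integral inequality for a single facet\<close>

definition gauss_weight :: "real \<Rightarrow> 'a::real_normed_vector \<Rightarrow> 'a \<Rightarrow> real" where
  "gauss_weight \<sigma> m Z = exp (- (norm (Z - m))\<^sup>2 / (2 * \<sigma>\<^sup>2))"

lemma gauss_weight_measurable [measurable]:
  "gauss_weight \<sigma> (m :: 'a::euclidean_space) \<in> borel_measurable borel"
  unfolding gauss_weight_def[abs_def] by measurable

lemma gauss_weight_nonneg [simp]: "0 \<le> gauss_weight \<sigma> m Z"
  by (simp add: gauss_weight_def)

text \<open>By the triangle inequality the squared distance grows by at most 2 \<rho> \<delta> +
  \<delta>^2, hence the exponent drops by at most 1.\<close>

lemma gauss_weight_perturb:
  assumes "\<sigma> > 0" "norm (Z - m) \<le> \<rho>" "norm (Z' - Z) \<le> \<delta>" "2 * \<rho> * \<delta> + \<delta>\<^sup>2 \<le> 2 * \<sigma>\<^sup>2"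
  shows "gauss_weight \<sigma> m Z \<le> exp 1 * gauss_weight \<sigma> m Z'"
proof -
  have "norm (Z' - m) \<le> norm (Z - m) + \<delta>"
    using norm_triangle_ineq[of "Z' - Z" "Z - m"] assms(3) by simp
  then have "(norm (Z' - m))\<^sup>2 \<le> (norm (Z - m) + \<delta>)\<^sup>2" by (intro power_mono) auto
  also have "\<dots> = (norm (Z - m))\<^sup>2 + 2 * norm (Z - m) * \<delta> + \<delta>\<^sup>2" by (simp add: power2_sum)
  also have "\<dots> \<le> (norm (Z - m))\<^sup>2 + 2 * \<rho> * \<delta> + \<delta>\<^sup>2"
    using assms order_trans[OF norm_ge_zero assms(3)] by (intro add_mono mult_right_mono mult_left_mono) auto
  finally have "(norm (Z' - m))\<^sup>2 \<le> (norm (Z - m))\<^sup>2 + 2 * \<sigma>\<^sup>2" using assms(4) by simp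
  then have "- (norm (Z - m))\<^sup>2 / (2 * \<sigma>\<^sup>2) \<le> 1 + - (norm (Z' - m))\<^sup>2 / (2 * \<sigma>\<^sup>2)"
    using assms(1) by (simp add: field_simps)
  then show ?thesis unfolding gauss_weight_def exp_add[symmetric] by simp
qed

text \<open>By the parallelogram law the product equals the square of the weight at \<open>Z\<close>
  times exp(-|V|^2/\<sigma>^2), which is at least exp(-2). The 3 is a rational upper bound for
  e.\<close>

lemma gauss_weight_symmetric_product:
  fixes m Z V :: "'a::real_inner"
  assumes "\<sigma> > 0" "(norm V)\<^sup>2 \<le> 2 * \<sigma>\<^sup>2"
  shows "(gauss_weight \<sigma> m Z / 3)\<^sup>2 \<le> gauss_weight \<sigma> m (Z + V) * gauss_weight \<sigma> m (Z - V)"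
proof -
  have p: "(norm (Z + V - m))\<^sup>2 + (norm (Z - V - m))\<^sup>2 = 2 * (norm (Z - m))\<^sup>2 + 2 * (norm V)\<^sup>2"
    by (simp add: power2_norm_eq_inner inner_diff inner_add inner_commute algebra_simps)
  have "exp (2::real) \<le> 9"
  proof -
    have "exp (1::real) ^ 2 \<le> 3 ^ 2" by (intro power_mono exp_le) auto
    then show ?thesis by (simp add: exp_double[symmetric])
  qed
  then have "(1::real) / 9 \<le> exp (- 2)" by (simp add: exp_minus divide_simps)
  then have "(gauss_weight \<sigma> m Z / 3)\<^sup>2 \<le> exp (- 2) * (gauss_weight \<sigma> m Z)\<^sup>2"
    by (simp add: power_divide mult_right_mono[of "1/9" _ "(gauss_weight \<sigma> m Z)\<^sup>2", simplified])
  also have "\<dots> = exp (- 2 + 2 * (- (norm (Z - m))\<^sup>2 / (2 * \<sigma>\<^sup>2)))"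
    unfolding gauss_weight_def exp_add exp_double by simp
  also have "\<dots> \<le> exp (- (norm (Z + V - m))\<^sup>2 / (2 * \<sigma>\<^sup>2) + - (norm (Z - V - m))\<^sup>2 / (2 * \<sigma>\<^sup>2))"
  proof -
    have lin: "- (2 * a + 2 * b) / (2 * c) = 2 * (- a / (2 * c)) - b / c" if "c \<noteq> 0" for a b c :: real
      using that by (simp add: field_simps)
    have "- (norm (Z + V - m))\<^sup>2 / (2 * \<sigma>\<^sup>2) + - (norm (Z - V - m))\<^sup>2 / (2 * \<sigma>\<^sup>2)
        = - (2 * (norm (Z - m))\<^sup>2 + 2 * (norm V)\<^sup>2) / (2 * \<sigma>\<^sup>2)"
      unfolding p[symmetric] by (simp add: add_divide_distrib diff_divide_distrib)
    moreover have "- (2 * (norm (Z - m))\<^sup>2 + 2 * (norm V)\<^sup>2) / (2 * \<sigma>\<^sup>2)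
        = 2 * (- (norm (Z - m))\<^sup>2 / (2 * \<sigma>\<^sup>2)) - (norm V)\<^sup>2 / \<sigma>\<^sup>2"
      using assms(1) by (intro lin) simp
    moreover have "(norm V)\<^sup>2 / \<sigma>\<^sup>2 \<le> 2"
      using assms by (simp add: divide_le_eq)
    ultimately show ?thesis by simp
  qed
  also have "\<dots> = gauss_weight \<sigma> m (Z + V) * gauss_weight \<sigma> m (Z - V)"
    unfolding gauss_weight_def exp_add ..
  finally show ?thesis .
qed

text \<open>An anti-concentration estimate that uses nothing about \<open>w\<close> beyond the midpoint bound:
  averaging over the translates by \<open>v\<close> and \<open>-v\<close>, AM-GM gives
  \<open>a (Z + s)\<^sup>2 + b (Z - s)\<^sup>2 \<ge> 2 sqrt (a b) \<bar>Z\<^sup>2 - s\<^sup>2\<bar>\<close>.\<close>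
lemma nn_integral_linear_abs_le_square:
  fixes w :: "'a::euclidean_space \<Rightarrow> real" and g v :: 'a
  assumes [measurable]: "w \<in> borel_measurable borel" and w: "\<And>x. 0 \<le> w x"
    and prod: "\<And>x. (w x / 3)\<^sup>2 \<le> w (x + v) * w (x - v)"
    and s: "0 < g \<bullet> v"
  shows "(\<integral>\<^sup>+x. ennreal (\<bar>g \<bullet> x\<bar> * w x) \<partial>lborel)
    \<le> (\<integral>\<^sup>+x. ennreal (2 / (g \<bullet> v) * (g \<bullet> x)\<^sup>2 * w x) \<partial>lborel)"
proof -
  let ?s = "g \<bullet> v"
  let ?J = "\<lambda>f. \<integral>\<^sup>+x. ennreal (f x) \<partial>lborel"
  have J_add: "?J (\<lambda>x. f x + h x) = ?J f + ?J h"
    if [measurable]: "f \<in> borel_measurable borel" "h \<in> borel_measurable borel"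
      and "\<And>x. 0 \<le> f x" "\<And>x. 0 \<le> h x" for f h :: "'a \<Rightarrow> real"
    using that(3,4) by (simp add: ennreal_plus nn_integral_add)
  have J_cmult: "?J (\<lambda>x. c * f x) = ennreal c * ?J f"
    if [measurable]: "f \<in> borel_measurable borel" and "0 \<le> c" for f :: "'a \<Rightarrow> real" and c
    using that(2) by (simp add: ennreal_mult' nn_integral_cmult)
  have plus: "?J (\<lambda>x. (g \<bullet> x + ?s)\<^sup>2 * w (x + v)) = ?J (\<lambda>x. (g \<bullet> x)\<^sup>2 * w x)"
    using nn_integral_lborel_translation[of "\<lambda>x. ennreal ((g \<bullet> x)\<^sup>2 * w x)" v]
    by (simp add: inner_add_right)
  have minus: "?J (\<lambda>x. (g \<bullet> x - ?s)\<^sup>2 * w (x - v)) = ?J (\<lambda>x. (g \<bullet> x)\<^sup>2 * w x)"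
    using nn_integral_lborel_translation[of "\<lambda>x. ennreal ((g \<bullet> x)\<^sup>2 * w x)" "- v"]
    by (simp add: inner_diff_right)
  have four_mult: "4 * p * q \<le> (p + q)\<^sup>2" for p q :: real
    using zero_le_power2[of "p - q"] by (simp add: power2_sum power2_diff algebra_simps)
  have pt: "?s\<^sup>2 / 3 * w x * 2 \<le> (g \<bullet> x + ?s)\<^sup>2 * w (x + v) + (g \<bullet> x - ?s)\<^sup>2 * w (x - v) + 2 / 3 * ((g \<bullet> x)\<^sup>2 * w x)" for x
  proof -
    let ?a = "w (x + v)" and ?b = "w (x - v)" and ?z = "g \<bullet> x"
    have "(2 * (\<bar>(?z + ?s) * (?z - ?s)\<bar> * (w x / 3)))\<^sup>2 = 4 * ((?z + ?s) * (?z - ?s))\<^sup>2 * (w x / 3)\<^sup>2"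
      by (simp add: power_mult_distrib power_divide)
    also have "\<dots> \<le> 4 * ((?z + ?s) * (?z - ?s))\<^sup>2 * (?a * ?b)"
      by (intro mult_left_mono prod) auto
    also have "\<dots> = 4 * ((?z + ?s)\<^sup>2 * ?a) * ((?z - ?s)\<^sup>2 * ?b)"
      by (simp add: power_mult_distrib)
    also have "\<dots> \<le> ((?z + ?s)\<^sup>2 * ?a + (?z - ?s)\<^sup>2 * ?b)\<^sup>2"
      by (rule four_mult)
    finally have "2 * (\<bar>(?z + ?s) * (?z - ?s)\<bar> * (w x / 3)) \<le> (?z + ?s)\<^sup>2 * ?a + (?z - ?s)\<^sup>2 * ?b"
      by (rule power2_le_imp_le) (simp add: w)
    moreover have "(?s\<^sup>2 - ?z\<^sup>2) * (w x / 3) \<le> \<bar>(?z + ?s) * (?z - ?s)\<bar> * (w x / 3)"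
    proof -
      have e: "(?z + ?s) * (?z - ?s) = ?z\<^sup>2 - ?s\<^sup>2" by (simp add: power2_eq_square algebra_simps)
      show ?thesis unfolding e using w by (intro mult_right_mono) auto
    qed
    ultimately show ?thesis by (simp add: algebra_simps)
  qed
  have "ennreal (2 * ?s\<^sup>2 / 3) * ?J w \<le> ennreal (8 / 3) * ?J (\<lambda>x. (g \<bullet> x)\<^sup>2 * w x)"
  proof -
    have "ennreal (2 * ?s\<^sup>2 / 3) * ?J w = ?J (\<lambda>x. ?s\<^sup>2 / 3 * w x * 2)"
    proof -
      have "ennreal (2 * ?s\<^sup>2 / 3) * ennreal (w x) = ennreal (?s\<^sup>2 / 3 * w x * 2)" for x
        by (subst ennreal_mult'[symmetric]) (simp_all add: field_simps)
      then show ?thesis by (subst nn_integral_cmult[symmetric]) auto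
    qed
    also have "\<dots> \<le> ?J (\<lambda>x. (g \<bullet> x + ?s)\<^sup>2 * w (x + v) + (g \<bullet> x - ?s)\<^sup>2 * w (x - v) + 2 / 3 * ((g \<bullet> x)\<^sup>2 * w x))"
      by (intro nn_integral_mono ennreal_leI pt)
    also have "\<dots> = ?J (\<lambda>x. (g \<bullet> x + ?s)\<^sup>2 * w (x + v) + (g \<bullet> x - ?s)\<^sup>2 * w (x - v))
        + ?J (\<lambda>x. 2 / 3 * ((g \<bullet> x)\<^sup>2 * w x))"
      by (rule J_add) (auto simp: w)
    also have "?J (\<lambda>x. (g \<bullet> x + ?s)\<^sup>2 * w (x + v) + (g \<bullet> x - ?s)\<^sup>2 * w (x - v))
        = ?J (\<lambda>x. (g \<bullet> x + ?s)\<^sup>2 * w (x + v)) + ?J (\<lambda>x. (g \<bullet> x - ?s)\<^sup>2 * w (x - v))"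
      by (rule J_add) (auto simp: w)
    also have "?J (\<lambda>x. 2 / 3 * ((g \<bullet> x)\<^sup>2 * w x)) = ennreal (2 / 3) * ?J (\<lambda>x. (g \<bullet> x)\<^sup>2 * w x)"
      by (rule J_cmult) auto
    also have "?J (\<lambda>x. (g \<bullet> x + ?s)\<^sup>2 * w (x + v)) + ?J (\<lambda>x. (g \<bullet> x - ?s)\<^sup>2 * w (x - v))
        + ennreal (2 / 3) * ?J (\<lambda>x. (g \<bullet> x)\<^sup>2 * w x) = (1 + 1 + ennreal (2 / 3)) * ?J (\<lambda>x. (g \<bullet> x)\<^sup>2 * w x)"
      unfolding plus minus by (simp only: distrib_right mult_1_left)
    also have "(1 + 1 + ennreal (2 / 3)) = ennreal (8 / 3)"
      using ennreal_plus[of "1 + 1" "2 / 3"] by simp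
    finally show ?thesis .
  qed
  then have "ennreal (3 / 8) * (ennreal (2 * ?s\<^sup>2 / 3) * ?J w) \<le> ennreal (3 / 8) * (ennreal (8 / 3) * ?J (\<lambda>x. (g \<bullet> x)\<^sup>2 * w x))"
    by (rule mult_left_mono) simp
  \<comment> \<open>Both translates have the same integral as the centred term, so the right-hand
    side carries 1 + 1 + 2/3 = 8/3. The outcome is a lower bound for the second moment of
    \<open>g \<bullet> x\<close> in terms of the total mass.\<close>
  then have var: "ennreal (?s\<^sup>2 / 4) * ?J w \<le> ?J (\<lambda>x. (g \<bullet> x)\<^sup>2 * w x)"
    by (simp add: mult.assoc[symmetric] ennreal_mult'[symmetric])
  \<comment> \<open>AM-GM balanced at s/2: after integration, the mass term s/4 is by
    \<open>var\<close> no larger than the second-moment term 1/s, so the two add up to 2/s.\<close>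
  have amgm: "\<bar>g \<bullet> x\<bar> * w x \<le> ?s / 4 * w x + 1 / ?s * ((g \<bullet> x)\<^sup>2 * w x)" for x
  proof -
    have "0 \<le> (\<bar>g \<bullet> x\<bar> - ?s / 2)\<^sup>2" by simp
    then have "\<bar>g \<bullet> x\<bar> * ?s \<le> ?s\<^sup>2 / 4 + (g \<bullet> x)\<^sup>2" by (simp add: power2_diff power_divide)
    then have "\<bar>g \<bullet> x\<bar> \<le> ?s / 4 + 1 / ?s * (g \<bullet> x)\<^sup>2" using s by (simp add: field_simps power2_eq_square)
    then show ?thesis using w[of x] by (metis (no_types) distrib_right mult.assoc mult_right_mono)
  qed
  have "?J (\<lambda>x. \<bar>g \<bullet> x\<bar> * w x) \<le> ?J (\<lambda>x. ?s / 4 * w x + 1 / ?s * ((g \<bullet> x)\<^sup>2 * w x))"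
    by (intro nn_integral_mono ennreal_leI amgm)
  also have "\<dots> = ?J (\<lambda>x. ?s / 4 * w x) + ?J (\<lambda>x. 1 / ?s * ((g \<bullet> x)\<^sup>2 * w x))"
    using w s by (intro J_add) auto
  also have "?J (\<lambda>x. ?s / 4 * w x) = ennreal (?s / 4) * ?J w"
    using s by (intro J_cmult) auto
  also have "?J (\<lambda>x. 1 / ?s * ((g \<bullet> x)\<^sup>2 * w x)) = ennreal (1 / ?s) * ?J (\<lambda>x. (g \<bullet> x)\<^sup>2 * w x)"
    using s by (intro J_cmult) auto
  also have "ennreal (?s / 4) * ?J w = ennreal (1 / ?s) * (ennreal (?s\<^sup>2 / 4) * ?J w)"
    using s by (simp add: mult.assoc[symmetric] ennreal_mult'[symmetric] power2_eq_square)
  also have "\<dots> + ennreal (1 / ?s) * ?J (\<lambda>x. (g \<bullet> x)\<^sup>2 * w x)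
      \<le> ennreal (1 / ?s) * ?J (\<lambda>x. (g \<bullet> x)\<^sup>2 * w x) + ennreal (1 / ?s) * ?J (\<lambda>x. (g \<bullet> x)\<^sup>2 * w x)"
    by (intro add_mono mult_left_mono var) auto
  also have "\<dots> = ennreal (2 / ?s) * ?J (\<lambda>x. (g \<bullet> x)\<^sup>2 * w x)"
    using s by (simp add: distrib_right[symmetric] ennreal_plus[symmetric] del: ennreal_plus)
  also have "\<dots> = ?J (\<lambda>x. 2 / ?s * (g \<bullet> x)\<^sup>2 * w x)"
    using s by (subst nn_integral_cmult[symmetric]) (auto simp: ennreal_mult'[symmetric] mult.assoc)
  finally show ?thesis .
qed

section \<open>The chord of a facet\<close>

text \<open>The cofactors of row \<open>k1\<close> in the matrix whose row \<open>k2\<close> is all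
  ones. The vector is orthogonal to the all-ones row and to every row other than \<open>k1\<close>
  and \<open>k2\<close>; it is therefore the direction in which barycentric weights can move while
  their sum stays 1 and the weighted point stays on the line.\<close>

definition slope_cofactor :: "'d \<Rightarrow> 'd \<Rightarrow> real ^ 'd ^ 'd \<Rightarrow> real ^ 'd" where
  "slope_cofactor k1 k2 Z = (\<chi> j. det (row_update (row_update Z k2 1) k1 (axis j 1)))"

lemma slope_cofactor_measurable [measurable]: "slope_cofactor k1 k2 \<in> borel_measurable borel"
  unfolding slope_cofactor_def[abs_def] by measurable

lemma slope_cofactor_row_update1 [simp]: "k1 \<noteq> k2 \<Longrightarrow> slope_cofactor k1 k2 (row_update Z k1 x) = slope_cofactor k1 k2 Z"
  by (simp add: slope_cofactor_def row_update_commute[of k1 k2])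

lemma slope_cofactor_row_update2 [simp]: "slope_cofactor k1 k2 (row_update Z k2 x) = slope_cofactor k1 k2 Z"
  by (simp add: slope_cofactor_def)

lemma slope_cofactor_inner:
  fixes Z :: "real ^ 'd ^ 'd"
  assumes "k1 \<noteq> k2"
  shows "slope_cofactor k1 k2 Z \<bullet> x = det (row_update (row_update Z k2 1) k1 x)"
proof -
  let ?B = "row_update Z k2 1"
  have "det (row_update ?B k1 x) = det (\<chi> i. if i = k1 then (\<Sum>j\<in>UNIV. x $ j *s axis j 1) else ?B $ i)"
    by (simp only: basis_expansion row_update_def)
  also have "\<dots> = (\<Sum>j\<in>UNIV. det (\<chi> i. if i = k1 then x $ j *s axis j 1 else ?B $ i))"
    by (rule det_linear_row_sum) simp
  also have "\<dots> = (\<Sum>j\<in>UNIV. x $ j * det (row_update ?B k1 (axis j 1)))"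
    by (simp only: det_row_mul row_update_def[of ?B])
  finally show ?thesis by (simp add: slope_cofactor_def inner_vec_def mult.commute)
qed

lemma base_det_slope:
  "k1 \<noteq> k2 \<Longrightarrow> base_det k2 Z = slope_cofactor k1 k2 Z \<bullet> Z $ k1"
  by (simp add: slope_cofactor_inner base_det_def row_update_commute[of k1 k2])
     (metis row_update_other row_update_triv)

lemma slope_cofactor_orthogonal:
  assumes "k1 \<noteq> k2" "c \<noteq> k1" "c \<noteq> k2"
  shows "slope_cofactor k1 k2 Z \<bullet> Z $ c = 0"
  unfolding slope_cofactor_inner[OF assms(1)]
  by (rule det_identical_rows[of k1 c]) (use assms in \<open>auto simp: row_def row_update_nth vec_eq_iff\<close>)

lemma slope_cofactor_one:
  assumes "k1 \<noteq> k2"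
  shows "slope_cofactor k1 k2 Z \<bullet> 1 = 0"
  unfolding slope_cofactor_inner[OF assms(1)]
  by (rule det_identical_rows[of k1 k2]) (use assms in \<open>auto simp: row_def row_update_nth vec_eq_iff\<close>)

text \<open>If weights of size at least \<epsilon> move by s times \<open>slope_cofactor\<close>,
  they stay positive as long as |s| times its norm is below \<epsilon>, and the weighted point moves
  along the line by s times \<open>base_det\<close>. For a balanced configuration this is thus a
  lower bound for the full chord. It replaces the full chord because, as row \<open>k1\<close>
  varies, it is a constant multiple of the Jacobian.\<close>

definition chord :: "'d \<Rightarrow> 'd \<Rightarrow> real \<Rightarrow> real ^ 'd ^ 'd \<Rightarrow> real" where
  "chord k1 k2 \<epsilon> Z = 2 * \<epsilon> * \<bar>base_det k2 Z\<bar> / norm (slope_cofactor k1 k2 Z)"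

lemma chord_measurable [measurable]: "chord k1 k2 \<epsilon> \<in> borel_measurable borel"
  unfolding chord_def[abs_def] by measurable

lemma norm_vec_le_sum: "norm (x :: 'b::real_normed_vector ^ 'n) \<le> (\<Sum>i\<in>UNIV. norm (x $ i))"
  unfolding norm_vec_def by (rule L2_set_le_sum) simp

lemma norm_one_vec: "norm (1 :: real ^ 'n) = sqrt CARD('n)"
  by (simp add: norm_eq_sqrt_inner inner_vec_def)

lemma abs_mean_le: "\<bar>mean (z :: real ^ 'n)\<bar> * sqrt CARD('n) \<le> norm z"
proof -
  let ?d = "real CARD('n)"
  have "\<bar>1 \<bullet> z\<bar> \<le> sqrt ?d * norm z"
    using Cauchy_Schwarz_ineq2[of 1 z] by (simp add: norm_one_vec)
  moreover have "1 \<bullet> z = ?d * mean z" by (simp add: inner_vec_def mean_def)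
  ultimately have "sqrt ?d * (sqrt ?d * \<bar>mean z\<bar>) \<le> sqrt ?d * norm z"
    by (simp add: abs_mult mult.assoc[symmetric])
  then show ?thesis by (simp add: mult.commute)
qed

lemma mean_add: "mean (x + y) = mean x + mean y"
  by (simp add: mean_def sum.distrib add_divide_distrib)

lemma mean_scaleR: "mean (a *\<^sub>R x) = a * mean x"
  by (simp add: mean_def sum_distrib_left[symmetric])

lemma mean_sum: "mean (\<Sum>i\<in>S. f i) = (\<Sum>i\<in>S. mean (f i))"
  by (induction S rule: infinite_finite_induct) (simp_all add: mean_add, simp_all add: mean_def)

lemma mean_one: "mean (1 :: real ^ 'n) = 1"
  by (simp add: mean_def)

text \<open>All heights change by the same amount, \<eta> times the difference between the intercept
  and the mean height. The intercept is the part at risk. At the point where the line meets the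
  simplex every horizontal coordinate except the one along \<open>k1\<close> vanishes, so the
  intercept is the height there minus slope times position; both are bounded by the norm of the
  configuration, the slope being at most 1.\<close>

lemma graph_config_contract_base_displacement:
  fixes Z :: "real ^ 'd ^ 'd" and \<eta> :: real
  assumes "k1 \<noteq> k2" "balanced k1 k2 0 Z" "\<bar>Z $ k2 $ k1\<bar> \<le> 1" "0 \<le> \<eta>"
  shows "norm (graph_config k2 (contract_base k2 \<eta> Z) - graph_config k2 Z)
    \<le> 3 * real CARD('d) * \<eta> * norm (graph_config k2 Z)"
proof -
  let ?X = "graph_config k2 Z" and ?X' = "graph_config k2 (contract_base k2 \<eta> Z)" and ?d = "real CARD('d)"
  have d1: "1 \<le> ?d" by (simp add: Suc_leI)
  have sd: "sqrt ?d \<le> ?d"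
    using d1 real_sqrt_le_mono[of ?d "?d * ?d"] by simp
  have rX: "norm (?X $ c) \<le> norm ?X" for c by (rule Finite_Cartesian_Product.norm_nth_le)
  obtain l :: "real ^ 'd" where l: "\<And>j. 0 \<le> l $ j" "(\<Sum>j\<in>UNIV. l $ j) = 1"
    "\<And>c. c \<noteq> k1 \<Longrightarrow> c \<noteq> k2 \<Longrightarrow> l \<bullet> Z $ c = 0"
    using assms(2) by (auto simp: balanced_def)
  have nl: "norm l \<le> 1" using norm_le_l1_cart[of l] l by simp
  have li: "\<bar>l \<bullet> ?X $ c\<bar> \<le> norm ?X" for c
  proof -
    have "\<bar>l \<bullet> ?X $ c\<bar> \<le> norm l * norm (?X $ c)" by (rule Cauchy_Schwarz_ineq2)
    also have "\<dots> \<le> 1 * norm ?X" using nl rX by (intro mult_mono) auto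
    finally show ?thesis by simp
  qed
  have h: "?X $ k2 = Z $ k2 $ k2 *\<^sub>R 1 + (\<Sum>c\<in>-{k2}. Z $ k2 $ c *\<^sub>R Z $ c)"
    by (simp add: graph_config_def heights_sum)
  have h': "?X' $ k2 = Z $ k2 $ k2 *\<^sub>R 1 + (\<Sum>c\<in>-{k2}. Z $ k2 $ c *\<^sub>R (Z $ c - (\<eta> * mean (Z $ c)) *\<^sub>R 1))"
    by (simp add: graph_config_def heights_sum contract_base_nth)
  have "l \<bullet> ?X $ k2 = Z $ k2 $ k2 * (l \<bullet> 1) + (\<Sum>c\<in>-{k2}. Z $ k2 $ c * (l \<bullet> Z $ c))"
    by (simp add: h inner_add_right inner_sum_right)
  also have "(\<Sum>c\<in>-{k2}. Z $ k2 $ c * (l \<bullet> Z $ c)) = (\<Sum>c\<in>-{k2}. if c = k1 then Z $ k2 $ k1 * (l \<bullet> Z $ k1) else 0)"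
    by (rule sum.cong) (auto simp: l(3))
  also have "\<dots> = Z $ k2 $ k1 * (l \<bullet> Z $ k1)" using assms(1) by simp
  also have "l \<bullet> 1 = 1" using l(2) by (simp add: inner_vec_def)
  finally have "Z $ k2 $ k2 = l \<bullet> ?X $ k2 - Z $ k2 $ k1 * (l \<bullet> ?X $ k1)" using assms(1) by simp
  then have "\<bar>Z $ k2 $ k2\<bar> \<le> \<bar>l \<bullet> ?X $ k2\<bar> + \<bar>Z $ k2 $ k1\<bar> * \<bar>l \<bullet> ?X $ k1\<bar>"
    by (simp add: abs_mult[symmetric])
  also have "\<dots> \<le> norm ?X + 1 * norm ?X"
    using assms(3) li by (intro add_mono mult_mono) auto
  finally have b: "\<bar>Z $ k2 $ k2\<bar> \<le> 2 * norm ?X" by simp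
  have mX: "\<bar>mean (?X $ c)\<bar> * sqrt ?d \<le> norm ?X" for c
    using abs_mean_le[of "?X $ c"] rX[of c] by linarith
  have r1: "norm ((?X' - ?X) $ c) \<le> \<eta> * norm ?X" if "c \<noteq> k2" for c
  proof -
    have "(?X' - ?X) $ c = - ((\<eta> * mean (?X $ c)) *\<^sub>R 1)"
      using that by (simp add: contract_base_nth)
    then have "norm ((?X' - ?X) $ c) = \<eta> * (\<bar>mean (?X $ c)\<bar> * sqrt ?d)"
      using assms(4) by (simp only: norm_minus_cancel norm_scaleR norm_one_vec abs_mult abs_of_nonneg mult.assoc)
    also have "\<dots> \<le> \<eta> * norm ?X" using mX assms(4) by (intro mult_left_mono) auto
    finally show ?thesis .
  qed
  have "mean (?X $ k2) = Z $ k2 $ k2 + (\<Sum>c\<in>-{k2}. Z $ k2 $ c * mean (Z $ c))"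
    by (simp add: h mean_add mean_scaleR mean_sum mean_one)
  then have "(?X' - ?X) $ k2 = - ((\<eta> * (mean (?X $ k2) - Z $ k2 $ k2)) *\<^sub>R 1)"
    unfolding vector_minus_component h' h
    by (simp add: scaleR_diff_right sum_subtractf sum_distrib_left scaleR_sum_left mult_ac)
  then have "norm ((?X' - ?X) $ k2) = \<eta> * (\<bar>mean (?X $ k2) - Z $ k2 $ k2\<bar> * sqrt ?d)"
    using assms(4) by (simp only: norm_minus_cancel norm_scaleR norm_one_vec abs_mult abs_of_nonneg mult.assoc)
  also have "\<dots> \<le> \<eta> * (norm ?X + 2 * norm ?X * ?d)"
  proof (intro mult_left_mono assms(4))
    have "\<bar>mean (?X $ k2) - Z $ k2 $ k2\<bar> * sqrt ?d \<le> (\<bar>mean (?X $ k2)\<bar> + \<bar>Z $ k2 $ k2\<bar>) * sqrt ?d"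
      by (intro mult_right_mono) auto
    also have "\<dots> \<le> norm ?X + 2 * norm ?X * ?d"
      unfolding distrib_right using b sd by (intro add_mono mX mult_mono) auto
    finally show "\<bar>mean (?X $ k2) - Z $ k2 $ k2\<bar> * sqrt ?d \<le> norm ?X + 2 * norm ?X * ?d" .
  qed
  finally have r2: "norm ((?X' - ?X) $ k2) \<le> \<eta> * (norm ?X + 2 * norm ?X * ?d)" .
  have "norm (?X' - ?X) \<le> (\<Sum>c\<in>UNIV. norm ((?X' - ?X) $ c))" by (rule norm_vec_le_sum)
  also have "\<dots> = norm ((?X' - ?X) $ k2) + (\<Sum>c\<in>UNIV - {k2}. norm ((?X' - ?X) $ c))"
    by (subst sum.remove[of _ k2]) auto
  also have "\<dots> \<le> \<eta> * (norm ?X + 2 * norm ?X * ?d) + (\<Sum>c\<in>UNIV - {k2}. \<eta> * norm ?X)"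
    using r1 by (intro add_mono r2 sum_mono) auto
  also have "(\<Sum>c\<in>UNIV - {k2}. \<eta> * norm ?X) = (?d - 1) * (\<eta> * norm ?X)"
    by (simp add: card_Diff_singleton of_nat_diff Suc_leI)
  \<comment> \<open>In units of \<eta> \<open>norm ?X\<close>, row \<open>k2\<close> contributes 1 +
    2d and each of the other d - 1 rows contributes 1, which gives 3d.\<close>
  also have "\<eta> * (norm ?X + 2 * norm ?X * ?d) + (?d - 1) * (\<eta> * norm ?X) = 3 * ?d * \<eta> * norm ?X"
    by (simp add: algebra_simps)
  finally show ?thesis .
qed

lemma contract_base_measurable [measurable]: "contract_base k \<eta> \<in> borel_measurable borel"
  unfolding contract_base_def[abs_def] by measurable

text \<open>Substituting the translated simplex costs a factor 1 - \<eta> for each of the d - 1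
  moved rows and \<open>exp 1\<close> for the density; Jacobian and hyperplane are unchanged. In
  return the weights on the right are at least \<eta>/d.\<close>

lemma nn_integral_contract_base_le:
  fixes m :: "real ^ 'd ^ 'd" and \<eta> \<epsilon> \<sigma> \<rho> \<delta> :: real
  assumes \<sigma>: "\<sigma> > 0" and k: "k1 \<noteq> k2" and \<eta>: "0 \<le> \<eta>" "\<eta> < 1" and Q [measurable]: "Q \<in> sets borel"
    and slope: "\<And>F. F \<in> Q \<Longrightarrow> \<bar>F $ k1\<bar> \<le> 1"
    and \<delta>: "\<delta> = 3 * real CARD('d) * \<eta> * (norm m + \<rho>)" "2 * \<rho> * \<delta> + \<delta>\<^sup>2 \<le> 2 * \<sigma>\<^sup>2"
  shows "(\<integral>\<^sup>+Z. ennreal \<bar>base_det k2 Z\<bar> * indicator Q (Z $ k2) *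
      (indicator {Z. balanced k1 k2 0 Z} Z * indicator {Z. norm (Z - m) \<le> \<rho>} (graph_config k2 Z) *
       ennreal (gauss_weight \<sigma> m (graph_config k2 Z))) \<partial>lborel)
    \<le> ennreal (exp 1 / (1 - \<eta>) ^ (CARD('d) - 1)) *
      (\<integral>\<^sup>+Z. ennreal \<bar>base_det k2 Z\<bar> * indicator Q (Z $ k2) *
        (indicator {Z. balanced k1 k2 (\<eta> / CARD('d)) Z} Z * ennreal (gauss_weight \<sigma> m (graph_config k2 Z))) \<partial>lborel)"
proof -
  note [measurable] = balanced_measurable[of 0 k1 k2] 
  have [measurable]: "{Z. balanced k1 k2 (\<eta> / CARD('d)) (Z :: real ^ 'd ^ 'd)} \<in> sets borel"
    using \<eta> by (intro balanced_measurable) auto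
  define H where "H Z = ennreal \<bar>base_det k2 Z\<bar> * indicator Q (Z $ k2) *
        (indicator {Z. balanced k1 k2 (\<eta> / CARD('d)) Z} Z * ennreal (gauss_weight \<sigma> m (graph_config k2 Z)))"
    for Z :: "real ^ 'd ^ 'd"
  have [measurable]: "H \<in> borel_measurable borel" unfolding H_def[abs_def] by measurable
  have card: "card (- {k2} :: 'd set) = CARD('d) - 1" by (simp add: Compl_eq_Diff_UNIV card_Diff_singleton)
  have int: "(\<integral>\<^sup>+Z. H Z \<partial>lborel) = ennreal ((1 - \<eta>) ^ (CARD('d) - 1)) * (\<integral>\<^sup>+Z. H (contract_base k2 \<eta> Z) \<partial>lborel)"
    using nn_integral_rows_linear_subst[of H "contraction \<eta>" "- {k2}"] \<eta>
    by (simp add: det_contraction card contract_base_def)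
  have "(\<integral>\<^sup>+Z. ennreal \<bar>base_det k2 Z\<bar> * indicator Q (Z $ k2) *
      (indicator {Z. balanced k1 k2 0 Z} Z * indicator {Z. norm (Z - m) \<le> \<rho>} (graph_config k2 Z) *
       ennreal (gauss_weight \<sigma> m (graph_config k2 Z))) \<partial>lborel)
     \<le> (\<integral>\<^sup>+Z. ennreal (exp 1) * H (contract_base k2 \<eta> Z) \<partial>lborel)"
  proof (rule nn_integral_mono)
    fix Z :: "real ^ 'd ^ 'd"
    show "ennreal \<bar>base_det k2 Z\<bar> * indicator Q (Z $ k2) *
      (indicator {Z. balanced k1 k2 0 Z} Z * indicator {Z. norm (Z - m) \<le> \<rho>} (graph_config k2 Z) *
       ennreal (gauss_weight \<sigma> m (graph_config k2 Z))) \<le> ennreal (exp 1) * H (contract_base k2 \<eta> Z)"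
    proof (cases "Z $ k2 \<in> Q \<and> balanced k1 k2 0 Z \<and> norm (graph_config k2 Z - m) \<le> \<rho>")
      case True
      then have X: "norm (graph_config k2 Z) \<le> norm m + \<rho>"
        using norm_triangle_ineq[of m "graph_config k2 Z - m"] by simp
      have "norm (graph_config k2 (contract_base k2 \<eta> Z) - graph_config k2 Z)
          \<le> 3 * real CARD('d) * \<eta> * norm (graph_config k2 Z)"
        using True slope \<eta> k by (intro graph_config_contract_base_displacement) auto
      also have "\<dots> \<le> \<delta>" unfolding \<delta>(1) using X \<eta> by (intro mult_left_mono) auto
      finally have "gauss_weight \<sigma> m (graph_config k2 Z)
          \<le> exp 1 * gauss_weight \<sigma> m (graph_config k2 (contract_base k2 \<eta> Z))"
        using True by (intro gauss_weight_perturb[OF \<sigma> _ _ \<delta>(2)]) auto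
      then have "ennreal \<bar>base_det k2 Z\<bar> * ennreal (gauss_weight \<sigma> m (graph_config k2 Z))
         \<le> ennreal \<bar>base_det k2 Z\<bar> * ennreal (exp 1 * gauss_weight \<sigma> m (graph_config k2 (contract_base k2 \<eta> Z)))"
        by (intro mult_left_mono ennreal_leI) auto
      moreover have "contract_base k2 \<eta> Z $ k2 = Z $ k2" by (simp add: contract_base_nth)
      moreover have "balanced k1 k2 (\<eta> / CARD('d)) (contract_base k2 \<eta> Z)"
        using True \<eta> by (intro balanced_contract_base) auto
      ultimately show ?thesis
        using True by (simp add: H_def base_det_contract_base ennreal_mult mult_ac)
    qed auto
  qed
  also have "\<dots> = ennreal (exp 1) * (\<integral>\<^sup>+Z. H (contract_base k2 \<eta> Z) \<partial>lborel)"
    by (rule nn_integral_cmult) measurable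
  also have "\<dots> = ennreal (exp 1 / (1 - \<eta>) ^ (CARD('d) - 1)) * (\<integral>\<^sup>+Z. H Z \<partial>lborel)"
    unfolding int mult.assoc[symmetric] using \<eta> by (simp add: ennreal_mult'[symmetric])
  finally show ?thesis unfolding H_def .
qed

text \<open>Integrate row \<open>k1\<close> alone. The cofactor vector g is then constant, the
  Jacobian is |g \<bullet> x| and the chord is proportional to |g \<bullet> x| too, so the claim
  bounds a first absolute moment by a second moment. Balance does not depend on row
  \<open>k1\<close> and comes out of the integral.\<close>

lemma nn_integral_chord_ge:
  fixes m :: "real ^ 'd ^ 'd" and \<eta> \<epsilon> \<sigma> \<rho> \<delta> :: real
  assumes \<sigma>: "\<sigma> > 0" and k: "k1 \<noteq> k2" and \<epsilon>: "0 < \<epsilon>" and Q [measurable]: "Q \<in> sets borel"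
    and slope: "\<And>F. F \<in> Q \<Longrightarrow> \<bar>F $ k1\<bar> \<le> 1"
  shows "(\<integral>\<^sup>+Z. ennreal \<bar>base_det k2 Z\<bar> * indicator Q (Z $ k2) *
        (indicator {Z. balanced k1 k2 \<epsilon> Z} Z * ennreal (gauss_weight \<sigma> m (graph_config k2 Z))) \<partial>lborel)
    \<le> ennreal (1 / (\<sigma> * \<epsilon>)) * (\<integral>\<^sup>+Z. ennreal \<bar>base_det k2 Z\<bar> * indicator Q (Z $ k2) *
        (indicator {Z. balanced k1 k2 \<epsilon> Z} Z * ennreal (chord k1 k2 \<epsilon> Z) *
         ennreal (gauss_weight \<sigma> m (graph_config k2 Z))) \<partial>lborel)"
proof -
  have [measurable]: "{Z. balanced k1 k2 \<epsilon> (Z :: real ^ 'd ^ 'd)} \<in> sets borel"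
    using \<epsilon> by (intro balanced_measurable) auto
  let ?L = "\<lambda>Z. ennreal \<bar>base_det k2 Z\<bar> * indicator Q (Z $ k2) *
        (indicator {Z. balanced k1 k2 \<epsilon> Z} Z * ennreal (gauss_weight \<sigma> m (graph_config k2 Z)))"
  let ?R = "\<lambda>Z. ennreal (1 / (\<sigma> * \<epsilon>)) * (ennreal \<bar>base_det k2 Z\<bar> * indicator Q (Z $ k2) *
        (indicator {Z. balanced k1 k2 \<epsilon> Z} Z * ennreal (chord k1 k2 \<epsilon> Z) * ennreal (gauss_weight \<sigma> m (graph_config k2 Z))))"
  have "(\<integral>\<^sup>+Z. ?L Z \<partial>lborel) \<le> (\<integral>\<^sup>+Z. ?R Z \<partial>lborel)"
  proof (rule nn_integral_row_mono[where k=k1])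
    fix Z :: "real ^ 'd ^ 'd"
    define g where "g = slope_cofactor k1 k2 Z"
    define w where "w x = gauss_weight \<sigma> m (graph_config k2 (row_update Z k1 x))" for x
    have [measurable]: "w \<in> borel_measurable borel" unfolding w_def[abs_def] by measurable
    have D: "base_det k2 (row_update Z k1 x) = g \<bullet> x" for x
      using base_det_slope[OF k, of "row_update Z k1 x"] k by (simp add: g_def)
    have B: "balanced k1 k2 \<epsilon> (row_update Z k1 x) \<longleftrightarrow> balanced k1 k2 \<epsilon> Z" for x
      by (rule balanced_cong) auto
    show "(\<integral>\<^sup>+x. ?L (row_update Z k1 x) \<partial>lborel) \<le> (\<integral>\<^sup>+x. ?R (row_update Z k1 x) \<partial>lborel)"
    proof (cases "g \<noteq> 0 \<and> Z $ k2 \<in> Q \<and> balanced k1 k2 \<epsilon> Z")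
      case True
      \<comment> \<open>A step of length \<sigma> in the direction that changes
        \<open>g \<bullet> x\<close> most. With the hyperplane fixed, moving row \<open>k1\<close>
        by \<open>v\<close> moves the heights by \<kappa> times \<open>v\<close>, where |\<kappa>|
        \<le> 1; hence the bound 2 \<sigma>^2 for the squared norm of the total shift
        \<open>V\<close>.\<close>
      define v where "v = (\<sigma> / norm g) *\<^sub>R g"
      have gv: "g \<bullet> v = \<sigma> * norm g" using True by (simp add: v_def power2_norm_eq_inner[symmetric] power2_eq_square)
      define \<kappa> where "\<kappa> = Z $ k2 $ k1"
      define V where "V = row_update (row_update 0 k1 v) k2 (\<kappa> *\<^sub>R v)"
      have "norm v = \<sigma>" using True \<sigma> by (simp add: v_def)
      have V: "(norm V)\<^sup>2 \<le> 2 * \<sigma>\<^sup>2"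
      proof -
        have "(norm V)\<^sup>2 = (\<Sum>c\<in>UNIV. (norm (V $ c))\<^sup>2)"
          by (simp add: power2_norm_eq_inner inner_vec_def[of V V])
        also have "\<dots> = (\<Sum>c\<in>UNIV. (if c = k1 then \<sigma>\<^sup>2 else 0) + (if c = k2 then (\<bar>\<kappa>\<bar> * \<sigma>)\<^sup>2 else 0))"
          using k \<open>norm v = \<sigma>\<close> by (intro sum.cong) (auto simp: V_def row_update_nth)
        also have "\<dots> = \<sigma>\<^sup>2 + (\<bar>\<kappa>\<bar> * \<sigma>)\<^sup>2" by (simp add: sum.distrib)
        also have "(\<bar>\<kappa>\<bar> * \<sigma>)\<^sup>2 \<le> (1 * \<sigma>)\<^sup>2"
          using slope[of "Z $ k2"] True \<sigma> by (intro power_mono mult_right_mono) (auto simp: \<kappa>_def)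
        finally show ?thesis by simp
      qed
      have G: "graph_config k2 (row_update Z k1 (x + a *\<^sub>R v)) = graph_config k2 (row_update Z k1 x) + a *\<^sub>R V" for x a
      proof -
        have S: "(\<Sum>c\<in>-{k2}. Z $ k2 $ c *\<^sub>R row_update Z k1 y $ c)
           = \<kappa> *\<^sub>R y + (\<Sum>c\<in>-{k2} - {k1}. Z $ k2 $ c *\<^sub>R Z $ c)" for y
          using k by (subst sum.remove[of _ k1]) (auto simp: \<kappa>_def intro!: sum.cong)
        have "graph_config k2 (row_update Z k1 (x + a *\<^sub>R v)) $ c
          = (graph_config k2 (row_update Z k1 x) + a *\<^sub>R V) $ c" for c
          using k by (cases "c = k2"; cases "c = k1")
            (simp_all add: graph_config_def heights_sum S V_def scaleR_add_right algebra_simps)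
        then show ?thesis by (simp add: vec_eq_iff)
      qed
      have "(\<integral>\<^sup>+x. ennreal (\<bar>g \<bullet> x\<bar> * w x) \<partial>lborel) \<le> (\<integral>\<^sup>+x. ennreal (2 / (g \<bullet> v) * (g \<bullet> x)\<^sup>2 * w x) \<partial>lborel)"
      proof (rule nn_integral_linear_abs_le_square)
        show "(w x / 3)\<^sup>2 \<le> w (x + v) * w (x - v)" for x
          using gauss_weight_symmetric_product[OF \<sigma> V, of m "graph_config k2 (row_update Z k1 x)"]
            G[of x 1] G[of x "-1"] by (simp add: w_def)
        show "0 < g \<bullet> v" using True \<sigma> by (simp add: gv)
      qed (auto simp: w_def)
      moreover have "2 / (g \<bullet> v) * (g \<bullet> x)\<^sup>2 * w x
          = 1 / (\<sigma> * \<epsilon>) * (\<bar>g \<bullet> x\<bar> * (2 * \<epsilon> * \<bar>g \<bullet> x\<bar> / norm g) * w x)" for x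
        using True \<sigma> \<epsilon> by (simp add: gv field_simps power2_eq_square)
      moreover have "?L (row_update Z k1 x) = ennreal (\<bar>g \<bullet> x\<bar> * w x)" for x
        using True k by (simp add: D B w_def ennreal_mult)
      moreover have "?R (row_update Z k1 x)
         = ennreal (1 / (\<sigma> * \<epsilon>) * (\<bar>g \<bullet> x\<bar> * (2 * \<epsilon> * \<bar>g \<bullet> x\<bar> / norm g) * w x))" for x
      proof -
        have p: "0 \<le> 1 / (\<sigma> * \<epsilon>)" "0 \<le> 2 * \<epsilon> * \<bar>g \<bullet> x\<bar> / norm g" "0 \<le> w x"
          using \<sigma> \<epsilon> by (auto simp: w_def)
        have "chord k1 k2 \<epsilon> (row_update Z k1 x) = 2 * \<epsilon> * \<bar>g \<bullet> x\<bar> / norm g"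
          using k by (simp add: chord_def D g_def)
        then have "?R (row_update Z k1 x) = ennreal (1 / (\<sigma> * \<epsilon>)) *
           (ennreal \<bar>g \<bullet> x\<bar> * ennreal (2 * \<epsilon> * \<bar>g \<bullet> x\<bar> / norm g) * ennreal (w x))"
          using True k by (simp add: D B w_def mult.assoc)
        then show ?thesis by (simp only: ennreal_mult p abs_ge_zero mult_nonneg_nonneg)
      qed
      ultimately show ?thesis by (simp only:)
    next
      case False
      then have L0: "?L (row_update Z k1 x) = 0" for x using k by (auto simp: D B)
      have "(\<integral>\<^sup>+x. ?L (row_update Z k1 x) \<partial>lborel) = (\<integral>\<^sup>+x. 0 \<partial>(lborel :: (real ^ 'd) measure))"
        by (rule nn_integral_cong) (rule L0)
      also have "\<dots> \<le> (\<integral>\<^sup>+x. ?R (row_update Z k1 x) \<partial>lborel)" by simp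
      finally show ?thesis .
    qed
  qed measurable
  also have "\<dots> = ennreal (1 / (\<sigma> * \<epsilon>)) * (\<integral>\<^sup>+Z. ennreal \<bar>base_det k2 Z\<bar> * indicator Q (Z $ k2) *
        (indicator {Z. balanced k1 k2 \<epsilon> Z} Z * ennreal (chord k1 k2 \<epsilon> Z) *
         ennreal (gauss_weight \<sigma> m (graph_config k2 Z))) \<partial>lborel)"
    by (rule nn_integral_cmult) measurable
  finally show ?thesis .
qed

text \<open>The two estimates chained with \<epsilon> = \<eta>/d, which turns 1/(\<sigma>
  \<epsilon>) into d/(\<sigma> \<eta>). Both live in hyperplane coordinates, so the change of
  variables is made at the start and undone at the end.\<close>

lemma nn_integral_facet_le_chord:
  fixes m :: "real ^ 'd ^ 'd" and \<eta> \<epsilon> \<sigma> \<rho> \<delta> :: real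
  assumes \<sigma>: "\<sigma> > 0" and k: "k1 \<noteq> k2" and \<eta>: "0 < \<eta>" "\<eta> < 1" and Q [measurable]: "Q \<in> sets borel"
    and slope: "\<And>F. F \<in> Q \<Longrightarrow> \<bar>F $ k1\<bar> \<le> 1"
    and \<delta>: "\<delta> = 3 * real CARD('d) * \<eta> * (norm m + \<rho>)" "2 * \<rho> * \<delta> + \<delta>\<^sup>2 \<le> 2 * \<sigma>\<^sup>2"
  shows "(\<integral>\<^sup>+Z. indicator {Z. base_det k2 Z \<noteq> 0 \<and> hyperplane_coeffs k2 Z \<in> Q} Z *
      (indicator {Z. balanced k1 k2 0 Z} Z * indicator {Z. norm (Z - m) \<le> \<rho>} Z *
       ennreal (gauss_weight \<sigma> m Z)) \<partial>lborel)
    \<le> ennreal (exp 1 / (1 - \<eta>) ^ (CARD('d) - 1) * (CARD('d) / (\<sigma> * \<eta>))) *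
      (\<integral>\<^sup>+Z. indicator {Z. base_det k2 Z \<noteq> 0 \<and> hyperplane_coeffs k2 Z \<in> Q} Z *
        (indicator {Z. balanced k1 k2 (\<eta> / CARD('d)) Z} Z * ennreal (chord k1 k2 (\<eta> / CARD('d)) Z) *
         ennreal (gauss_weight \<sigma> m Z)) \<partial>lborel)"
proof -
  let ?\<epsilon> = "\<eta> / CARD('d)"
  have e0: "0 < ?\<epsilon>" using \<eta> by simp
  note [measurable] = balanced_measurable[of 0 k1 k2] balanced_measurable[of ?\<epsilon> k1 k2, OF less_imp_le[OF e0]]
  have bg: "balanced k1 k2 e (graph_config k2 Z) \<longleftrightarrow> balanced k1 k2 e Z" for e and Z :: "real ^ 'd ^ 'd"
    by (rule balanced_cong) auto
  have cg: "chord k1 k2 e (graph_config k2 Z) = chord k1 k2 e Z" for e and Z :: "real ^ 'd ^ 'd"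
    by (simp add: chord_def graph_config_def)
  have "(\<integral>\<^sup>+Z. indicator {Z. base_det k2 Z \<noteq> 0 \<and> hyperplane_coeffs k2 Z \<in> Q} Z *
      (indicator {Z. balanced k1 k2 0 Z} Z * indicator {Z. norm (Z - m) \<le> \<rho>} Z *
       ennreal (gauss_weight \<sigma> m Z)) \<partial>lborel)
    = (\<integral>\<^sup>+Z. ennreal \<bar>base_det k2 Z\<bar> * indicator Q (Z $ k2) *
      (indicator {Z. balanced k1 k2 0 Z} (graph_config k2 Z) * indicator {Z. norm (Z - m) \<le> \<rho>} (graph_config k2 Z) *
       ennreal (gauss_weight \<sigma> m (graph_config k2 Z))) \<partial>lborel)"
    by (rule nn_integral_hyperplane_coordinates) measurable
  also have "\<dots> = (\<integral>\<^sup>+Z. ennreal \<bar>base_det k2 Z\<bar> * indicator Q (Z $ k2) *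
      (indicator {Z. balanced k1 k2 0 Z} Z * indicator {Z. norm (Z - m) \<le> \<rho>} (graph_config k2 Z) *
       ennreal (gauss_weight \<sigma> m (graph_config k2 Z))) \<partial>lborel)"
    by (simp only: indicator_def mem_Collect_eq bg)
  also have "\<dots> \<le> ennreal (exp 1 / (1 - \<eta>) ^ (CARD('d) - 1)) *
      (\<integral>\<^sup>+Z. ennreal \<bar>base_det k2 Z\<bar> * indicator Q (Z $ k2) *
        (indicator {Z. balanced k1 k2 ?\<epsilon> Z} Z * ennreal (gauss_weight \<sigma> m (graph_config k2 Z))) \<partial>lborel)"
    using \<eta> by (intro nn_integral_contract_base_le[OF \<sigma> k _ _ Q slope \<delta>]) auto
  also have "\<dots> \<le> ennreal (exp 1 / (1 - \<eta>) ^ (CARD('d) - 1)) *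
      (ennreal (1 / (\<sigma> * ?\<epsilon>)) * (\<integral>\<^sup>+Z. ennreal \<bar>base_det k2 Z\<bar> * indicator Q (Z $ k2) *
        (indicator {Z. balanced k1 k2 ?\<epsilon> Z} Z * ennreal (chord k1 k2 ?\<epsilon> Z) *
         ennreal (gauss_weight \<sigma> m (graph_config k2 Z))) \<partial>lborel))"
    by (intro mult_left_mono nn_integral_chord_ge[OF \<sigma> k e0 Q slope]) auto
  also have "(\<integral>\<^sup>+Z. ennreal \<bar>base_det k2 Z\<bar> * indicator Q (Z $ k2) *
        (indicator {Z. balanced k1 k2 ?\<epsilon> Z} Z * ennreal (chord k1 k2 ?\<epsilon> Z) *
         ennreal (gauss_weight \<sigma> m (graph_config k2 Z))) \<partial>lborel)
     = (\<integral>\<^sup>+Z. ennreal \<bar>base_det k2 Z\<bar> * indicator Q (Z $ k2) *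
        (indicator {Z. balanced k1 k2 ?\<epsilon> Z} (graph_config k2 Z) * ennreal (chord k1 k2 ?\<epsilon> (graph_config k2 Z)) *
         ennreal (gauss_weight \<sigma> m (graph_config k2 Z))) \<partial>lborel)"
    by (simp only: indicator_def mem_Collect_eq bg cg)
  also have "\<dots> = (\<integral>\<^sup>+Z. indicator {Z. base_det k2 Z \<noteq> 0 \<and> hyperplane_coeffs k2 Z \<in> Q} Z *
        (indicator {Z. balanced k1 k2 ?\<epsilon> Z} Z * ennreal (chord k1 k2 ?\<epsilon> Z) * ennreal (gauss_weight \<sigma> m Z)) \<partial>lborel)"
    by (rule nn_integral_hyperplane_coordinates[symmetric]) measurable
  finally show ?thesis
    using \<sigma> \<eta> by (simp add: mult.assoc[symmetric] ennreal_mult'[symmetric])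
qed

section \<open>Hyperplanes through a further point are negligible\<close>

lemma AE_row_not_on_hyperplane:
  fixes \<alpha> :: "real ^ 'n"
  assumes "\<alpha> \<noteq> 0"
  shows "AE Z :: real ^ 'n ^ 'm in lborel. \<alpha> \<bullet> Z $ k \<noteq> \<beta>"
proof -
  let ?a = "row_update 0 k \<alpha> :: real ^ 'n ^ 'm"
  have a: "?a \<bullet> Z = \<alpha> \<bullet> Z $ k" for Z
    by (simp add: inner_vec_def[of ?a] row_update_nth if_distrib[of "\<lambda>x. x \<bullet> _"] cong: if_cong)
  have "?a \<noteq> 0" using assms by (metis row_update_same zero_index)
  then have "negligible {Z. ?a \<bullet> Z = \<beta>}" by (intro negligible_hyperplane) auto
  then have "AE Z in lebesgue. Z \<notin> {Z. ?a \<bullet> Z = \<beta>}"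
    by (intro AE_not_in) (simp add: negligible_iff_null_sets)
  then show ?thesis by (simp add: a AE_completion_iff)
qed

text \<open>In hyperplane coordinates the coefficients are simply row \<open>k\<close>, so finitely
  many nontrivial linear equations for them confine this row to a null set. Weak inequalities can
  thereby be exchanged for strict ones.\<close>

lemma nn_integral_coeffs_AE_cong:
  fixes g :: "real ^ 'd ^ 'd \<Rightarrow> ennreal"
  assumes [measurable]: "g \<in> borel_measurable borel" "Q \<in> sets borel" "Q' \<in> sets borel"
    and fin: "finite K" and nz: "\<And>i. i \<in> K \<Longrightarrow> \<alpha> i \<noteq> 0"
    and Q: "\<And>F. (\<And>i. i \<in> K \<Longrightarrow> \<alpha> i \<bullet> F \<noteq> \<beta> i) \<Longrightarrow> F \<in> Q \<longleftrightarrow> F \<in> Q'"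
  shows "(\<integral>\<^sup>+Z. indicator {Z. base_det k Z \<noteq> 0 \<and> hyperplane_coeffs k Z \<in> Q} Z * g Z \<partial>lborel)
     = (\<integral>\<^sup>+Z. indicator {Z. base_det k Z \<noteq> 0 \<and> hyperplane_coeffs k Z \<in> Q'} Z * g Z \<partial>lborel)"
proof -
  have "AE Z :: real ^ 'd ^ 'd in lborel. \<forall>i\<in>K. \<alpha> i \<bullet> Z $ k \<noteq> \<beta> i"
    using fin nz by (intro AE_finite_allI AE_row_not_on_hyperplane) auto
  then have "AE Z :: real ^ 'd ^ 'd in lborel. Z $ k \<in> Q \<longleftrightarrow> Z $ k \<in> Q'"
    by (rule AE_mp) (use Q in auto)
  then show ?thesis
    unfolding nn_integral_hyperplane_coordinates[OF assms(1,2)] nn_integral_hyperplane_coordinates[OF assms(1,3)]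
    by (intro nn_integral_cong_AE) (auto simp: indicator_def elim!: AE_mp)
qed

section \<open>Gaussian points\<close>

definition orthonormal_frame :: "('d \<Rightarrow> real ^ 'd) \<Rightarrow> bool" where
  "orthonormal_frame u \<longleftrightarrow> (\<forall>c c'. u c \<bullet> u c' = (if c = c' then 1 else 0))"

definition config :: "('d \<Rightarrow> real ^ 'd) \<Rightarrow> ('d \<Rightarrow> nat) \<Rightarrow> (nat \<Rightarrow> real ^ 'd) \<Rightarrow> real ^ 'd ^ 'd" where
  "config u f a = (\<chi> c j. u c \<bullet> a (f j))"

lemma config_nth: "config u f a $ c $ j = u c \<bullet> a (f j)"
  by (simp add: config_def)

text \<open>Points are columns of a configuration but the linear substitutions act on rows; this
  switches between the two.\<close>

lemma nn_integral_transpose: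
  fixes G :: "real ^ 'n ^ 'm \<Rightarrow> ennreal"
  assumes [measurable]: "G \<in> borel_measurable borel"
  shows "(\<integral>\<^sup>+Z. G (transpose Z) \<partial>lborel) = (\<integral>\<^sup>+Z. G Z \<partial>lborel)"
proof -
  have "lborel = distr lborel borel (transpose :: real ^ 'm ^ 'n \<Rightarrow> real ^ 'n ^ 'm)"
  proof (rule lborel_eqI)
    fix l u :: "real ^ 'n ^ 'm" assume le: "\<And>b. b \<in> Basis \<Longrightarrow> l \<bullet> b \<le> u \<bullet> b"
    have le': "l $ i $ j \<le> u $ i $ j" for i j
      using le[of "axis i (axis j 1)"] by (simp add: inner_axis)
    have "(transpose :: real ^ 'm ^ 'n \<Rightarrow> real ^ 'n ^ 'm) -` box l u = box (transpose l) (transpose u)"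
      by (auto simp: mem_box_vec mem_box_cart transpose_def)
    moreover have "transpose l \<bullet> b \<le> transpose u \<bullet> b" if "b \<in> Basis" for b
      using that le' by (auto simp: Basis_vec_def inner_axis transpose_def)
    moreover have "(\<Prod>b\<in>Basis. (transpose u - transpose l) \<bullet> b) = (\<Prod>b\<in>Basis. (u - l) \<bullet> b)"
      unfolding prod_Basis_vec by (simp add: inner_axis transpose_def) (rule prod.swap)
    ultimately show "emeasure (distr lborel borel (transpose :: real ^ 'm ^ 'n \<Rightarrow> real ^ 'n ^ 'm)) (box l u)
        = ennreal (\<Prod>b\<in>Basis. (u - l) \<bullet> b)"
      by (simp add: emeasure_distr emeasure_lborel_box)
  qed simp
  then have "(\<integral>\<^sup>+Z. G Z \<partial>lborel) = (\<integral>\<^sup>+Z. G Z \<partial>distr lborel borel (transpose :: real ^ 'm ^ 'n \<Rightarrow> real ^ 'n ^ 'm))"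
    by (rule arg_cong)
  also have "\<dots> = (\<integral>\<^sup>+Z. G (transpose Z) \<partial>lborel)" by (rule nn_integral_distr) measurable
  finally show ?thesis by simp
qed

lemma orthonormal_frame_matrix:
  assumes "orthonormal_frame u"
  shows "orthogonal_matrix (\<chi> c. u c)"
proof -
  let ?U = "\<chi> c. u c"
  have "?U ** transpose ?U = mat 1"
    using assms by (simp add: vec_eq_iff matrix_matrix_mult_def transpose_def orthonormal_frame_def mat_def inner_vec_def)
  then show ?thesis
    using matrix_left_right_inverse[of ?U "transpose ?U"] by (simp add: orthogonal_matrix_def)
qed

lemma norm_vec_square: "(norm (x :: 'b::real_inner ^ 'n))\<^sup>2 = (\<Sum>i\<in>UNIV. (norm (x $ i))\<^sup>2)"
  by (simp add: power2_norm_eq_inner inner_vec_def)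

lemma frame_mult: "(\<chi> c. u c) *v x = (\<chi> c. u c \<bullet> x)"
  by (simp add: vec_eq_iff matrix_vector_mult_def inner_vec_def)

lemma frame_norm:
  assumes "orthonormal_frame u"
  shows "(\<Sum>c\<in>UNIV. (u c \<bullet> x)\<^sup>2) = (norm x)\<^sup>2"
proof -
  have "orthogonal_transformation ((*v) (\<chi> c. u c))"
    using orthonormal_frame_matrix[OF assms] by (simp add: orthogonal_transformation_matrix)
  then have "norm ((\<chi> c. u c) *v x) = norm x" by (rule orthogonal_transformation_norm)
  then show ?thesis
    using norm_vec_square[of "(\<chi> c. u c) *v x"] by (simp add: frame_mult)
qed

lemma PiM_component_borel:
  "i \<in> S \<Longrightarrow> (\<lambda>a. a i) \<in> borel_measurable (Pi\<^sub>M S (\<lambda>_. lborel))"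
  using measurable_component_singleton[of i S "\<lambda>_. lborel"] by simp

lemma config_measurable:
  assumes "range f \<subseteq> S"
  shows "config u f \<in> borel_measurable (Pi\<^sub>M S (\<lambda>_. lborel))"
proof -
  have [measurable]: "(\<lambda>a. a (f j)) \<in> borel_measurable (Pi\<^sub>M S (\<lambda>_. lborel))" for j
    using assms by (intro PiM_component_borel) auto
  show ?thesis unfolding config_def[abs_def] by measurable
qed

text \<open>Write the points as rows, apply the orthogonal matrix of the frame to each row
  (determinant 1 or -1), and transpose.\<close>

lemma nn_integral_config:
  fixes G :: "real ^ 'd ^ 'd \<Rightarrow> ennreal"
  assumes f: "bij_betw f (UNIV :: 'd set) I" and u: "orthonormal_frame u"
    and [measurable]: "G \<in> borel_measurable borel"
  shows "(\<integral>\<^sup>+a. G (config u f a) \<partial>Pi\<^sub>M I (\<lambda>_. lborel)) = (\<integral>\<^sup>+Z. G Z \<partial>lborel)"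
proof -
  let ?U = "\<chi> c. u c"
  have det: "\<bar>det ?U\<bar> = 1"
    using det_orthogonal_matrix[OF orthonormal_frame_matrix[OF u]] by auto
  have c: "config u f a = transpose (\<chi> j. if j \<in> UNIV then ?U *v (\<chi> j. a (f j)) $ j else (\<chi> j. a (f j)) $ j)" for a
    by (simp add: config_def frame_mult transpose_def vec_eq_iff)
  have [measurable]: "(\<lambda>a. \<chi> j. a (f j)) \<in> borel_measurable (Pi\<^sub>M I (\<lambda>_. lborel :: (real ^ 'd) measure))"
  proof (rule borel_measurable_vec_lambda)
    show "(\<lambda>a. a (f j)) \<in> borel_measurable (Pi\<^sub>M I (\<lambda>_. lborel :: (real ^ 'd) measure))" for j
      using f by (intro PiM_component_borel) (auto simp: bij_betw_def)
  qed
  have "(\<integral>\<^sup>+a. G (config u f a) \<partial>Pi\<^sub>M I (\<lambda>_. lborel))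
      = (\<integral>\<^sup>+W. G (transpose (\<chi> j. if j \<in> UNIV then ?U *v W $ j else W $ j))
           \<partial>distr (Pi\<^sub>M I (\<lambda>_. lborel)) borel (\<lambda>a. \<chi> j. a (f j)))"
    unfolding c by (rule nn_integral_distr[symmetric]) measurable
  also have "\<dots> = (\<integral>\<^sup>+W. G (transpose (\<chi> j. if j \<in> UNIV then ?U *v W $ j else W $ j)) \<partial>lborel)"
    by (simp only: distr_PiM_lborel_bij[OF f])
  also have "\<dots> = (\<integral>\<^sup>+W. G (transpose W) \<partial>lborel)"
    using nn_integral_rows_linear_subst[of "\<lambda>W. G (transpose W)" ?U UNIV] det by auto
  also have "\<dots> = (\<integral>\<^sup>+Z. G Z \<partial>lborel)" by (rule nn_integral_transpose) measurable
  finally show ?thesis .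
qed

lemma norm_config_diff:
  assumes f: "bij_betw f (UNIV :: 'd set) I" and u: "orthonormal_frame (u :: 'd \<Rightarrow> real ^ 'd)"
  shows "(norm (config u f a - config u f b))\<^sup>2 = (\<Sum>i\<in>I. (norm (a i - b i))\<^sup>2)"
proof -
  have "(norm (config u f a - config u f b))\<^sup>2 = (\<Sum>c\<in>UNIV. \<Sum>j\<in>UNIV. (u c \<bullet> (a (f j) - b (f j)))\<^sup>2)"
    by (simp add: norm_vec_square config_nth inner_diff_right)
  also have "\<dots> = (\<Sum>j\<in>UNIV. (norm (a (f j) - b (f j)))\<^sup>2)"
    by (subst sum.swap) (simp add: frame_norm[OF u])
  also have "\<dots> = (\<Sum>i\<in>I. (norm (a i - b i))\<^sup>2)"
    by (rule sum.reindex_bij_betw[OF f])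
  finally show ?thesis .
qed

definition gauss_const :: "'d itself \<Rightarrow> real \<Rightarrow> real" where
  "gauss_const _ \<sigma> = (2 * pi * \<sigma>\<^sup>2) powr (- real CARD('d) / 2)"

lemma gaussian_pdf_eq: "gaussian_pdf \<sigma> c (x :: real ^ 'd) = gauss_const TYPE('d) \<sigma> * gauss_weight \<sigma> c x"
  by (simp add: gaussian_pdf_def gauss_const_def gauss_weight_def)

lemma gauss_const_nonneg [simp]: "0 \<le> gauss_const T \<sigma>"
  by (simp add: gauss_const_def)

lemma gaussian_pdf_nonneg [simp]: "0 \<le> gaussian_pdf \<sigma> c x"
  by (simp add: gaussian_pdf_def)

lemma gaussian_pdf_measurable [measurable]: "gaussian_pdf \<sigma> c \<in> borel_measurable borel"
  unfolding gaussian_pdf_def[abs_def] by measurable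

text \<open>Rotation invariance: in every frame the joint density of the d vertices is one spherical
  Gaussian on the space of matrices, of dimension d^2.\<close>

lemma prod_gaussian_pdf_config:
  assumes f: "bij_betw f (UNIV :: 'd set) I" and u: "orthonormal_frame (u :: 'd \<Rightarrow> real ^ 'd)"
  shows "(\<Prod>i\<in>I. gaussian_pdf \<sigma> (c i) (a i))
    = gauss_const TYPE('d) \<sigma> ^ CARD('d) * gauss_weight \<sigma> (config u f c) (config u f a)"
proof -
  have card: "card I = CARD('d)" and fin: "finite I"
    using bij_betw_same_card[OF f] bij_betw_finite[OF f] by auto
  have "(\<Prod>i\<in>I. gauss_weight \<sigma> (c i) (a i)) = exp (\<Sum>i\<in>I. - (norm (a i - c i))\<^sup>2 / (2 * \<sigma>\<^sup>2))"
    unfolding gauss_weight_def by (rule exp_sum[OF fin, symmetric])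
  also have "(\<Sum>i\<in>I. - (norm (a i - c i))\<^sup>2 / (2 * \<sigma>\<^sup>2)) = - (\<Sum>i\<in>I. (norm (a i - c i))\<^sup>2) / (2 * \<sigma>\<^sup>2)"
    by (simp add: sum_divide_distrib sum_negf)
  finally show ?thesis
    unfolding gaussian_pdf_eq prod.distrib norm_config_diff[OF f u, symmetric]
    by (simp add: card gauss_weight_def norm_config_diff[OF f u])
qed

lemma nn_integral_gaussian_pdf:
  fixes c :: "real ^ 'd"
  assumes "\<sigma> > 0"
  shows "(\<integral>\<^sup>+x. ennreal (gaussian_pdf \<sigma> c x) \<partial>lborel) = 1"
proof -
  interpret product_sigma_finite "\<lambda>_. lborel :: real measure" ..
  have eq: "gaussian_pdf \<sigma> c x = (\<Prod>i\<in>UNIV. normal_density (c $ i) \<sigma> (x $ i))" for x :: "real ^ 'd"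
  proof -
    have "(1 / sqrt (2 * pi * \<sigma>\<^sup>2)) ^ CARD('d) = (2 * pi * \<sigma>\<^sup>2) powr (- real CARD('d) / 2)"
    proof -
      have p: "2 * pi * \<sigma>\<^sup>2 > 0" using assms by simp
      have "1 / sqrt (2 * pi * \<sigma>\<^sup>2) = (2 * pi * \<sigma>\<^sup>2) powr (- (1 / 2))"
        using p by (simp add: powr_half_sqrt powr_minus_divide)
      moreover have "((2 * pi * \<sigma>\<^sup>2) powr (- (1 / 2))) ^ CARD('d) = ((2 * pi * \<sigma>\<^sup>2) powr (- (1 / 2))) powr real CARD('d)"
        using assms by (intro powr_realpow[symmetric]) simp
      ultimately show ?thesis by (simp add: powr_powr)
    qed
    moreover have "(\<Sum>i\<in>UNIV. - (x $ i - c $ i)\<^sup>2 / (2 * \<sigma>\<^sup>2)) = - (norm (x - c))\<^sup>2 / (2 * \<sigma>\<^sup>2)"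
      by (simp add: norm_vec_square sum_divide_distrib sum_negf)
    ultimately show ?thesis
      unfolding normal_density_def prod.distrib gaussian_pdf_def by (simp add: exp_sum[symmetric])
  qed
  have "(\<integral>\<^sup>+x. ennreal (gaussian_pdf \<sigma> c x) \<partial>lborel)
     = (\<integral>\<^sup>+x. ennreal (gaussian_pdf \<sigma> c x) \<partial>distr (Pi\<^sub>M UNIV (\<lambda>_. lborel)) borel (\<lambda>a. \<chi> j. a j))"
    using distr_PiM_lborel_bij[of "\<lambda>j. j" "UNIV :: 'd set", where 'b=real] by (simp add: bij_betw_def)
  also have "\<dots> = (\<integral>\<^sup>+a. (\<Prod>i\<in>UNIV. ennreal (normal_density (c $ i) \<sigma> (a i))) \<partial>Pi\<^sub>M UNIV (\<lambda>_. lborel))"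
    by (subst nn_integral_distr) (auto simp: eq prod_ennreal)
  also have "\<dots> = (\<Prod>i\<in>UNIV. \<integral>\<^sup>+x. ennreal (normal_density (c $ i) \<sigma> x) \<partial>lborel)"
    by (rule product_nn_integral_prod) auto
  also have "\<dots> = 1"
  proof -
    have "(\<integral>\<^sup>+x. ennreal (normal_density \<mu> \<sigma> x) \<partial>lborel) = 1" for \<mu>
      using prob_space.emeasure_space_1[OF prob_space_normal_density[OF assms, of \<mu>]]
      by (simp add: emeasure_density)
    then show ?thesis by simp
  qed
  finally show ?thesis .
qed

text \<open>Normalisation on the matrix space, obtained by reading a matrix in the standard frame as
  d independent Gaussian points.\<close>

lemma nn_integral_gauss_weight:
  fixes m :: "real ^ 'd ^ 'd"
  assumes "\<sigma> > 0"
  shows "ennreal (gauss_const TYPE('d) \<sigma> ^ CARD('d)) * (\<integral>\<^sup>+Z. ennreal (gauss_weight \<sigma> m Z) \<partial>lborel) = 1"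
proof -
  interpret product_sigma_finite "\<lambda>_. lborel :: (real ^ 'd) measure" ..
  obtain f :: "'d \<Rightarrow> nat" where f: "bij_betw f UNIV {0..<CARD('d)}"
    using ex_bij_betw_finite_nat[of "UNIV :: 'd set"] by auto
  define u :: "'d \<Rightarrow> real ^ 'd" where "u c = axis c 1" for c
  have u: "orthonormal_frame u" by (auto simp: orthonormal_frame_def u_def inner_axis_axis)
  define c where "c i = (\<chi> k. m $ k $ inv_into UNIV f i)" for i
  have c: "config u f c = m"
    using f by (simp add: vec_eq_iff config_nth u_def inner_axis' c_def bij_betw_def)
  have "ennreal (gauss_const TYPE('d) \<sigma> ^ CARD('d)) * (\<integral>\<^sup>+Z. ennreal (gauss_weight \<sigma> m Z) \<partial>lborel)
     = (\<integral>\<^sup>+Z. ennreal (gauss_const TYPE('d) \<sigma> ^ CARD('d) * gauss_weight \<sigma> m Z) \<partial>lborel)"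
    by (simp add: nn_integral_cmult ennreal_mult)
  also have "\<dots> = (\<integral>\<^sup>+a. ennreal (gauss_const TYPE('d) \<sigma> ^ CARD('d) * gauss_weight \<sigma> m (config u f a))
       \<partial>Pi\<^sub>M {0..<CARD('d)} (\<lambda>_. lborel))"
    by (rule nn_integral_config[OF f u, symmetric]) measurable
  also have "\<dots> = (\<integral>\<^sup>+a. (\<Prod>i\<in>{0..<CARD('d)}. ennreal (gaussian_pdf \<sigma> (c i) (a i))) \<partial>Pi\<^sub>M {0..<CARD('d)} (\<lambda>_. lborel))"
    by (simp add: prod_ennreal prod_gaussian_pdf_config[OF f u] c)
  also have "\<dots> = (\<Prod>i\<in>{0..<CARD('d)}. \<integral>\<^sup>+x. ennreal (gaussian_pdf \<sigma> (c i) x) \<partial>lborel)"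
    by (rule product_nn_integral_prod) auto
  also have "\<dots> = 1" by (simp add: nn_integral_gaussian_pdf[OF assms])
  finally show ?thesis .
qed

lemma sets_gaussian_points [measurable_cong]:
  "sets (gaussian_points n \<sigma> c) = sets (Pi\<^sub>M {1..n} (\<lambda>_. lborel))"
  by (simp add: gaussian_points_def)

lemma gaussian_density_measurable [measurable]:
  assumes "J \<subseteq> S"
  shows "(\<lambda>a. \<Prod>i\<in>J. gaussian_pdf \<sigma> (c i) (a i)) \<in> borel_measurable (Pi\<^sub>M S (\<lambda>_. lborel))"
proof (rule borel_measurable_prod)
  fix i assume "i \<in> J"
  then have "(\<lambda>a. a i) \<in> Pi\<^sub>M S (\<lambda>_. lborel) \<rightarrow>\<^sub>M lborel" using assms by (intro measurable_component_singleton) auto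
  then show "(\<lambda>a. gaussian_pdf \<sigma> (c i) (a i)) \<in> borel_measurable (Pi\<^sub>M S (\<lambda>_. lborel))"
    using gaussian_pdf_measurable[of \<sigma> "c i"] by (auto intro: measurable_compose)
qed

lemma nn_integral_gaussian_points:
  assumes [measurable]: "h \<in> borel_measurable (Pi\<^sub>M {1..n} (\<lambda>_. lborel))"
  shows "(\<integral>\<^sup>+a. h a \<partial>gaussian_points n \<sigma> c)
    = (\<integral>\<^sup>+a. ennreal (\<Prod>i\<in>{1..n}. gaussian_pdf \<sigma> (c i) (a i)) * h a \<partial>Pi\<^sub>M {1..n} (\<lambda>_. lborel))"
proof -
  have [measurable]: "(\<lambda>a. \<Prod>i\<in>{1..n}. gaussian_pdf \<sigma> (c i) (a i)) \<in> borel_measurable (Pi\<^sub>M {1..n} (\<lambda>_. lborel))"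
    by (rule gaussian_density_measurable) simp
  show ?thesis unfolding gaussian_points_def by (rule nn_integral_density) measurable
qed

lemma prob_space_gaussian_points:
  fixes c :: "nat \<Rightarrow> real ^ 'd"
  assumes "\<sigma> > 0"
  shows "prob_space (gaussian_points n \<sigma> c)"
proof
  interpret product_sigma_finite "\<lambda>_. lborel :: (real ^ 'd) measure" ..
  have "emeasure (gaussian_points n \<sigma> c) (space (gaussian_points n \<sigma> c)) = (\<integral>\<^sup>+a. 1 \<partial>gaussian_points n \<sigma> c)"
    by simp
  also have "\<dots> = (\<integral>\<^sup>+a. (\<Prod>i\<in>{1..n}. ennreal (gaussian_pdf \<sigma> (c i) (a i))) \<partial>Pi\<^sub>M {1..n} (\<lambda>_. lborel))"
    by (subst nn_integral_gaussian_points) (auto simp: prod_ennreal)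
  also have "\<dots> = (\<Prod>i\<in>{1..n}. \<integral>\<^sup>+x. ennreal (gaussian_pdf \<sigma> (c i) x) \<partial>lborel)"
    by (rule product_nn_integral_prod) auto
  also have "\<dots> = 1" by (simp add: nn_integral_gaussian_pdf[OF assms])
  finally show "emeasure (gaussian_points n \<sigma> c) (space (gaussian_points n \<sigma> c)) = 1" .
qed

text \<open>Fubini with the vertices inside and the remaining points outside. \<open>\<Phi>\<close>
  receives the configuration and the points separately and ignores the points numbered by
  \<open>I\<close>, so the remaining points can be frozen as \<open>y\<close> while the
  configuration ranges over all matrices.\<close>

lemma nn_integral_gaussian_points_split:
  fixes \<Phi> :: "real ^ 'd ^ 'd \<Rightarrow> (nat \<Rightarrow> real ^ 'd) \<Rightarrow> ennreal"
  assumes I: "I \<subseteq> {1..n}" and f: "bij_betw f (UNIV :: 'd set) I" and u: "orthonormal_frame u"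
    and meas: "(\<lambda>a. \<Phi> (config u f a) a) \<in> borel_measurable (Pi\<^sub>M {1..n} (\<lambda>_. lborel))"
    and meas': "\<And>a. (\<lambda>Z. \<Phi> Z a) \<in> borel_measurable borel"
    and dep: "\<And>Z a b. (\<And>i. i \<in> {1..n} - I \<Longrightarrow> a i = b i) \<Longrightarrow> \<Phi> Z a = \<Phi> Z b"
  shows "(\<integral>\<^sup>+a. \<Phi> (config u f a) a \<partial>gaussian_points n \<sigma> c)
    = (\<integral>\<^sup>+y. ennreal ((\<Prod>i\<in>{1..n} - I. gaussian_pdf \<sigma> (c i) (y i)) * gauss_const TYPE('d) \<sigma> ^ CARD('d)) *
         (\<integral>\<^sup>+Z. \<Phi> Z y * ennreal (gauss_weight \<sigma> (config u f c) Z) \<partial>lborel) \<partial>Pi\<^sub>M ({1..n} - I) (\<lambda>_. lborel))"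
proof -
  interpret product_sigma_finite "\<lambda>_. lborel :: (real ^ 'd) measure" ..
  let ?K = "{1..n} - I" and ?p = "\<lambda>J a. \<Prod>i\<in>J. gaussian_pdf \<sigma> (c i) (a i)"
  have KI: "?K \<union> I = {1..n}" and fin: "finite I" using I finite_subset by auto
  have fI: "f j \<in> I" for j using f by (auto simp: bij_betw_def)
  have [measurable]: "?p {1..n} \<in> borel_measurable (Pi\<^sub>M {1..n} (\<lambda>_. lborel))"
    by (rule gaussian_density_measurable) simp
  note [measurable] = meas meas'
  let ?h = "\<lambda>a. ennreal (?p {1..n} a) * \<Phi> (config u f a) a"
  have "(\<integral>\<^sup>+a. \<Phi> (config u f a) a \<partial>gaussian_points n \<sigma> c) = (\<integral>\<^sup>+a. ?h a \<partial>Pi\<^sub>M (?K \<union> I) (\<lambda>_. lborel))"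
    unfolding KI by (rule nn_integral_gaussian_points[OF meas])
  also have "\<dots> = (\<integral>\<^sup>+y. \<integral>\<^sup>+x. ?h (merge ?K I (y, x)) \<partial>Pi\<^sub>M I (\<lambda>_. lborel) \<partial>Pi\<^sub>M ?K (\<lambda>_. lborel))"
  proof (rule product_nn_integral_fold)
    show "?h \<in> borel_measurable (Pi\<^sub>M (?K \<union> I) (\<lambda>_. lborel))"
      unfolding KI by measurable
  qed (use fin in auto)
  also have "\<dots> = (\<integral>\<^sup>+y. ennreal (?p ?K y * gauss_const TYPE('d) \<sigma> ^ CARD('d)) *
         (\<integral>\<^sup>+Z. \<Phi> Z y * ennreal (gauss_weight \<sigma> (config u f c) Z) \<partial>lborel) \<partial>Pi\<^sub>M ?K (\<lambda>_. lborel))"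
  proof (rule nn_integral_cong)
    fix y
    have c1: "config u f (merge ?K I (y, x)) = config u f x" for x
      using fI by (simp add: vec_eq_iff config_nth merge_def)
    have d1: "\<Phi> Z (merge ?K I (y, x)) = \<Phi> Z y" for Z x
      by (rule dep) (simp add: merge_def)
    have p1: "?p {1..n} (merge ?K I (y, x)) = ?p ?K y * ?p I x" for x
    proof -
      have "?p {1..n} (merge ?K I (y, x)) = ?p ?K (merge ?K I (y, x)) * ?p I (merge ?K I (y, x))"
        using prod.union_disjoint[of ?K I "\<lambda>i. gaussian_pdf \<sigma> (c i) (merge ?K I (y, x) i)"] fin
        by (simp only: KI) auto
      also have "?p ?K (merge ?K I (y, x)) = ?p ?K y" by (rule prod.cong) (auto simp: merge_def)
      also have "?p I (merge ?K I (y, x)) = ?p I x" by (rule prod.cong) (auto simp: merge_def)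
      finally show ?thesis .
    qed
    have [measurable]: "config u f \<in> borel_measurable (Pi\<^sub>M I (\<lambda>_. lborel))"
      by (rule config_measurable) (use fI in auto)
    have nn: "0 \<le> ?p ?K y" "0 \<le> gauss_const TYPE('d) \<sigma> ^ CARD('d)" by (auto intro: prod_nonneg)
    have "(\<integral>\<^sup>+x. ?h (merge ?K I (y, x)) \<partial>Pi\<^sub>M I (\<lambda>_. lborel))
       = (\<integral>\<^sup>+x. ennreal (?p ?K y * gauss_const TYPE('d) \<sigma> ^ CARD('d)) *
           (\<Phi> (config u f x) y * ennreal (gauss_weight \<sigma> (config u f c) (config u f x))) \<partial>Pi\<^sub>M I (\<lambda>_. lborel))"
    proof (rule nn_integral_cong)
      fix x
      have p2: "?p I x = gauss_const TYPE('d) \<sigma> ^ CARD('d) * gauss_weight \<sigma> (config u f c) (config u f x)"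
        by (rule prod_gaussian_pdf_config[OF f u])
      have "ennreal (?p {1..n} (merge ?K I (y, x)))
        = ennreal (?p ?K y * gauss_const TYPE('d) \<sigma> ^ CARD('d)) * ennreal (gauss_weight \<sigma> (config u f c) (config u f x))"
        unfolding p1 p2 mult.assoc[symmetric] using nn by (intro ennreal_mult) auto
      then show "?h (merge ?K I (y, x)) = ennreal (?p ?K y * gauss_const TYPE('d) \<sigma> ^ CARD('d)) *
           (\<Phi> (config u f x) y * ennreal (gauss_weight \<sigma> (config u f c) (config u f x)))"
        by (simp only: c1 d1 mult_ac)
    qed
    also have "\<dots> = ennreal (?p ?K y * gauss_const TYPE('d) \<sigma> ^ CARD('d)) *
         (\<integral>\<^sup>+x. \<Phi> (config u f x) y * ennreal (gauss_weight \<sigma> (config u f c) (config u f x)) \<partial>Pi\<^sub>M I (\<lambda>_. lborel))"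
      by (rule nn_integral_cmult) measurable
    also have "(\<integral>\<^sup>+x. \<Phi> (config u f x) y * ennreal (gauss_weight \<sigma> (config u f c) (config u f x)) \<partial>Pi\<^sub>M I (\<lambda>_. lborel))
       = (\<integral>\<^sup>+Z. \<Phi> Z y * ennreal (gauss_weight \<sigma> (config u f c) Z) \<partial>lborel)"
      by (rule nn_integral_config[OF f u]) measurable
    finally show "(\<integral>\<^sup>+x. ?h (merge ?K I (y, x)) \<partial>Pi\<^sub>M I (\<lambda>_. lborel))
      = ennreal (?p ?K y * gauss_const TYPE('d) \<sigma> ^ CARD('d)) *
         (\<integral>\<^sup>+Z. \<Phi> Z y * ennreal (gauss_weight \<sigma> (config u f c) Z) \<partial>lborel)" .
  qed
  finally show ?thesis .
qed

text \<open>Homogeneous coordinates of the projection of \<open>x\<close>: the inner product with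
  \<open>F\<close> is the height over \<open>x\<close> of the hyperplane with coefficients
  \<open>F\<close>.\<close>

definition lift_base :: "('d \<Rightarrow> real ^ 'd) \<Rightarrow> 'd \<Rightarrow> real ^ 'd \<Rightarrow> real ^ 'd" where
  "lift_base u k x = (\<chi> c. if c = k then 1 else u c \<bullet> x)"

text \<open>A set of coefficient vectors, so that with the remaining points frozen it can take the
  place of \<open>Q\<close> in the hyperplane-coordinate lemmas. A facet provides the weak
  inequalities, whereas the disjointness of chords rests on the strict ones.\<close>

definition weakly_above :: "('d \<Rightarrow> real ^ 'd) \<Rightarrow> 'd \<Rightarrow> 'd \<Rightarrow> nat set \<Rightarrow> (nat \<Rightarrow> real ^ 'd) \<Rightarrow> (real ^ 'd) set" where
  "weakly_above u k1 k2 K a = {F. \<bar>F $ k1\<bar> \<le> 1 \<and> (\<forall>i\<in>K. u k2 \<bullet> a i \<le> lift_base u k2 (a i) \<bullet> F)}"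

definition strictly_above :: "('d \<Rightarrow> real ^ 'd) \<Rightarrow> 'd \<Rightarrow> 'd \<Rightarrow> nat set \<Rightarrow> (nat \<Rightarrow> real ^ 'd) \<Rightarrow> (real ^ 'd) set" where
  "strictly_above u k1 k2 K a = {F. \<bar>F $ k1\<bar> \<le> 1 \<and> (\<forall>i\<in>K. u k2 \<bullet> a i < lift_base u k2 (a i) \<bullet> F)}"

lemma lift_base_measurable [measurable (raw)]:
  assumes [measurable]: "g \<in> borel_measurable M"
  shows "(\<lambda>x. lift_base u k (g x)) \<in> borel_measurable M"
  unfolding lift_base_def by measurable

lemma above_sets [measurable]:
  fixes a :: "nat \<Rightarrow> real ^ 'd"
  assumes "finite K"
  shows "weakly_above u k1 k2 K a \<in> sets borel" "strictly_above u k1 k2 K a \<in> sets borel"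
proof -
  have *: "{F :: real ^ 'd. \<bar>F $ k1\<bar> \<le> 1} \<inter> (\<Inter>i\<in>K. {F. P i F}) \<in> sets borel"
    if "\<And>i. {F. P i F} \<in> sets borel" for P :: "nat \<Rightarrow> real ^ 'd \<Rightarrow> bool"
  proof (intro sets.Int)
    show "{F :: real ^ 'd. \<bar>F $ k1\<bar> \<le> 1} \<in> sets borel" by measurable
    show "(\<Inter>i\<in>K. {F. P i F}) \<in> sets borel"
      using assms that by (cases "K = {}") (auto intro!: sets.finite_INT)
  qed
  have "weakly_above u k1 k2 K a = {F. \<bar>F $ k1\<bar> \<le> 1} \<inter> (\<Inter>i\<in>K. {F. u k2 \<bullet> a i \<le> lift_base u k2 (a i) \<bullet> F})"
    by (auto simp: weakly_above_def)
  then show "weakly_above u k1 k2 K a \<in> sets borel" by (simp only:) (rule *, measurable)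
  have "strictly_above u k1 k2 K a = {F. \<bar>F $ k1\<bar> \<le> 1} \<inter> (\<Inter>i\<in>K. {F. u k2 \<bullet> a i < lift_base u k2 (a i) \<bullet> F})"
    by (auto simp: strictly_above_def)
  then show "strictly_above u k1 k2 K a \<in> sets borel" by (simp only:) (rule *, measurable)
qed


section \<open>Gaussian tails and first moments\<close>

lemma gauss_const_sqrt2: "gauss_const TYPE('d::finite) (sqrt 2 * \<sigma>) = 2 powr (- real CARD('d) / 2) * gauss_const TYPE('d) \<sigma>"
proof -
  have "2 * pi * (sqrt 2 * \<sigma>)\<^sup>2 = 2 * (2 * pi * \<sigma>\<^sup>2)" by (simp add: power_mult_distrib)
  then show ?thesis unfolding gauss_const_def by (simp only: powr_mult)
qed

lemma gauss_weight_sqrt2: "gauss_weight (sqrt 2 * \<sigma>) m Z = exp (- (norm (Z - m))\<^sup>2 / (4 * \<sigma>\<^sup>2))"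
  by (simp add: gauss_weight_def power_mult_distrib)

text \<open>Outside the ball, half of the exponent is at least \<rho>^2/(4 \<sigma>^2). The other
  half is a Gaussian weight of deviation sqrt 2 \<sigma> in dimension d^2, whose normalisation
  differs by the factor 2^(d^2/2).\<close>

lemma gaussian_config_tail:
  fixes m :: "real ^ 'd ^ 'd"
  assumes \<sigma>: "\<sigma> > 0" and \<rho>: "0 \<le> \<rho>"
  shows "ennreal (gauss_const TYPE('d) \<sigma> ^ CARD('d)) *
      (\<integral>\<^sup>+Z. indicator {Z. \<rho> < norm (Z - m)} Z * ennreal (gauss_weight \<sigma> m Z) \<partial>lborel)
    \<le> ennreal (2 powr ((real CARD('d))\<^sup>2 / 2) * exp (- \<rho>\<^sup>2 / (4 * \<sigma>\<^sup>2)))"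
proof -
  let ?d = "CARD('d)" and ?e = "exp (- \<rho>\<^sup>2 / (4 * \<sigma>\<^sup>2))" and ?g = "gauss_const TYPE('d)"
  have "(2 powr (- real ?d / 2)) ^ ?d = 2 powr (- ((real ?d)\<^sup>2 / 2))"
    by (subst powr_realpow[symmetric]) (simp_all add: powr_powr power2_eq_square)
  then have "2 powr ((real ?d)\<^sup>2 / 2) * ?g (sqrt 2 * \<sigma>) ^ ?d
      = (2 powr ((real ?d)\<^sup>2 / 2) * 2 powr (- ((real ?d)\<^sup>2 / 2))) * ?g \<sigma> ^ ?d"
    by (simp add: gauss_const_sqrt2 power_mult_distrib)
  then have gc: "?g \<sigma> ^ ?d = 2 powr ((real ?d)\<^sup>2 / 2) * ?g (sqrt 2 * \<sigma>) ^ ?d"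
    by (simp add: powr_minus)
  have pt: "indicator {Z. \<rho> < norm (Z - m)} Z * ennreal (gauss_weight \<sigma> m Z)
      \<le> ennreal ?e * ennreal (gauss_weight (sqrt 2 * \<sigma>) m Z)" for Z
  proof (cases "\<rho> < norm (Z - m)")
    case True
    then have "\<rho>\<^sup>2 \<le> (norm (Z - m))\<^sup>2" using \<rho> by (intro power_mono) auto
    then have "- (norm (Z - m))\<^sup>2 / (2 * \<sigma>\<^sup>2) \<le> - \<rho>\<^sup>2 / (4 * \<sigma>\<^sup>2) + - (norm (Z - m))\<^sup>2 / (4 * \<sigma>\<^sup>2)"
      using \<sigma> by (simp add: field_simps)
    then have "gauss_weight \<sigma> m Z \<le> ?e * gauss_weight (sqrt 2 * \<sigma>) m Z"
      unfolding gauss_weight_sqrt2 exp_add[symmetric] by (simp add: gauss_weight_def)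
    then show ?thesis using True by (simp add: ennreal_mult[symmetric] ennreal_leI)
  qed simp
  have "(\<integral>\<^sup>+Z. indicator {Z. \<rho> < norm (Z - m)} Z * ennreal (gauss_weight \<sigma> m Z) \<partial>lborel)
     \<le> (\<integral>\<^sup>+Z. ennreal ?e * ennreal (gauss_weight (sqrt 2 * \<sigma>) m Z) \<partial>lborel)"
    by (intro nn_integral_mono pt)
  also have "\<dots> = ennreal ?e * (\<integral>\<^sup>+Z. ennreal (gauss_weight (sqrt 2 * \<sigma>) m Z) \<partial>lborel)"
    by (rule nn_integral_cmult) measurable
  finally have "ennreal (?g \<sigma> ^ ?d) * (\<integral>\<^sup>+Z. indicator {Z. \<rho> < norm (Z - m)} Z * ennreal (gauss_weight \<sigma> m Z) \<partial>lborel)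
     \<le> ennreal (?g \<sigma> ^ ?d) * (ennreal ?e * (\<integral>\<^sup>+Z. ennreal (gauss_weight (sqrt 2 * \<sigma>) m Z) \<partial>lborel))"
    by (rule mult_left_mono) simp
  also have "\<dots> = ennreal (2 powr ((real ?d)\<^sup>2 / 2) * ?e) *
      (ennreal (?g (sqrt 2 * \<sigma>) ^ ?d) * (\<integral>\<^sup>+Z. ennreal (gauss_weight (sqrt 2 * \<sigma>) m Z) \<partial>lborel))"
    unfolding gc by (simp add: ennreal_mult mult_ac)
  also have "\<dots> = ennreal (2 powr ((real ?d)\<^sup>2 / 2) * ?e)"
    using \<sigma> by (subst nn_integral_gauss_weight) auto
  finally show ?thesis .
qed

text \<open>For y = \<open>norm (x - c)\<close> and t = y^2/(4 \<sigma>^2), AM-GM gives y \<le>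
  \<sigma> d + (\<sigma>/d) t, and t \<le> d + exp(t - d). The density times exp t is 2^(d/2) times
  the density of deviation sqrt 2 \<sigma>, and exp(-d) absorbs this factor. The bound thus follows
  from the total masses of two Gaussians.\<close>

lemma nn_integral_gaussian_inner:
  fixes c v :: "real ^ 'd"
  assumes \<sigma>: "\<sigma> > 0" and c: "norm c \<le> 1" and v: "norm v \<le> 1"
  shows "(\<integral>\<^sup>+x. ennreal (gaussian_pdf \<sigma> c x) * ennreal \<bar>v \<bullet> x\<bar> \<partial>lborel) \<le> ennreal (1 + \<sigma> * (real CARD('d) + 2))"
proof -
  let ?d = "real CARD('d)"
  have d: "1 \<le> ?d" by (simp add: Suc_leI)
  have pt: "\<bar>v \<bullet> x\<bar> \<le> 1 + \<sigma> * (?d + 1) + \<sigma> / ?d * (exp (- ?d) * exp ((norm (x - c))\<^sup>2 / (4 * \<sigma>\<^sup>2)))" for x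
  proof -
    let ?y = "norm (x - c)" and ?t = "(norm (x - c))\<^sup>2 / (4 * \<sigma>\<^sup>2)"
    have "\<bar>v \<bullet> x\<bar> \<le> norm v * norm x" by (rule Cauchy_Schwarz_ineq2)
    also have "\<dots> \<le> 1 * norm x" using v by (intro mult_right_mono) auto
    also have "1 * norm x \<le> 1 + ?y" using norm_triangle_ineq[of c "x - c"] c by simp
    finally have 1: "\<bar>v \<bullet> x\<bar> \<le> 1 + ?y" .
    have "0 \<le> (?y - 2 * \<sigma> * ?d)\<^sup>2" by simp
    then have "?y * (4 * \<sigma> * ?d) \<le> ?y\<^sup>2 + 4 * \<sigma>\<^sup>2 * ?d\<^sup>2" by (simp add: power2_diff power_mult_distrib algebra_simps)
    then have 2: "?y \<le> \<sigma> * ?d + \<sigma> / ?d * ?t"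
      using \<sigma> d by (simp add: field_simps power2_eq_square)
    have "?t - ?d \<le> exp (?t - ?d)" using exp_ge_add_one_self[of "?t - ?d"] by linarith
    then have "?t \<le> ?d + exp (- ?d) * exp ?t" by (simp add: exp_diff exp_minus field_simps)
    then have "\<sigma> / ?d * ?t \<le> \<sigma> / ?d * (?d + exp (- ?d) * exp ?t)" using \<sigma> by (intro mult_left_mono) auto
    also have "\<dots> = \<sigma> + \<sigma> / ?d * (exp (- ?d) * exp ?t)" by (simp add: distrib_left)
    finally show ?thesis using 1 2 by (simp add: distrib_left)
  qed
  have conv: "gaussian_pdf \<sigma> c x * exp ((norm (x - c))\<^sup>2 / (4 * \<sigma>\<^sup>2)) = 2 powr (?d / 2) * gaussian_pdf (sqrt 2 * \<sigma>) c x" for x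
  proof -
    have "- (norm (x - c))\<^sup>2 / (2 * \<sigma>\<^sup>2) + (norm (x - c))\<^sup>2 / (4 * \<sigma>\<^sup>2) = - (norm (x - c))\<^sup>2 / (4 * \<sigma>\<^sup>2)"
      using \<sigma> by (simp add: field_simps)
    then have "gauss_weight \<sigma> c x * exp ((norm (x - c))\<^sup>2 / (4 * \<sigma>\<^sup>2)) = gauss_weight (sqrt 2 * \<sigma>) c x"
      unfolding gauss_weight_sqrt2 unfolding gauss_weight_def exp_add[symmetric] by simp
    moreover have "2 powr (?d / 2) * 2 powr (- ?d / 2) = 1" by (simp add: powr_add[symmetric])
    then have "2 powr (?d / 2) * gauss_const TYPE('d) (sqrt 2 * \<sigma>) = gauss_const TYPE('d) \<sigma>"
      unfolding gauss_const_sqrt2 by (simp only: mult.assoc[symmetric] mult_1_left)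
    ultimately show ?thesis unfolding gaussian_pdf_eq by (metis mult.assoc)
  qed
  have "(2::real) powr (?d / 2) \<le> exp ?d"
  proof -
    have "ln (2::real) \<le> 1" using ln_2_less_1 by simp
    then have "?d / 2 * ln 2 \<le> ?d" using d mult_mono[of "?d / 2" ?d "ln 2" 1] by simp
    then show ?thesis by (simp add: powr_def)
  qed
  then have e1: "exp (- ?d) * 2 powr (?d / 2) \<le> 1" by (simp add: exp_minus field_simps)
  have "(\<integral>\<^sup>+x. ennreal (gaussian_pdf \<sigma> c x) * ennreal \<bar>v \<bullet> x\<bar> \<partial>lborel)
     \<le> (\<integral>\<^sup>+x. ennreal (1 + \<sigma> * (?d + 1)) * ennreal (gaussian_pdf \<sigma> c x)
          + ennreal (\<sigma> / ?d * (exp (- ?d) * 2 powr (?d / 2))) * ennreal (gaussian_pdf (sqrt 2 * \<sigma>) c x) \<partial>lborel)"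
  proof (rule nn_integral_mono)
    fix x
    have "gaussian_pdf \<sigma> c x * \<bar>v \<bullet> x\<bar>
       \<le> gaussian_pdf \<sigma> c x * (1 + \<sigma> * (?d + 1) + \<sigma> / ?d * (exp (- ?d) * exp ((norm (x - c))\<^sup>2 / (4 * \<sigma>\<^sup>2))))"
      by (intro mult_left_mono pt) simp
    also have "\<dots> = (1 + \<sigma> * (?d + 1)) * gaussian_pdf \<sigma> c x
        + \<sigma> / ?d * exp (- ?d) * (gaussian_pdf \<sigma> c x * exp ((norm (x - c))\<^sup>2 / (4 * \<sigma>\<^sup>2)))"
      by (simp add: algebra_simps)
    also have "\<dots> = (1 + \<sigma> * (?d + 1)) * gaussian_pdf \<sigma> c x
        + \<sigma> / ?d * (exp (- ?d) * 2 powr (?d / 2)) * gaussian_pdf (sqrt 2 * \<sigma>) c x"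
      unfolding conv by (simp add: mult_ac)
    finally have le: "gaussian_pdf \<sigma> c x * \<bar>v \<bullet> x\<bar> \<le> \<dots>" .
    have nn: "0 \<le> 1 + \<sigma> * (?d + 1)" "0 \<le> \<sigma> / ?d * (exp (- ?d) * 2 powr (?d / 2))"
      using \<sigma> by auto
    show "ennreal (gaussian_pdf \<sigma> c x) * ennreal \<bar>v \<bullet> x\<bar> \<le> ennreal (1 + \<sigma> * (?d + 1)) * ennreal (gaussian_pdf \<sigma> c x)
          + ennreal (\<sigma> / ?d * (exp (- ?d) * 2 powr (?d / 2))) * ennreal (gaussian_pdf (sqrt 2 * \<sigma>) c x)"
      using ennreal_leI[OF le] nn
      by (simp only: ennreal_mult ennreal_plus gaussian_pdf_nonneg abs_ge_zero mult_nonneg_nonneg)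
  qed
  also have "\<dots> = ennreal (1 + \<sigma> * (?d + 1)) * (\<integral>\<^sup>+x. ennreal (gaussian_pdf \<sigma> c x) \<partial>lborel)
      + ennreal (\<sigma> / ?d * (exp (- ?d) * 2 powr (?d / 2))) * (\<integral>\<^sup>+x. ennreal (gaussian_pdf (sqrt 2 * \<sigma>) c x) \<partial>lborel)"
    by (subst nn_integral_add) (auto simp: nn_integral_cmult)
  also have "\<dots> = ennreal (1 + \<sigma> * (?d + 1) + \<sigma> / ?d * (exp (- ?d) * 2 powr (?d / 2)))"
    using \<sigma> by (simp add: nn_integral_gaussian_pdf ennreal_plus)
  also have "\<dots> \<le> ennreal (1 + \<sigma> * (?d + 2))"
  proof (rule ennreal_leI)
    have "\<sigma> / ?d * (exp (- ?d) * 2 powr (?d / 2)) \<le> \<sigma> / 1 * 1"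
      using \<sigma> d e1 by (intro mult_mono divide_left_mono) auto
    then show "1 + \<sigma> * (?d + 1) + \<sigma> / ?d * (exp (- ?d) * 2 powr (?d / 2)) \<le> 1 + \<sigma> * (?d + 2)"
      by (simp add: algebra_simps)
  qed
  finally show ?thesis .
qed

section \<open>Expected chord length of a facet\<close>

text \<open>Faces are not mentioned: the vertices span a nonvertical hyperplane of slope at most 1,
  the remaining points do not lie above it, and the \<open>k1\<close>-axis meets the projected
  simplex. Membership in the shadow implies this event in a suitable frame.\<close>

definition facet_event :: "('d \<Rightarrow> real ^ 'd) \<Rightarrow> 'd \<Rightarrow> 'd \<Rightarrow> nat \<Rightarrow> ('d \<Rightarrow> nat) \<Rightarrow> (nat \<Rightarrow> real ^ 'd) \<Rightarrow> bool" where
  "facet_event u k1 k2 n f a \<longleftrightarrow> base_det k2 (config u f a) \<noteq> 0 \<and>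
     hyperplane_coeffs k2 (config u f a) \<in> weakly_above u k1 k2 ({1..n} - range f) a \<and>
     balanced k1 k2 0 (config u f a)"

definition robust_facet_event ::
  "('d \<Rightarrow> real ^ 'd) \<Rightarrow> 'd \<Rightarrow> 'd \<Rightarrow> real \<Rightarrow> nat \<Rightarrow> ('d \<Rightarrow> nat) \<Rightarrow> (nat \<Rightarrow> real ^ 'd) \<Rightarrow> bool" where
  "robust_facet_event u k1 k2 \<epsilon> n f a \<longleftrightarrow> base_det k2 (config u f a) \<noteq> 0 \<and>
     hyperplane_coeffs k2 (config u f a) \<in> strictly_above u k1 k2 ({1..n} - range f) a \<and>
     balanced k1 k2 \<epsilon> (config u f a)"

lemma pred_conjI:
  "Measurable.pred M P \<Longrightarrow> Measurable.pred M Q \<Longrightarrow> Measurable.pred M (\<lambda>x. P x \<and> Q x)"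
  by measurable

lemma pred_above:
  assumes f: "range f \<subseteq> {1..n}" and P: "P = weakly_above \<or> P = strictly_above"
  shows "Measurable.pred (Pi\<^sub>M {1..n} (\<lambda>_. lborel))
    (\<lambda>a. base_det k2 (config u f a) \<noteq> 0 \<and> hyperplane_coeffs k2 (config u f a) \<in> P u k1 k2 ({1..n} - range f) a)"
proof -
  note [measurable] = config_measurable[OF f]
  have 1: "Measurable.pred (Pi\<^sub>M {1..n} (\<lambda>_. lborel)) (\<lambda>a. \<forall>i\<in>{1..n} - range f. R i a)"
    if "\<And>i. i \<in> {1..n} \<Longrightarrow> Measurable.pred (Pi\<^sub>M {1..n} (\<lambda>_. lborel)) (R i)" for R :: "nat \<Rightarrow> (nat \<Rightarrow> real ^ 'a) \<Rightarrow> bool"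
    using that by (intro pred_intros_finite) auto
  have "Measurable.pred (Pi\<^sub>M {1..n} (\<lambda>_. lborel)) (\<lambda>a. \<forall>i\<in>{1..n} - range f.
      u k2 \<bullet> a i \<le> lift_base u k2 (a i) \<bullet> hyperplane_coeffs k2 (config u f a))"
  proof (rule 1)
    fix i assume "i \<in> {1..n}"
    note [measurable] = PiM_component_borel[OF this]
    show "Measurable.pred (Pi\<^sub>M {1..n} (\<lambda>_. lborel))
      (\<lambda>a. u k2 \<bullet> a i \<le> lift_base u k2 (a i) \<bullet> hyperplane_coeffs k2 (config u f a))"
      unfolding not_less[symmetric] by measurable
  qed
  moreover have "Measurable.pred (Pi\<^sub>M {1..n} (\<lambda>_. lborel)) (\<lambda>a. \<forall>i\<in>{1..n} - range f.
      u k2 \<bullet> a i < lift_base u k2 (a i) \<bullet> hyperplane_coeffs k2 (config u f a))"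
  proof (rule 1)
    fix i assume "i \<in> {1..n}"
    note [measurable] = PiM_component_borel[OF this]
    show "Measurable.pred (Pi\<^sub>M {1..n} (\<lambda>_. lborel))
      (\<lambda>a. u k2 \<bullet> a i < lift_base u k2 (a i) \<bullet> hyperplane_coeffs k2 (config u f a))"
      by measurable
  qed
  moreover have "Measurable.pred (Pi\<^sub>M {1..n} (\<lambda>_. lborel)) (\<lambda>a. base_det k2 (config u f a) \<noteq> 0)" by measurable
  moreover have "Measurable.pred (Pi\<^sub>M {1..n} (\<lambda>_. lborel)) (\<lambda>a. \<bar>hyperplane_coeffs k2 (config u f a) $ k1\<bar> \<le> 1)"
    by measurable
  ultimately show ?thesis
    using P unfolding weakly_above_def strictly_above_def
    by (elim disjE; simp only: mem_Collect_eq) (intro pred_conjI; assumption)+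
qed

lemma pred_balanced:
  assumes f: "range f \<subseteq> {1..n}" and "0 \<le> \<epsilon>"
  shows "Measurable.pred (Pi\<^sub>M {1..n} (\<lambda>_. lborel)) (\<lambda>a. balanced k1 k2 \<epsilon> (config u f a))"
proof -
  note [measurable] = config_measurable[OF f] balanced_measurable[OF assms(2), of k1 k2]
  have "Measurable.pred (Pi\<^sub>M {1..n} (\<lambda>_. lborel)) (\<lambda>a. config u f a \<in> {Z. balanced k1 k2 \<epsilon> Z})"
    by measurable
  then show ?thesis by simp
qed

lemma pred_facet_event:
  assumes "range f \<subseteq> {1..n}"
  shows "Measurable.pred (Pi\<^sub>M {1..n} (\<lambda>_. lborel)) (facet_event u k1 k2 n f)"
  unfolding facet_event_def[abs_def] conj_assoc[symmetric]
  by (rule pred_conjI[OF pred_above[OF assms] pred_balanced[OF assms]]) auto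

lemma pred_robust_facet_event:
  assumes "range f \<subseteq> {1..n}" "0 \<le> \<epsilon>"
  shows "Measurable.pred (Pi\<^sub>M {1..n} (\<lambda>_. lborel)) (robust_facet_event u k1 k2 \<epsilon> n f)"
  unfolding robust_facet_event_def[abs_def] conj_assoc[symmetric]
  by (rule pred_conjI[OF pred_above[OF assms(1)] pred_balanced[OF assms]]) auto

lemma lift_base_nonzero: "lift_base u k x \<noteq> 0"
  by (auto simp: lift_base_def vec_eq_iff)

text \<open>The inequality for a single facet holds for every position \<open>y\<close> of the
  remaining points, which enter only through the admissible set of hyperplanes; it is then
  integrated over \<open>y\<close>.\<close>

lemma expected_facet_le_chord:
  fixes u :: "'d \<Rightarrow> real ^ 'd" and c :: "nat \<Rightarrow> real ^ 'd" and \<sigma> \<eta> \<rho> \<delta> :: real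
  assumes f: "inj f" "range f \<subseteq> {1..n}" and u: "orthonormal_frame u" and k: "k1 \<noteq> k2"
    and \<sigma>: "\<sigma> > 0" and \<eta>: "0 < \<eta>" "\<eta> < 1"
    and \<delta>: "\<delta> = 3 * real CARD('d) * \<eta> * (norm (config u f c) + \<rho>)" "2 * \<rho> * \<delta> + \<delta>\<^sup>2 \<le> 2 * \<sigma>\<^sup>2"
  shows "(\<integral>\<^sup>+a. indicator {a. facet_event u k1 k2 n f a} a *
        indicator {Z. norm (Z - config u f c) \<le> \<rho>} (config u f a) \<partial>gaussian_points n \<sigma> c)
    \<le> ennreal (exp 1 / (1 - \<eta>) ^ (CARD('d) - 1) * (CARD('d) / (\<sigma> * \<eta>))) *
      (\<integral>\<^sup>+a. indicator {a. robust_facet_event u k1 k2 (\<eta> / CARD('d)) n f a} a *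
        ennreal (chord k1 k2 (\<eta> / CARD('d)) (config u f a)) \<partial>gaussian_points n \<sigma> c)"
proof -
  let ?I = "range f" and ?e = "\<eta> / CARD('d)" and ?m = "config u f c"
  let ?C = "ennreal (exp 1 / (1 - \<eta>) ^ (CARD('d) - 1) * (CARD('d) / (\<sigma> * \<eta>)))"
  let ?w = "\<lambda>y. ennreal ((\<Prod>i\<in>{1..n} - ?I. gaussian_pdf \<sigma> (c i) (y i)) * gauss_const TYPE('d) \<sigma> ^ CARD('d))"
  have e0: "0 \<le> ?e" using \<eta> by simp
  have bij: "bij_betw f UNIV ?I" using f by (simp add: bij_betw_def)
  note [measurable] = config_measurable[OF f(2)] balanced_measurable[of 0 k1 k2] balanced_measurable[OF e0, of k1 k2]
    pred_facet_event[OF f(2)] pred_robust_facet_event[OF f(2) e0]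
  have [measurable]: "weakly_above u k1 k2 ({1..n} - ?I) a \<in> sets borel" "strictly_above u k1 k2 ({1..n} - ?I) a \<in> sets borel" for a
    by (auto intro: above_sets)
  define \<Phi> where "\<Phi> Z a = indicator {Z. base_det k2 Z \<noteq> 0 \<and> hyperplane_coeffs k2 Z \<in> weakly_above u k1 k2 ({1..n} - ?I) a} Z *
      (indicator {Z. balanced k1 k2 0 Z} Z * indicator {Z. norm (Z - ?m) \<le> \<rho>} Z :: ennreal)" for Z a
  define \<Psi> where "\<Psi> Z a = indicator {Z. base_det k2 Z \<noteq> 0 \<and> hyperplane_coeffs k2 Z \<in> strictly_above u k1 k2 ({1..n} - ?I) a} Z *
      (indicator {Z. balanced k1 k2 ?e Z} Z * ennreal (chord k1 k2 ?e Z))" for Z a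
  have \<Phi>: "indicator {a. facet_event u k1 k2 n f a} a * indicator {Z. norm (Z - ?m) \<le> \<rho>} (config u f a) = \<Phi> (config u f a) a" for a
    by (simp add: \<Phi>_def facet_event_def indicator_def)
  have \<Psi>: "indicator {a. robust_facet_event u k1 k2 ?e n f a} a * ennreal (chord k1 k2 ?e (config u f a)) = \<Psi> (config u f a) a" for a
    by (simp add: \<Psi>_def robust_facet_event_def indicator_def)
  have dep: "weakly_above u k1 k2 ({1..n} - ?I) a = weakly_above u k1 k2 ({1..n} - ?I) b"
            "strictly_above u k1 k2 ({1..n} - ?I) a = strictly_above u k1 k2 ({1..n} - ?I) b"
    if "\<And>i. i \<in> {1..n} - ?I \<Longrightarrow> a i = b i" for a b
    using that by (auto simp: weakly_above_def strictly_above_def)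
  have meas\<Phi>: "(\<lambda>a. \<Phi> (config u f a) a) \<in> borel_measurable (Pi\<^sub>M {1..n} (\<lambda>_. lborel))"
    unfolding \<Phi>[symmetric] by measurable
  have meas\<Psi>: "(\<lambda>a. \<Psi> (config u f a) a) \<in> borel_measurable (Pi\<^sub>M {1..n} (\<lambda>_. lborel))"
    unfolding \<Psi>[symmetric] by measurable
  have E\<Phi>: "(\<integral>\<^sup>+a. \<Phi> (config u f a) a \<partial>gaussian_points n \<sigma> c)
     = (\<integral>\<^sup>+y. ?w y * (\<integral>\<^sup>+Z. \<Phi> Z y * ennreal (gauss_weight \<sigma> ?m Z) \<partial>lborel) \<partial>Pi\<^sub>M ({1..n} - ?I) (\<lambda>_. lborel))"
  proof (rule nn_integral_gaussian_points_split[where \<Phi>=\<Phi> and n=n, OF f(2) bij u meas\<Phi>])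
    show "(\<lambda>Z. \<Phi> Z a) \<in> borel_measurable borel" for a unfolding \<Phi>_def by measurable
    show "\<Phi> Z a = \<Phi> Z b" if "\<And>i. i \<in> {1..n} - ?I \<Longrightarrow> a i = b i" for Z a b
      unfolding \<Phi>_def using dep(1)[of a b, OF that] by simp
  qed
  have E\<Psi>: "(\<integral>\<^sup>+a. \<Psi> (config u f a) a \<partial>gaussian_points n \<sigma> c)
     = (\<integral>\<^sup>+y. ?w y * (\<integral>\<^sup>+Z. \<Psi> Z y * ennreal (gauss_weight \<sigma> ?m Z) \<partial>lborel) \<partial>Pi\<^sub>M ({1..n} - ?I) (\<lambda>_. lborel))"
  proof (rule nn_integral_gaussian_points_split[where \<Phi>=\<Psi> and n=n, OF f(2) bij u meas\<Psi>])
    show "(\<lambda>Z. \<Psi> Z a) \<in> borel_measurable borel" for a unfolding \<Psi>_def by measurable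
    show "\<Psi> Z a = \<Psi> Z b" if "\<And>i. i \<in> {1..n} - ?I \<Longrightarrow> a i = b i" for Z a b
      unfolding \<Psi>_def using dep(2)[of a b, OF that] by simp
  qed
  have inner: "(\<integral>\<^sup>+Z. \<Phi> Z y * ennreal (gauss_weight \<sigma> ?m Z) \<partial>lborel)
      \<le> ?C * (\<integral>\<^sup>+Z. \<Psi> Z y * ennreal (gauss_weight \<sigma> ?m Z) \<partial>lborel)" for y
  proof -
    let ?W = "weakly_above u k1 k2 ({1..n} - ?I) y" and ?S = "strictly_above u k1 k2 ({1..n} - ?I) y"
    have "(\<integral>\<^sup>+Z. \<Phi> Z y * ennreal (gauss_weight \<sigma> ?m Z) \<partial>lborel)
       = (\<integral>\<^sup>+Z. indicator {Z. base_det k2 Z \<noteq> 0 \<and> hyperplane_coeffs k2 Z \<in> ?W} Z *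
          (indicator {Z. balanced k1 k2 0 Z} Z * indicator {Z. norm (Z - ?m) \<le> \<rho>} Z * ennreal (gauss_weight \<sigma> ?m Z)) \<partial>lborel)"
      by (simp only: \<Phi>_def mult.assoc)
    also have "\<dots> \<le> ?C * (\<integral>\<^sup>+Z. indicator {Z. base_det k2 Z \<noteq> 0 \<and> hyperplane_coeffs k2 Z \<in> ?W} Z *
          (indicator {Z. balanced k1 k2 ?e Z} Z * ennreal (chord k1 k2 ?e Z) * ennreal (gauss_weight \<sigma> ?m Z)) \<partial>lborel)"
      by (rule nn_integral_facet_le_chord[OF \<sigma> k \<eta> _ _ \<delta>]) (auto simp: weakly_above_def intro: above_sets[unfolded weakly_above_def])
    also have "(\<integral>\<^sup>+Z. indicator {Z. base_det k2 Z \<noteq> 0 \<and> hyperplane_coeffs k2 Z \<in> ?W} Z *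
          (indicator {Z. balanced k1 k2 ?e Z} Z * ennreal (chord k1 k2 ?e Z) * ennreal (gauss_weight \<sigma> ?m Z)) \<partial>lborel)
       = (\<integral>\<^sup>+Z. indicator {Z. base_det k2 Z \<noteq> 0 \<and> hyperplane_coeffs k2 Z \<in> ?S} Z *
          (indicator {Z. balanced k1 k2 ?e Z} Z * ennreal (chord k1 k2 ?e Z) * ennreal (gauss_weight \<sigma> ?m Z)) \<partial>lborel)"
    \<comment> \<open>\<open>lift_base\<close> has entry 1 at \<open>k2\<close>, so passing through
      a further point is a nontrivial linear equation for the coefficients.\<close>
    proof (rule nn_integral_coeffs_AE_cong[where K="{1..n} - ?I" and \<alpha>="\<lambda>i. lift_base u k2 (y i)" and \<beta>="\<lambda>i. u k2 \<bullet> y i"])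
      show "F \<in> ?W \<longleftrightarrow> F \<in> ?S" if "\<And>i. i \<in> {1..n} - ?I \<Longrightarrow> lift_base u k2 (y i) \<bullet> F \<noteq> u k2 \<bullet> y i" for F
        using that by (force simp: weakly_above_def strictly_above_def)
    qed (auto simp: lift_base_nonzero)
    also have "\<dots> = (\<integral>\<^sup>+Z. \<Psi> Z y * ennreal (gauss_weight \<sigma> ?m Z) \<partial>lborel)"
      by (simp only: \<Psi>_def mult.assoc)
    finally show ?thesis .
  qed
  have w_meas: "?w \<in> borel_measurable (Pi\<^sub>M ({1..n} - ?I) (\<lambda>_. lborel))"
  proof -
    have "(\<lambda>y. \<Prod>i\<in>{1..n} - ?I. gaussian_pdf \<sigma> (c i) (y i)) \<in> borel_measurable (Pi\<^sub>M ({1..n} - ?I) (\<lambda>_. lborel))"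
      by (rule gaussian_density_measurable) simp
    then show ?thesis by measurable
  qed
  have "(\<integral>\<^sup>+a. \<Phi> (config u f a) a \<partial>gaussian_points n \<sigma> c)
     \<le> (\<integral>\<^sup>+a. ?C * \<Psi> (config u f a) a \<partial>gaussian_points n \<sigma> c)"
  proof -
    have "(\<integral>\<^sup>+a. ?C * \<Psi> (config u f a) a \<partial>gaussian_points n \<sigma> c)
     = (\<integral>\<^sup>+y. ?w y * (\<integral>\<^sup>+Z. ?C * \<Psi> Z y * ennreal (gauss_weight \<sigma> ?m Z) \<partial>lborel) \<partial>Pi\<^sub>M ({1..n} - ?I) (\<lambda>_. lborel))"
    \<comment> \<open>The constant travels inside \<open>\<Phi>\<close>, so that it need not be
      pulled out of the integral over \<open>y\<close>, which would call for measurability of the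
      inner integral in \<open>y\<close>.\<close>
    proof (rule nn_integral_gaussian_points_split[where \<Phi>="\<lambda>Z a. ?C * \<Psi> Z a" and n=n, OF f(2) bij u])
      show "(\<lambda>a. ?C * \<Psi> (config u f a) a) \<in> borel_measurable (Pi\<^sub>M {1..n} (\<lambda>_. lborel))"
        using meas\<Psi> by measurable
      show "(\<lambda>Z. ?C * \<Psi> Z a) \<in> borel_measurable borel" for a unfolding \<Psi>_def by measurable
      show "?C * \<Psi> Z a = ?C * \<Psi> Z b" if "\<And>i. i \<in> {1..n} - ?I \<Longrightarrow> a i = b i" for Z a b
        unfolding \<Psi>_def using dep(2)[of a b, OF that] by simp
    qed
    moreover have "(\<integral>\<^sup>+Z. ?C * \<Psi> Z y * ennreal (gauss_weight \<sigma> ?m Z) \<partial>lborel)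
        = ?C * (\<integral>\<^sup>+Z. \<Psi> Z y * ennreal (gauss_weight \<sigma> ?m Z) \<partial>lborel)" for y
      unfolding mult.assoc by (rule nn_integral_cmult) (unfold \<Psi>_def, measurable)
    ultimately show ?thesis
      unfolding E\<Phi> using inner by (auto intro!: nn_integral_mono mult_left_mono)
  qed
  also have "\<dots> = ?C * (\<integral>\<^sup>+a. \<Psi> (config u f a) a \<partial>gaussian_points n \<sigma> c)"
    by (rule nn_integral_cmult) (use meas\<Psi> in \<open>simp add: measurable_cong_sets[OF sets_gaussian_points refl]\<close>)
  finally show ?thesis unfolding \<Phi> \<Psi> .
qed

text \<open>An integrand that depends on the vertices alone: the remaining points integrate to
  1.\<close>

lemma nn_integral_config_gaussian:
  fixes u :: "'d \<Rightarrow> real ^ 'd" and c :: "nat \<Rightarrow> real ^ 'd"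
  assumes f: "inj f" "range f \<subseteq> {1..n}" and u: "orthonormal_frame u" and \<sigma>: "\<sigma> > 0"
    and G [measurable]: "G \<in> borel_measurable borel"
  shows "(\<integral>\<^sup>+a. G (config u f a) \<partial>gaussian_points n \<sigma> c)
    = ennreal (gauss_const TYPE('d) \<sigma> ^ CARD('d)) * (\<integral>\<^sup>+Z. G Z * ennreal (gauss_weight \<sigma> (config u f c) Z) \<partial>lborel)"
proof -
  interpret product_sigma_finite "\<lambda>_. lborel :: (real ^ 'd) measure" ..
  let ?K = "{1..n} - range f"
  let ?X = "\<integral>\<^sup>+Z. G Z * ennreal (gauss_weight \<sigma> (config u f c) Z) \<partial>lborel"
  note [measurable] = config_measurable[OF f(2)]
  have [measurable]: "(\<lambda>y. \<Prod>i\<in>?K. gaussian_pdf \<sigma> (c i) (y i)) \<in> borel_measurable (Pi\<^sub>M ?K (\<lambda>_. lborel))"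
    by (rule gaussian_density_measurable) simp
  have "(\<integral>\<^sup>+a. G (config u f a) \<partial>gaussian_points n \<sigma> c)
     = (\<integral>\<^sup>+y. ennreal ((\<Prod>i\<in>?K. gaussian_pdf \<sigma> (c i) (y i)) * gauss_const TYPE('d) \<sigma> ^ CARD('d)) * ?X \<partial>Pi\<^sub>M ?K (\<lambda>_. lborel))"
  proof (rule nn_integral_gaussian_points_split[where \<Phi>="\<lambda>Z a. G Z" and n=n, OF f(2) _ u])
    show "bij_betw f UNIV (range f)" using f by (simp add: bij_betw_def)
    show "(\<lambda>a. G (config u f a)) \<in> borel_measurable (Pi\<^sub>M {1..n} (\<lambda>_. lborel))" by measurable
  qed (simp_all add: G)
  also have "\<dots> = (\<integral>\<^sup>+y. (ennreal (gauss_const TYPE('d) \<sigma> ^ CARD('d)) * ?X) *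
      (\<Prod>i\<in>?K. ennreal (gaussian_pdf \<sigma> (c i) (y i))) \<partial>Pi\<^sub>M ?K (\<lambda>_. lborel))"
    by (intro nn_integral_cong) (simp add: prod_ennreal ennreal_mult prod_nonneg mult_ac)
  also have "\<dots> = (ennreal (gauss_const TYPE('d) \<sigma> ^ CARD('d)) * ?X) *
      (\<integral>\<^sup>+y. (\<Prod>i\<in>?K. ennreal (gaussian_pdf \<sigma> (c i) (y i))) \<partial>Pi\<^sub>M ?K (\<lambda>_. lborel))"
    by (rule nn_integral_cmult) (simp add: prod_ennreal)
  also have "(\<integral>\<^sup>+y. (\<Prod>i\<in>?K. ennreal (gaussian_pdf \<sigma> (c i) (y i))) \<partial>Pi\<^sub>M ?K (\<lambda>_. lborel))
      = (\<Prod>i\<in>?K. \<integral>\<^sup>+x. ennreal (gaussian_pdf \<sigma> (c i) x) \<partial>lborel)"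
    by (rule product_nn_integral_prod) auto
  also have "\<dots> = 1" by (simp add: nn_integral_gaussian_pdf[OF \<sigma>])
  finally show ?thesis by simp
qed

lemma gaussian_points_tail:
  fixes u :: "'d \<Rightarrow> real ^ 'd" and c :: "nat \<Rightarrow> real ^ 'd"
  assumes f: "inj f" "range f \<subseteq> {1..n}" and u: "orthonormal_frame u" and \<sigma>: "\<sigma> > 0" and \<rho>: "0 \<le> \<rho>"
  shows "(\<integral>\<^sup>+a. indicator {Z. \<rho> < norm (Z - config u f c)} (config u f a) \<partial>gaussian_points n \<sigma> c)
    \<le> ennreal (2 powr ((real CARD('d))\<^sup>2 / 2) * exp (- \<rho>\<^sup>2 / (4 * \<sigma>\<^sup>2)))"
proof -
  have m: "indicator {Z. \<rho> < norm (Z - config u f c)} \<in> borel_measurable borel" by measurable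
  show ?thesis unfolding nn_integral_config_gaussian[OF f u \<sigma> m] by (rule gaussian_config_tail[OF \<sigma> \<rho>])
qed

lemma nn_integral_gaussian_points_inner:
  fixes c :: "nat \<Rightarrow> real ^ 'd"
  assumes k: "k \<in> {1..n}" and \<sigma>: "\<sigma> > 0" and c: "norm (c k) \<le> 1" and v: "norm v \<le> 1"
  shows "(\<integral>\<^sup>+a. ennreal \<bar>v \<bullet> a k\<bar> \<partial>gaussian_points n \<sigma> c) \<le> ennreal (1 + \<sigma> * (real CARD('d) + 2))"
proof -
  interpret product_sigma_finite "\<lambda>_. lborel :: (real ^ 'd) measure" ..
  have [measurable]: "(\<lambda>a. a k) \<in> borel_measurable (Pi\<^sub>M {1..n} (\<lambda>_. lborel))"
    by (rule PiM_component_borel[OF k])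
  have "(\<integral>\<^sup>+a. ennreal \<bar>v \<bullet> a k\<bar> \<partial>gaussian_points n \<sigma> c)
     = (\<integral>\<^sup>+a. ennreal (\<Prod>i\<in>{1..n}. gaussian_pdf \<sigma> (c i) (a i)) * ennreal \<bar>v \<bullet> a k\<bar> \<partial>Pi\<^sub>M {1..n} (\<lambda>_. lborel))"
    by (rule nn_integral_gaussian_points) measurable
  also have "\<dots> = (\<integral>\<^sup>+a. (\<Prod>i\<in>{1..n}. ennreal (gaussian_pdf \<sigma> (c i) (a i)) * (if i = k then ennreal \<bar>v \<bullet> a i\<bar> else 1))
       \<partial>Pi\<^sub>M {1..n} (\<lambda>_. lborel))"
    using k by (intro nn_integral_cong) (simp add: prod.distrib prod_ennreal prod.delta)
  also have "\<dots> = (\<Prod>i\<in>{1..n}. \<integral>\<^sup>+x. ennreal (gaussian_pdf \<sigma> (c i) x) * (if i = k then ennreal \<bar>v \<bullet> x\<bar> else 1) \<partial>lborel)"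
    by (rule product_nn_integral_prod) auto
  also have "\<dots> = (\<integral>\<^sup>+x. ennreal (gaussian_pdf \<sigma> (c k) x) * ennreal \<bar>v \<bullet> x\<bar> \<partial>lborel) *
      (\<Prod>i\<in>{1..n} - {k}. \<integral>\<^sup>+x. ennreal (gaussian_pdf \<sigma> (c i) x) * (if i = k then ennreal \<bar>v \<bullet> x\<bar> else 1) \<partial>lborel)"
    using k by (subst prod.remove[of _ k]) auto
  also have "(\<Prod>i\<in>{1..n} - {k}. \<integral>\<^sup>+x. ennreal (gaussian_pdf \<sigma> (c i) x) * (if i = k then ennreal \<bar>v \<bullet> x\<bar> else 1) \<partial>lborel) = 1"
    by (rule prod.neutral) (auto simp: nn_integral_gaussian_pdf[OF \<sigma>])
  finally show ?thesis
    using nn_integral_gaussian_inner[OF \<sigma> c v] by simp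
qed

section \<open>Chords of distinct facets are disjoint\<close>

lemma heights_config: "heights k (config u f a) F $ j = lift_base u k (a (f j)) \<bullet> F"
proof -
  have "lift_base u k (a (f j)) \<bullet> F = F $ k + (\<Sum>c\<in>UNIV - {k}. F $ c * (u c \<bullet> a (f j)))"
    unfolding inner_vec_def[of "lift_base u k (a (f j))"]
    by (subst sum.remove[of _ k]) (auto simp: lift_base_def mult.commute intro!: sum.cong)
  then show ?thesis by (simp add: heights_sum config_nth Compl_eq_Diff_UNIV)
qed

text \<open>A weighted mean of the values of an affine function is its value at the weighted point.
  That point lies on the line, where all horizontal coordinates except the one along
  \<open>k1\<close> vanish.\<close>

lemma balanced_heights:
  fixes l :: "real ^ 'd"
  assumes "k1 \<noteq> k2" "(\<Sum>j\<in>UNIV. l $ j) = 1" "\<And>c. c \<noteq> k1 \<Longrightarrow> c \<noteq> k2 \<Longrightarrow> l \<bullet> Z $ c = 0"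
  shows "l \<bullet> heights k2 Z F = F $ k2 + F $ k1 * (l \<bullet> Z $ k1)"
proof -
  have "l \<bullet> heights k2 Z F = F $ k2 * (l \<bullet> 1) + (\<Sum>c\<in>-{k2}. F $ c * (l \<bullet> Z $ c))"
    by (simp add: heights_sum inner_add_right inner_sum_right)
  also have "(\<Sum>c\<in>-{k2}. F $ c * (l \<bullet> Z $ c)) = (\<Sum>c\<in>-{k2}. if c = k1 then F $ k1 * (l \<bullet> Z $ k1) else 0)"
    by (rule sum.cong) (auto simp: assms(3))
  also have "\<dots> = F $ k1 * (l \<bullet> Z $ k1)" using assms(1) by simp
  also have "l \<bullet> 1 = 1" using assms(2) by (simp add: inner_vec_def)
  finally show ?thesis by simp
qed

text \<open>A robustly balanced configuration meets the line with strictly positive weights on a whole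
  interval of length \<open>chord\<close>: the weights are moved along the affine dependency \<open>slope_cofactor\<close>.\<close>
lemma chord_weights:
  fixes Z :: "real ^ 'd ^ 'd"
  assumes k: "k1 \<noteq> k2" and \<epsilon>: "0 < \<epsilon>" and b: "balanced k1 k2 \<epsilon> Z" and D: "base_det k2 Z \<noteq> 0"
  shows "\<exists>m. \<forall>x. \<bar>x - m\<bar> < chord k1 k2 \<epsilon> Z / 2 \<longrightarrow> (\<exists>l :: real ^ 'd. (\<forall>j. 0 < l $ j) \<and> (\<Sum>j\<in>UNIV. l $ j) = 1 \<and>
      (\<forall>c. c \<noteq> k1 \<longrightarrow> c \<noteq> k2 \<longrightarrow> l \<bullet> Z $ c = 0) \<and> l \<bullet> Z $ k1 = x)"
proof -
  let ?g = "slope_cofactor k1 k2 Z"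
  obtain l :: "real ^ 'd" where l: "\<And>j. \<epsilon> \<le> l $ j" "(\<Sum>j\<in>UNIV. l $ j) = 1"
    "\<And>c. c \<noteq> k1 \<Longrightarrow> c \<noteq> k2 \<Longrightarrow> l \<bullet> Z $ c = 0"
    using b by (auto simp: balanced_def)
  have g1: "?g \<bullet> Z $ k1 = base_det k2 Z" by (rule base_det_slope[OF k, symmetric])
  then have g0: "?g \<noteq> 0" using D by auto
  have "\<exists>l' :: real ^ 'd. (\<forall>j. 0 < l' $ j) \<and> (\<Sum>j\<in>UNIV. l' $ j) = 1 \<and>
      (\<forall>c. c \<noteq> k1 \<longrightarrow> c \<noteq> k2 \<longrightarrow> l' \<bullet> Z $ c = 0) \<and> l' \<bullet> Z $ k1 = x"
    if x: "\<bar>x - l \<bullet> Z $ k1\<bar> < chord k1 k2 \<epsilon> Z / 2" for x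
  proof (intro exI conjI allI impI)
    define s where "s = (x - l \<bullet> Z $ k1) / base_det k2 Z"
    let ?l = "l + s *\<^sub>R ?g"
    have "\<bar>s\<bar> * norm ?g < \<epsilon>"
      using x D g0 by (simp add: s_def chord_def abs_divide field_simps)
    then have sg: "\<bar>s * ?g $ j\<bar> < \<epsilon>" for j
      using component_le_norm_cart[of ?g j] mult_left_mono[of "\<bar>?g $ j\<bar>" "norm ?g" "\<bar>s\<bar>"]
      by (simp add: abs_mult)
    show "0 < ?l $ j" for j using sg[of j] l(1)[of j] by simp
    have "(\<Sum>j\<in>UNIV. ?g $ j) = 0" using slope_cofactor_one[OF k, of Z] by (simp add: inner_vec_def)
    then show "(\<Sum>j\<in>UNIV. ?l $ j) = 1" by (simp add: sum.distrib l(2) sum_distrib_left[symmetric])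
    show "?l \<bullet> Z $ c = 0" if "c \<noteq> k1" "c \<noteq> k2" for c
      using l(3)[OF that] slope_cofactor_orthogonal[OF k that, of Z] by (simp add: inner_add_left)
    show "?l \<bullet> Z $ k1 = x" using D by (simp add: inner_add_left g1 s_def)
  qed
  then show ?thesis by blast
qed

text \<open>The vertices lie on the hyperplane by interpolation and all other points strictly below
  it, so the points in contact with it are exactly the vertices.\<close>

lemma strictly_above_mono:
  assumes Q: "hyperplane_coeffs k2 (config u f a) \<in> strictly_above u k1 k2 ({1..n} - range f) a"
    and D: "base_det k2 (config u f a) \<noteq> 0" and i: "i \<in> {1..n}"
  shows "u k2 \<bullet> a i \<le> lift_base u k2 (a i) \<bullet> hyperplane_coeffs k2 (config u f a)"
    and "u k2 \<bullet> a i = lift_base u k2 (a i) \<bullet> hyperplane_coeffs k2 (config u f a) \<Longrightarrow> i \<in> range f"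
proof -
  have eq: "u k2 \<bullet> a (f j) = lift_base u k2 (a (f j)) \<bullet> hyperplane_coeffs k2 (config u f a)" for j
    using heights_eq_iff[OF D] heights_config[of k2 u f a] by (metis config_nth)
  show "u k2 \<bullet> a i \<le> lift_base u k2 (a i) \<bullet> hyperplane_coeffs k2 (config u f a)"
    using Q i eq by (cases "i \<in> range f") (auto simp: strictly_above_def less_imp_le)
  show "i \<in> range f" if "u k2 \<bullet> a i = lift_base u k2 (a i) \<bullet> hyperplane_coeffs k2 (config u f a)"
    using Q i that by (force simp: strictly_above_def)
qed

text \<open>Over the common point x, the first facet has a point of the convex hull on its own
  hyperplane and not above the second one, and vice versa; hence the two hyperplanes have equal
  height over x. Since the weights are positive, every vertex of the first facet then lies on the
  second hyperplane, and strictness makes it a vertex of the second facet.\<close>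

lemma robust_facet_subset:
  fixes l l' :: "real ^ 'd"
  assumes k: "k1 \<noteq> k2"
    and Q: "hyperplane_coeffs k2 (config u f a) \<in> strictly_above u k1 k2 ({1..n} - range f) a"
      "base_det k2 (config u f a) \<noteq> 0" "range f \<subseteq> {1..n}"
    and Q': "hyperplane_coeffs k2 (config u f' a) \<in> strictly_above u k1 k2 ({1..n} - range f') a"
      "base_det k2 (config u f' a) \<noteq> 0" "range f' \<subseteq> {1..n}"
    and l: "\<And>j. 0 < l $ j" "(\<Sum>j\<in>UNIV. l $ j) = 1" "\<And>c. c \<noteq> k1 \<Longrightarrow> c \<noteq> k2 \<Longrightarrow> l \<bullet> config u f a $ c = 0"
    and l': "\<And>j. 0 < l' $ j" "(\<Sum>j\<in>UNIV. l' $ j) = 1" "\<And>c. c \<noteq> k1 \<Longrightarrow> c \<noteq> k2 \<Longrightarrow> l' \<bullet> config u f' a $ c = 0"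
    and x: "l \<bullet> config u f a $ k1 = l' \<bullet> config u f' a $ k1"
  shows "range f \<subseteq> range f'"
proof -
  let ?Z = "config u f a" and ?Z' = "config u f' a"
  let ?F = "hyperplane_coeffs k2 ?Z" and ?F' = "hyperplane_coeffs k2 ?Z'"
  have h: "heights k2 ?Z ?F = ?Z $ k2" and h': "heights k2 ?Z' ?F' = ?Z' $ k2"
    using heights_eq_iff Q(2) Q'(2) by blast+
  have 1: "l \<bullet> heights k2 ?Z G = G $ k2 + G $ k1 * (l \<bullet> ?Z $ k1)" for G
    by (rule balanced_heights[OF k l(2,3)])
  have 2: "l' \<bullet> heights k2 ?Z' G = G $ k2 + G $ k1 * (l' \<bullet> ?Z' $ k1)" for G
    by (rule balanced_heights[OF k l'(2,3)])
  have fj: "f j \<in> {1..n}" and fj': "f' j \<in> {1..n}" for j using Q(3) Q'(3) by blast+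
  have le: "?Z $ k2 $ j \<le> heights k2 ?Z ?F' $ j" for j
    using strictly_above_mono(1)[OF Q'(1,2) fj] by (simp add: heights_config config_nth)
  have le': "?Z' $ k2 $ j \<le> heights k2 ?Z' ?F $ j" for j
    using strictly_above_mono(1)[OF Q(1,2) fj'] by (simp add: heights_config config_nth)
  have "l' \<bullet> ?Z' $ k2 \<le> l' \<bullet> heights k2 ?Z' ?F"
    unfolding inner_vec_def using le' l'(1) by (intro sum_mono) (auto intro!: mult_left_mono less_imp_le)
  then have "l \<bullet> heights k2 ?Z ?F' \<le> l \<bullet> heights k2 ?Z ?F"
    unfolding h'[symmetric] 1 2 x .
  then have "(\<Sum>j\<in>UNIV. l $ j * (heights k2 ?Z ?F' $ j - ?Z $ k2 $ j)) \<le> 0"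
    by (simp add: h inner_vec_def right_diff_distrib sum_subtractf)
  moreover have nn: "0 \<le> l $ j * (heights k2 ?Z ?F' $ j - ?Z $ k2 $ j)" for j
    using l(1)[of j] le[of j] by simp
  ultimately have "(\<Sum>j\<in>UNIV. l $ j * (heights k2 ?Z ?F' $ j - ?Z $ k2 $ j)) = 0"
    by (intro antisym sum_nonneg) auto
  then have "l $ j * (heights k2 ?Z ?F' $ j - ?Z $ k2 $ j) = 0" for j
    using nn by (simp add: sum_nonneg_eq_0_iff)
  then have "?Z $ k2 $ j = heights k2 ?Z ?F' $ j" for j
    using l(1)[of j] by (metis eq_iff_diff_eq_0 mult_eq_0_iff less_irrefl)
  then have "f j \<in> range f'" for j
    using strictly_above_mono(2)[OF Q'(1,2) fj] by (simp add: heights_config config_nth)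
  then show ?thesis by auto
qed

lemma sum_chord_le:
  fixes u :: "'d \<Rightarrow> real ^ 'd" and f :: "nat set \<Rightarrow> 'd \<Rightarrow> nat"
  assumes k: "k1 \<noteq> k2" and \<epsilon>: "0 < \<epsilon>" and fin: "finite \<I>"
    and f: "\<And>I. I \<in> \<I> \<Longrightarrow> bij_betw (f I) UNIV I" "\<And>I. I \<in> \<I> \<Longrightarrow> I \<subseteq> {1..n}"
    and ev: "\<And>I. I \<in> \<I> \<Longrightarrow> robust_facet_event u k1 k2 \<epsilon> n (f I) a"
  shows "(\<Sum>I\<in>\<I>. chord k1 k2 \<epsilon> (config u (f I) a)) \<le> 2 * (\<Sum>i\<in>{1..n}. \<bar>u k1 \<bullet> a i\<bar>)"
proof -
  let ?Z = "\<lambda>I. config u (f I) a" and ?X = "\<Sum>i\<in>{1..n}. \<bar>u k1 \<bullet> a i\<bar>"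
  let ?c = "\<lambda>I. chord k1 k2 \<epsilon> (?Z I)"
  have rf: "range (f I) = I" if "I \<in> \<I>" for I using f(1)[OF that] by (simp add: bij_betw_def)
  define W where "W I x l \<longleftrightarrow> (\<forall>j. 0 < l $ j) \<and> (\<Sum>j\<in>UNIV. l $ j) = 1 \<and>
      (\<forall>c. c \<noteq> k1 \<longrightarrow> c \<noteq> k2 \<longrightarrow> l \<bullet> ?Z I $ c = 0) \<and> l \<bullet> ?Z I $ k1 = x" for I x and l :: "real ^ 'd"
  have "\<exists>m. \<forall>x. \<bar>x - m\<bar> < ?c I / 2 \<longrightarrow> (\<exists>l. W I x l)" if "I \<in> \<I>" for I
    using chord_weights[OF k \<epsilon>, of "?Z I"] ev[OF that] unfolding W_def robust_facet_event_def by blast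
  then obtain m where m: "\<And>I x. I \<in> \<I> \<Longrightarrow> \<bar>x - m I\<bar> < ?c I / 2 \<Longrightarrow> \<exists>l. W I x l"
    by metis
  \<comment> \<open>Open intervals: strictly within half a chord of the centre the weights stay
    positive, as the comparison of two facets requires.\<close>
  define C where "C I = {m I - ?c I / 2 <..< m I + ?c I / 2}" for I
  have CW: "\<exists>l. W I x l" if "I \<in> \<I>" "x \<in> C I" for I x
  proof (rule m[OF that(1)])
    show "\<bar>x - m I\<bar> < ?c I / 2" unfolding abs_less_iff using that(2) by (auto simp: C_def)
  qed
  have sub: "I \<subseteq> J" if IJ: "I \<in> \<I>" "J \<in> \<I>" and x: "x \<in> C I" "x \<in> C J" for I J x
  proof -
    obtain l l' where w: "W I x l" "W J x l'" using CW[OF IJ(1) x(1)] CW[OF IJ(2) x(2)] by blast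
    have "range (f I) \<subseteq> range (f J)"
      by (rule robust_facet_subset[where a=a and u=u and n=n and l=l and l'=l', OF k])
        (use w ev[OF IJ(1)] ev[OF IJ(2)] f(2)[OF IJ(1)] f(2)[OF IJ(2)] rf[OF IJ(1)] rf[OF IJ(2)]
          in \<open>auto simp: W_def robust_facet_event_def\<close>)
    then show ?thesis using rf IJ by simp
  qed
  then have dis: "disjoint_family_on C \<I>"
    unfolding disjoint_family_on_def by (metis disjoint_iff subset_antisym)
  \<comment> \<open>The sum of all |\<open>u k1 \<bullet> a i\<close>| is a crude bound for a point
    of a chord but, unlike the maximum, its expectation can be taken point by point.\<close>
  have bd: "C I \<subseteq> {- ?X .. ?X}" if I: "I \<in> \<I>" for I
  proof
    fix x assume "x \<in> C I"
    then obtain l where w: "W I x l" using CW[OF I] by auto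
    have l1: "l $ j \<le> 1" for j
      using member_le_sum[of j UNIV "\<lambda>j. l $ j"] w by (auto simp: W_def intro: less_imp_le)
    have "\<bar>x\<bar> = \<bar>\<Sum>j\<in>UNIV. l $ j * (u k1 \<bullet> a (f I j))\<bar>" using w by (auto simp: W_def inner_vec_def config_nth)
    also have "\<dots> \<le> (\<Sum>j\<in>UNIV. \<bar>l $ j * (u k1 \<bullet> a (f I j))\<bar>)" by (rule sum_abs)
    also have "\<dots> \<le> (\<Sum>j\<in>UNIV. \<bar>u k1 \<bullet> a (f I j)\<bar>)"
    proof (rule sum_mono)
      fix j
      have "0 < l $ j" using w by (auto simp: W_def)
      then show "\<bar>l $ j * (u k1 \<bullet> a (f I j))\<bar> \<le> \<bar>u k1 \<bullet> a (f I j)\<bar>"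
        using l1[of j] mult_right_mono[of "l $ j" 1 "\<bar>u k1 \<bullet> a (f I j)\<bar>"] by (simp add: abs_mult)
    qed
    also have "\<dots> = (\<Sum>i\<in>I. \<bar>u k1 \<bullet> a i\<bar>)" by (rule sum.reindex_bij_betw[OF f(1)[OF I]])
    also have "\<dots> \<le> ?X" using f(2)[OF I] by (intro sum_mono2) auto
    finally show "x \<in> {- ?X .. ?X}" by auto
  qed
  have c0: "0 \<le> ?c I" for I using \<epsilon> by (simp add: chord_def)
  have X0: "0 \<le> ?X" by (intro sum_nonneg) auto
  have "ennreal (\<Sum>I\<in>\<I>. ?c I) = (\<Sum>I\<in>\<I>. emeasure lborel (C I))"
    using c0 by (simp add: C_def)
  also have "\<dots> = emeasure lborel (\<Union>I\<in>\<I>. C I)"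
    by (rule sum_emeasure[OF _ dis fin]) (auto simp: C_def)
  also have "\<dots> \<le> emeasure lborel {- ?X .. ?X}" using bd by (intro emeasure_mono) auto
  also have "\<dots> = ennreal (2 * ?X)" using X0 by simp
  finally show ?thesis using X0 by simp
qed

section \<open>From supporting functionals to facet events\<close>

lemma lin_indep_family_kernel:
  fixes a :: "nat \<Rightarrow> real ^ 'd"
  assumes "lin_indep_family a I" "bij_betw f (UNIV :: 'd set) I" "(\<Sum>j\<in>UNIV. w j *\<^sub>R a (f j)) = 0"
  shows "w j = 0"
proof -
  have inj: "inj (\<lambda>j. a (f j))"
    using assms(1,2) by (auto simp: lin_indep_family_def bij_betw_def inj_on_def)
  have r: "range (\<lambda>j. a (f j)) = a ` I"
    using assms(2) by (auto simp: bij_betw_def)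
  define v where "v x = w (inv (\<lambda>j. a (f j)) x)" for x
  have "(\<Sum>x\<in>range (\<lambda>j. a (f j)). v x *\<^sub>R x) = 0"
    using assms(3) by (subst sum.reindex[OF inj]) (simp add: v_def inv_f_f[OF inj] comp_def)
  then have "v (a (f j)) = 0"
    using assms(1) unfolding r lin_indep_family_def
    by (intro independentD[of "a ` I" "a ` I" v]) (use assms(2) bij_betw_finite[OF assms(2)] in \<open>auto simp: bij_betw_def\<close>)
  then show ?thesis by (simp add: v_def inv_f_f[OF inj])
qed

lemma frame_inner:
  assumes "orthonormal_frame (u :: 'd \<Rightarrow> real ^ 'd)"
  shows "(\<Sum>c\<in>UNIV. (u c \<bullet> x) * (u c \<bullet> y)) = x \<bullet> y"
proof -
  have "orthogonal_transformation ((*v) (\<chi> c. u c))"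
    using orthonormal_frame_matrix[OF assms] by (simp add: orthogonal_transformation_matrix)
  then have "((\<chi> c. u c) *v x) \<bullet> ((\<chi> c. u c) *v y) = x \<bullet> y" by (simp add: orthogonal_transformation_def)
  then show ?thesis by (simp add: frame_mult inner_vec_def[of "\<chi> c. u c \<bullet> x"])
qed

lemma frame_eq_zero:
  assumes "orthonormal_frame (u :: 'd \<Rightarrow> real ^ 'd)" "\<And>c. u c \<bullet> x = 0"
  shows "x = 0"
  using frame_inner[OF assms(1), of x x] assms(2) by simp

text \<open>Solve the equation \<theta> \<bullet> x = 1 for the coordinate along \<open>k2\<close>,
  whose coefficient is positive. Points with \<theta> \<bullet> x \<le> 1 lie below the resulting
  graph, and its slope along \<open>k1\<close> is minus the quotient of the two components of
  \<theta>.\<close>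

lemma facet_event_supporting:
  fixes u :: "'d \<Rightarrow> real ^ 'd"
  assumes u: "orthonormal_frame u" and k: "k1 \<noteq> k2" and f: "bij_betw f UNIV I" and li: "lin_indep_family a I"
    and \<theta>: "\<And>j. \<theta> \<bullet> a (f j) = 1" "\<And>i. i \<in> {1..n} \<Longrightarrow> \<theta> \<bullet> a i \<le> 1"
    and l: "\<And>j. 0 \<le> l j" "(\<Sum>j\<in>UNIV. l j) = 1" "\<And>c. c \<noteq> k1 \<Longrightarrow> c \<noteq> k2 \<Longrightarrow> u c \<bullet> (\<Sum>j\<in>UNIV. l j *\<^sub>R a (f j)) = 0"
    and pos: "0 < u k2 \<bullet> \<theta>" "\<bar>u k1 \<bullet> \<theta>\<bar> \<le> u k2 \<bullet> \<theta>"
  shows "facet_event u k1 k2 n f a"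
proof -
  let ?Z = "config u f a" and ?t = "u k2 \<bullet> \<theta>"
  define F :: "real ^ 'd" where "F = (\<chi> c. if c = k2 then 1 / ?t else - (u c \<bullet> \<theta>) / ?t)"
  have lift: "lift_base u k2 x \<bullet> F = u k2 \<bullet> x + (1 - \<theta> \<bullet> x) / ?t" for x
  proof -
    have "\<theta> \<bullet> x = ?t * (u k2 \<bullet> x) + (\<Sum>c\<in>UNIV - {k2}. (u c \<bullet> \<theta>) * (u c \<bullet> x))"
      using frame_inner[OF u, of \<theta> x] by (subst (asm) sum.remove[of _ k2]) auto
    moreover have "lift_base u k2 x \<bullet> F = 1 / ?t + (\<Sum>c\<in>UNIV - {k2}. - ((u c \<bullet> \<theta>) * (u c \<bullet> x)) / ?t)"
      unfolding inner_vec_def[of "lift_base u k2 x"]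
      by (subst sum.remove[of _ k2]) (auto simp: lift_base_def F_def mult.commute intro!: sum.cong)
    ultimately show ?thesis using pos by (simp add: sum_divide_distrib[symmetric] sum_negf field_simps)
  qed
  have h: "heights k2 ?Z F = ?Z $ k2"
    by (simp add: vec_eq_iff heights_config lift \<theta>(1) config_nth)
  \<comment> \<open>A kernel vector would be orthogonal to the all-ones row and the horizontal rows,
    hence also to the row of heights, which is a combination of these. It would be a linear
    dependency among the vertices.\<close>
  have D: "base_det k2 ?Z \<noteq> 0"
  proof
    assume "base_det k2 ?Z = 0"
    then have "\<not> invertible (row_update ?Z k2 1)" by (simp add: base_det_def invertible_det_nz)
    then obtain w where w: "w \<noteq> 0" "row_update ?Z k2 1 *v w = 0"
      unfolding invertible_left_inverse matrix_left_invertible_ker by blast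
    have row: "row_update ?Z k2 1 $ c \<bullet> w = 0" for c
      using w(2) by (simp add: vec_eq_iff matrix_vector_mult_def inner_vec_def)
    have r1: "1 \<bullet> w = 0" using row[of k2] by simp
    have r2: "?Z $ c \<bullet> w = 0" if "c \<noteq> k2" for c using row[of c] that by simp
    have "heights k2 ?Z F \<bullet> w = 0"
      by (simp add: heights_sum inner_add_left inner_sum_left r1 r2)
    then have r3: "?Z $ c \<bullet> w = 0" for c using h r2 by (cases "c = k2") auto
    have "u c \<bullet> (\<Sum>j\<in>UNIV. w $ j *\<^sub>R a (f j)) = 0" for c
      using r3[of c] by (simp add: inner_sum_right inner_vec_def[of "?Z $ c"] config_nth mult.commute)
    then have "(\<Sum>j\<in>UNIV. w $ j *\<^sub>R a (f j)) = 0" by (rule frame_eq_zero[OF u])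
    then have "w $ j = 0" for j by (rule lin_indep_family_kernel[OF li f])
    then show False using w(1) by (simp add: vec_eq_iff)
  qed
  have F: "hyperplane_coeffs k2 ?Z = F" using heights_eq_iff[OF D, of F] h by simp
  have "\<bar>F $ k1\<bar> \<le> 1" using k pos by (simp add: F_def abs_divide)
  moreover have "u k2 \<bullet> a i \<le> lift_base u k2 (a i) \<bullet> F" if "i \<in> {1..n}" for i
    using \<theta>(2)[OF that] pos by (simp add: lift)
  moreover have "balanced k1 k2 0 ?Z"
    unfolding balanced_def
  proof (intro exI[of _ "\<chi> j. l j"] conjI allI impI)
    show "(\<chi> j. l j) \<bullet> ?Z $ c = 0" if "c \<noteq> k1" "c \<noteq> k2" for c
      using l(3)[OF that] by (simp add: inner_sum_right inner_vec_def[of "\<chi> j. l j"] config_nth)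
  qed (simp_all add: l)
  ultimately show ?thesis using D F by (simp add: facet_event_def weakly_above_def)
qed

section \<open>Measurability of the shadow\<close>

abbreviation point_matrix :: "('d \<Rightarrow> nat) \<Rightarrow> (nat \<Rightarrow> real ^ 'd) \<Rightarrow> real ^ 'd ^ 'd" where
  "point_matrix f a \<equiv> config (\<lambda>c. axis c 1) f a"

definition replace_column :: "real ^ 'd ^ 'd \<Rightarrow> 'd \<Rightarrow> real ^ 'd \<Rightarrow> real ^ 'd ^ 'd" where
  "replace_column A j x = (\<chi> i k. if k = j then x $ i else A $ i $ k)"

definition coords :: "real ^ 'd ^ 'd \<Rightarrow> real ^ 'd \<Rightarrow> real ^ 'd" where
  "coords A x = (\<chi> j. det (replace_column A j x) / det A)"

lemma coords_iff: "det A \<noteq> 0 \<Longrightarrow> A *v y = x \<longleftrightarrow> y = coords A x"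
  using cramer[of A y x] by (simp add: coords_def replace_column_def)

lemma point_matrix_mult: "point_matrix f a *v w = (\<Sum>j\<in>UNIV. w $ j *\<^sub>R a (f j))"
  by (simp add: vec_eq_iff matrix_vector_mult_def config_nth inner_axis' mult.commute)

lemma point_matrix_axis: "point_matrix f a *v axis j 1 = a (f j)"
  unfolding point_matrix_mult by (simp add: axis_def if_distrib[of "\<lambda>x. x *\<^sub>R _"] cong: if_cong)

lemma lin_indep_iff_det:
  fixes a :: "nat \<Rightarrow> real ^ 'd"
  assumes f: "bij_betw f (UNIV :: 'd set) I"
  shows "lin_indep_family a I \<longleftrightarrow> det (point_matrix f a) \<noteq> 0"
proof
  assume li: "lin_indep_family a I"
  have "w = 0" if "point_matrix f a *v w = 0" for w
    using lin_indep_family_kernel[OF li f, of "\<lambda>j. w $ j"] that by (simp add: point_matrix_mult vec_eq_iff)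
  then show "det (point_matrix f a) \<noteq> 0"
    unfolding invertible_det_nz[symmetric] invertible_left_inverse matrix_left_invertible_ker by blast
next
  assume d: "det (point_matrix f a) \<noteq> 0"
  have ker: "w = 0" if "point_matrix f a *v w = 0" for w
    using d that unfolding invertible_det_nz[symmetric] invertible_left_inverse matrix_left_invertible_ker by blast
  have If: "I = range f" using f by (simp add: bij_betw_def)
  have inj: "inj (\<lambda>j. a (f j))"
  proof (rule injI)
    fix i j assume "a (f i) = a (f j)"
    then have "point_matrix f a *v (axis i 1 - axis j 1) = 0" by (simp add: matrix_vector_mult_diff_distrib point_matrix_axis)
    then have "axis i (1::real) = axis j 1" using ker by fastforce
    then show "i = j" by (simp add: axis_eq_axis)
  qed
  have "inj_on a I" unfolding If using inj by (auto simp: inj_on_def)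
  moreover have "independent (a ` I)"
  proof
    assume "dependent (a ` I)"
    moreover have "finite (a ` I)" using If by simp
    ultimately obtain v where v: "\<exists>x\<in>a ` I. v x \<noteq> 0" "(\<Sum>x\<in>a ` I. v x *\<^sub>R x) = 0"
      using dependent_finite[of "a ` I"] by blast
    have r: "a ` I = range (\<lambda>j. a (f j))" using If by auto
    have "(\<Sum>j\<in>UNIV. v (a (f j)) *\<^sub>R a (f j)) = (\<Sum>x\<in>a ` I. v x *\<^sub>R x)"
      unfolding r by (rule sum.reindex_cong[OF inj, symmetric]) auto
    then have "(\<Sum>j\<in>UNIV. v (a (f j)) *\<^sub>R a (f j)) = 0" by (simp only: v(2))
    then have "point_matrix f a *v (\<chi> j. v (a (f j))) = 0" by (simp add: point_matrix_mult)
    then have "(\<chi> j. v (a (f j))) = 0" by (rule ker)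
    then have "v (a (f j)) = 0" for j by (simp add: vec_eq_iff)
    then show False using v(1) If by auto
  qed
  ultimately show "lin_indep_family a I" by (simp add: lin_indep_family_def)
qed

lemma cone_of_eq:
  fixes a :: "nat \<Rightarrow> real ^ 'd"
  assumes f: "bij_betw f (UNIV :: 'd set) I"
  shows "cone_of a I = (\<lambda>w. point_matrix f a *v w) ` {w. \<forall>j. 0 \<le> w $ j}"
proof (intro set_eqI iffI)
  fix x assume "x \<in> cone_of a I"
  then obtain l where l: "x = (\<Sum>i\<in>I. l i *\<^sub>R a i)" "\<forall>i\<in>I. 0 \<le> l i" by (auto simp: cone_of_def)
  have "x = point_matrix f a *v (\<chi> j. l (f j))"
    unfolding l(1) point_matrix_mult by (subst sum.reindex_bij_betw[OF f, symmetric]) simp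
  then show "x \<in> (\<lambda>w. point_matrix f a *v w) ` {w. \<forall>j. 0 \<le> w $ j}"
    using l(2) f by (intro image_eqI[of _ _ "\<chi> j. l (f j)"]) (auto simp: bij_betw_def)
next
  fix x assume "x \<in> (\<lambda>w. point_matrix f a *v w) ` {w. \<forall>j. 0 \<le> w $ j}"
  then obtain w where w: "x = point_matrix f a *v w" "\<And>j. 0 \<le> w $ j" by auto
  define l where "l i = w $ inv_into UNIV f i" for i
  have lf: "l (f j) = w $ j" for j using f by (simp add: l_def bij_betw_def)
  have "x = (\<Sum>i\<in>I. l i *\<^sub>R a i)"
    unfolding w(1) point_matrix_mult by (subst sum.reindex_bij_betw[OF f, symmetric]) (simp add: lf)
  moreover have "\<forall>i\<in>I. 0 \<le> l i" by (simp add: l_def w(2))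
  ultimately show "x \<in> cone_of a I" unfolding cone_of_def by blast
qed

lemma convex_hull_eq_simplex:
  fixes a :: "nat \<Rightarrow> real ^ 'd"
  assumes f: "bij_betw f (UNIV :: 'd set) I"
  shows "convex hull (a ` I) = (\<lambda>w. point_matrix f a *v w) ` {w. (\<forall>j. 0 \<le> w $ j) \<and> (\<Sum>j\<in>UNIV. w $ j) = 1}"
    (is "_ = ?S")
proof
  have If: "I = range f" using f by (simp add: bij_betw_def)
  show "convex hull (a ` I) \<subseteq> ?S"
  proof (rule hull_minimal)
    show "a ` I \<subseteq> ?S"
    proof
      fix x assume "x \<in> a ` I"
      then obtain j where x: "x = a (f j)" using If by auto
      show "x \<in> ?S"
        unfolding x
      proof (rule image_eqI[where x="axis j 1"])
        show "a (f j) = point_matrix f a *v axis j 1" by (rule point_matrix_axis[symmetric])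
      qed (simp add: axis_def)
    qed
    have "convex {w :: real ^ 'd. (\<forall>j. 0 \<le> w $ j) \<and> (\<Sum>j\<in>UNIV. w $ j) = 1}"
      by (rule convexI) (auto simp: sum.distrib sum_distrib_left[symmetric])
    then show "convex ?S" by (intro convex_linear_image) auto
  qed
  show "?S \<subseteq> convex hull (a ` I)"
  proof
    fix x assume "x \<in> ?S"
    then obtain w where w: "x = (\<Sum>j\<in>UNIV. w $ j *\<^sub>R a (f j))" "\<And>j. 0 \<le> w $ j" "(\<Sum>j\<in>UNIV. w $ j) = 1"
      by (auto simp: point_matrix_mult)
    show "x \<in> convex hull (a ` I)"
      unfolding w(1) by (rule convex_sum) (use w If in \<open>auto intro: hull_inc\<close>)
  qed
qed

text \<open>The vertices form a basis, so there is a functional with value 1 on each; its level set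
  1 is the hyperplane of the candidate facet.\<close>

lemma ex_normal:
  fixes a :: "nat \<Rightarrow> real ^ 'd"
  assumes d: "det (point_matrix f a) \<noteq> 0"
  shows "\<exists>\<theta>. \<forall>w. \<theta> \<bullet> (point_matrix f a *v w) = (\<Sum>j\<in>UNIV. w $ j)"
proof -
  let ?\<theta> = "coords (transpose (point_matrix f a)) 1"
  have "transpose (point_matrix f a) *v ?\<theta> = 1"
    using coords_iff[of "transpose (point_matrix f a)" ?\<theta> 1] d by (simp add: det_transpose)
  then have "?\<theta> \<bullet> (point_matrix f a *v w) = 1 \<bullet> w" for w
    by (metis dot_lmul_matrix transpose_matrix_vector)
  then show ?thesis by (auto simp: inner_vec_def)
qed

text \<open>Further points may lie in the simplex itself, whence the second alternative. A facet of
  a polytope is exposed, and the exposing functional, which has a positive value on the facet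
  because 0 lies in the hull but not in the simplex, is proportional to \<theta> since the vertices
  are a basis. Conversely the simplex is the contact set of \<theta> and has the right dimension: 0
  and the vertices make the hull full-dimensional.\<close>

lemma facet_iff:
  fixes a :: "nat \<Rightarrow> real ^ 'd"
  assumes f: "bij_betw f (UNIV :: 'd set) I" and I: "I \<subseteq> {1..n}" and li: "lin_indep_family a I"
    and \<theta>: "\<And>w. \<theta> \<bullet> (point_matrix f a *v w) = (\<Sum>j\<in>UNIV. w $ j)"
  shows "(convex hull (a ` I)) facet_of (convex hull (insert 0 (a ` {1..n}))) \<longleftrightarrow>
    (\<forall>i\<in>{1..n}. \<theta> \<bullet> a i < 1 \<or> a i \<in> convex hull (a ` I))" (is "?T facet_of ?S \<longleftrightarrow> _")
proof -
  have If: "I = range f" using f by (simp add: bij_betw_def)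
  have d: "det (point_matrix f a) \<noteq> 0" using li lin_indep_iff_det[OF f] by simp
  have T1: "\<theta> \<bullet> x = 1" if "x \<in> ?T" for x
    using that unfolding convex_hull_eq_simplex[OF f] by (auto simp: \<theta>)
  have TS: "?T \<subseteq> ?S" using I by (intro hull_mono) auto
  show ?thesis
  proof
    assume "?T facet_of ?S"
    then have "?T face_of ?S" by (rule facet_of_imp_face_of)
    moreover have "polyhedron ?S" by (intro polytope_imp_polyhedron polytope_convex_hull) auto
    ultimately have "?T exposed_face_of ?S" by (simp add: exposed_face_of_polyhedron)
    then obtain \<alpha> \<beta> where \<alpha>: "?S \<subseteq> {x. \<alpha> \<bullet> x \<le> \<beta>}" "?T = ?S \<inter> {x. \<alpha> \<bullet> x = \<beta>}"
      unfolding exposed_face_of_def by blast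
    have zS: "0 \<in> ?S" by (intro hull_inc) simp
    have zT: "0 \<notin> ?T" using T1 by force
    have \<beta>: "0 < \<beta>" using zS zT \<alpha> by (auto simp: less_le)
    have "\<alpha> = \<beta> *\<^sub>R \<theta>"
    proof -
      have "(\<alpha> - \<beta> *\<^sub>R \<theta>) \<bullet> x = 0" for x
      proof -
        define w where "w = coords (point_matrix f a) x"
        have x: "x = point_matrix f a *v w" using coords_iff[OF d, of w x] by (simp add: w_def)
        have "\<alpha> \<bullet> a (f j) = \<beta>" for j
        proof -
          have "a (f j) \<in> ?T" using If by (intro hull_inc) auto
          then show ?thesis using \<alpha>(2) by auto
        qed
        then have "\<alpha> \<bullet> x = (\<Sum>j\<in>UNIV. w $ j * \<beta>)"
          unfolding x point_matrix_mult by (simp add: inner_sum_right)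
        also have "\<dots> = \<beta> * (\<theta> \<bullet> x)" unfolding x \<theta> by (simp add: sum_distrib_left mult.commute)
        finally show ?thesis by (simp add: inner_diff_left)
      qed
      from this[of "\<alpha> - \<beta> *\<^sub>R \<theta>"] show ?thesis by simp
    qed
    show "\<forall>i\<in>{1..n}. \<theta> \<bullet> a i < 1 \<or> a i \<in> ?T"
    proof
      fix i assume "i \<in> {1..n}"
      then have "a i \<in> ?S" by (intro hull_inc) auto
      then have "\<beta> * (\<theta> \<bullet> a i) \<le> \<beta> * 1" "\<theta> \<bullet> a i = 1 \<longrightarrow> a i \<in> ?T"
        using \<alpha> \<open>\<alpha> = \<beta> *\<^sub>R \<theta>\<close> by auto
      then show "\<theta> \<bullet> a i < 1 \<or> a i \<in> ?T" using \<beta> by (auto simp: less_le)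
    qed
  next
    assume H: "\<forall>i\<in>{1..n}. \<theta> \<bullet> a i < 1 \<or> a i \<in> ?T"
    \<comment> \<open>An open half-space together with the simplex on its boundary. It is convex
      because a proper mixture with one point in the open half-space stays there, so it contains the
      whole hull.\<close>
    let ?C = "{x. \<theta> \<bullet> x < 1} \<union> ?T"
    have le: "\<theta> \<bullet> x \<le> 1" if "x \<in> ?C" for x using that T1 by force
    have "convex ?C"
    proof (rule convexI)
      fix x y and p q :: real assume x: "x \<in> ?C" and y: "y \<in> ?C" and pq: "0 \<le> p" "0 \<le> q" "p + q = 1"
      show "p *\<^sub>R x + q *\<^sub>R y \<in> ?C"
      proof (cases "p = 0 \<or> q = 0 \<or> (x \<in> ?T \<and> y \<in> ?T)")
        case True
        then show ?thesis using x y pq convexD[OF convex_convex_hull, of x "a ` I" y p q] by auto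
      next
        case False
        then have p: "0 < p" "0 < q" using pq by auto
        have "p * (\<theta> \<bullet> x) + q * (\<theta> \<bullet> y) < p * 1 + q * 1"
        proof (cases "x \<in> ?T")
          case True
          then have "\<theta> \<bullet> y < 1" using False y by auto
          then show ?thesis using p le[OF x] by (intro add_le_less_mono mult_left_mono mult_strict_left_mono) auto
        next
          case False
          then have "\<theta> \<bullet> x < 1" using x by auto
          then show ?thesis using p le[OF y] by (intro add_less_le_mono mult_left_mono mult_strict_left_mono) auto
        qed
        then show ?thesis using pq(3) by (simp add: inner_add_right)
      qed
    qed
    then have SC: "?S \<subseteq> ?C" using H by (intro hull_minimal) auto
    have "?T = ?S \<inter> {x. \<theta> \<bullet> x = 1}" using SC TS T1 by fastforce
    then have face: "?T face_of ?S"
      using face_of_Int_supporting_hyperplane_le[of ?S \<theta> 1] SC le by auto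
    have card: "card (a ` I) = CARD('d)" "finite (a ` I)"
      using li f bij_betw_same_card[OF f] If by (auto simp: lin_indep_family_def card_image)
    have ind: "independent (a ` I)" using li by (simp add: lin_indep_family_def)
    have "\<not> affine_dependent (a ` I)" using ind affine_dependent_imp_dependent by blast
    then have "aff_dim ?T = int CARD('d) - 1"
      using card aff_dim_affine_independent[of "a ` I"] by (simp add: aff_dim_convex_hull)
    moreover have "aff_dim ?S = int CARD('d)"
    proof (rule antisym)
      show "aff_dim ?S \<le> int CARD('d)" using aff_dim_le_DIM[of ?S] by simp
      have "dim (a ` I) = CARD('d)" using ind card dim_eq_card_independent by metis
      moreover have "dim (a ` I) \<le> dim ?S"
        by (rule dim_subset) (use I hull_subset[of "insert 0 (a ` {1..n})" convex] in auto)
      moreover have "aff_dim ?S = int (dim ?S)"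
        by (intro aff_dim_zero hull_inc) auto
      ultimately show "int CARD('d) \<le> aff_dim ?S" by simp
    qed
    moreover have "?T \<noteq> {}" using If by auto
    ultimately show "?T facet_of ?S" using face by (simp add: facet_of_def)
  qed
qed

text \<open>Membership in a form whose measurability can be read off. Nonnegativity of a coordinate
  of \<open>q\<close> is stated with a product of determinants rather than the quotient from
  Cramer's rule: the product is continuous on all matrices, including singular ones, so the cone
  condition is closed.\<close>

lemma Shadow_iff:
  fixes a :: "nat \<Rightarrow> real ^ 'd"
  assumes f: "bij_betw f (UNIV :: 'd set) I" and I: "I \<subseteq> {1..n}"
  shows "I \<in> Shadow t z n a \<longleftrightarrow> det (point_matrix f a) \<noteq> 0 \<and>
    (\<forall>i\<in>{1..n}. (\<Sum>j\<in>UNIV. coords (point_matrix f a) (a i) $ j) < 1 \<or>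
       ((\<forall>j. 0 \<le> coords (point_matrix f a) (a i) $ j) \<and> (\<Sum>j\<in>UNIV. coords (point_matrix f a) (a i) $ j) = 1)) \<and>
    (\<exists>q\<in>{q \<in> span {t, z}. norm q = 1}. \<forall>j. 0 \<le> det (replace_column (point_matrix f a) j q) * det (point_matrix f a))"
proof (cases "lin_indep_family a I")
  case True
  let ?A = "point_matrix f a"
  have d: "det ?A \<noteq> 0" using True lin_indep_iff_det[OF f] by simp
  obtain \<theta> where \<theta>: "\<And>w. \<theta> \<bullet> (?A *v w) = (\<Sum>j\<in>UNIV. w $ j)" using ex_normal[OF d] by auto
  have Ac: "?A *v coords ?A x = x" for x using coords_iff[OF d] by blast
  have cu: "coords ?A (?A *v w) = w" for w using coords_iff[OF d] by metis
  have \<theta>c: "\<theta> \<bullet> x = (\<Sum>j\<in>UNIV. coords ?A x $ j)" for x using \<theta>[of "coords ?A x"] by (simp add: Ac)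
  have hull: "x \<in> convex hull (a ` I) \<longleftrightarrow> (\<forall>j. 0 \<le> coords ?A x $ j) \<and> (\<Sum>j\<in>UNIV. coords ?A x $ j) = 1" for x
    unfolding convex_hull_eq_simplex[OF f] using cu Ac by (auto intro: image_eqI[of _ _ "coords ?A x"])
  have cone: "x \<in> cone_of a I \<longleftrightarrow> (\<forall>j. 0 \<le> det (replace_column ?A j x) * det ?A)" for x
  proof -
    have "x \<in> cone_of a I \<longleftrightarrow> (\<forall>j. 0 \<le> coords ?A x $ j)"
      unfolding cone_of_eq[OF f] using cu Ac by (auto intro: image_eqI[of _ _ "coords ?A x"])
    also have "\<dots> \<longleftrightarrow> (\<forall>j. 0 \<le> det (replace_column ?A j x) * det ?A)"
      using d by (simp add: coords_def zero_le_divide_iff zero_le_mult_iff)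
    finally show ?thesis .
  qed
  have cone_scale: "s *\<^sub>R x \<in> cone_of a I" if xc: "x \<in> cone_of a I" and s0: "0 \<le> s" for x s
  proof -
    obtain w where "x = ?A *v w" "\<forall>j. 0 \<le> w $ j" using xc unfolding cone_of_eq[OF f] by blast
    then have "s *\<^sub>R x = ?A *v (s *\<^sub>R w)" "\<forall>j. 0 \<le> (s *\<^sub>R w) $ j"
      using s0 by (auto simp: matrix_vector_mult_scaleR)
    then show ?thesis unfolding cone_of_eq[OF f] by blast
  qed
  \<comment> \<open>The cone is invariant under positive scaling, so the nonzero directions can be
    replaced by a compact set, the unit vectors of the plane.\<close>
  have ex: "(\<exists>q\<in>span {t, z} - {0}. q \<in> cone_of a I) \<longleftrightarrow> (\<exists>q\<in>{q \<in> span {t, z}. norm q = 1}. q \<in> cone_of a I)"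
  proof
    assume "\<exists>q\<in>span {t, z} - {0}. q \<in> cone_of a I"
    then obtain q where "q \<in> span {t, z}" "q \<noteq> 0" "q \<in> cone_of a I" by auto
    then show "\<exists>q\<in>{q \<in> span {t, z}. norm q = 1}. q \<in> cone_of a I"
      using cone_scale[of q "1 / norm q"] by (intro bexI[of _ "(1 / norm q) *\<^sub>R q"]) (auto intro: span_scale)
  qed auto
  have cardI: "card I = CARD('d)" using bij_betw_same_card[OF f] by simp
  have iff: "I \<in> Shadow t z n a \<longleftrightarrow> (convex hull (a ` I)) facet_of (convex hull (insert 0 (a ` {1..n}))) \<and>
     (\<exists>q\<in>span {t, z} - {0}. q \<in> cone_of a I)"
    using I cardI True by (auto simp: Shadow_def optSimp_def)
  show ?thesis
    by (simp only: iff[unfolded ex] facet_iff[OF f I True \<theta>] hull cone \<theta>c d not_False_eq_True simp_thms)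
next
  case False
  then show ?thesis using lin_indep_iff_det[OF f, of a] by (auto simp: Shadow_def optSimp_def)
qed

lemma replace_column_measurable [measurable (raw)]:
  assumes "F \<in> borel_measurable M" "G \<in> borel_measurable M"
  shows "(\<lambda>x. replace_column (F x) j (G x)) \<in> borel_measurable M"
  unfolding replace_column_def using assms
  by (intro borel_measurable_vec_lambda borel_measurable_if_const borel_measurable_vec_nth_comp)

lemma coords_measurable [measurable (raw)]:
  assumes [measurable]: "F \<in> borel_measurable M" "G \<in> borel_measurable M"
  shows "(\<lambda>x. coords (F x) (G x)) \<in> borel_measurable M"
  unfolding coords_def by measurable

lemma continuous_on_det [continuous_intros]:
  fixes F :: "'a::topological_space \<Rightarrow> real ^ 'n ^ 'n"
  assumes "continuous_on S F"
  shows "continuous_on S (\<lambda>x. det (F x))"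
  unfolding det_def by (intro continuous_intros continuous_on_component assms)

lemma closed_cone_condition:
  fixes t z :: "real ^ 'd"
  shows "closed {A :: real ^ 'd ^ 'd. \<exists>q\<in>{q \<in> span {t, z}. norm q = 1}. \<forall>j. 0 \<le> det (replace_column A j q) * det A}"
proof -
  have "closed ({q. norm q = 1} \<inter> span {t, z})"
    by (intro closed_Int closed_subspace subspace_span closed_Collect_eq continuous_intros)
  moreover have "bounded {q :: real ^ 'd. norm q = 1}" by (auto simp: bounded_iff)
  ultimately have K: "compact {q \<in> span {t, z}. norm q = 1}"
  proof -
    assume c: "closed ({q. norm q = 1} \<inter> span {t, z})" and b: "bounded {q :: real ^ 'd. norm q = 1}"
    have "{q \<in> span {t, z}. norm q = 1} = {q. norm q = 1} \<inter> span {t, z}" by auto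
    then show ?thesis using c b by (auto simp: compact_eq_bounded_closed intro: bounded_subset)
  qed
  have c: "continuous_on UNIV (\<lambda>p :: (real ^ 'd ^ 'd) \<times> (real ^ 'd). replace_column (fst p) j (snd p))" for j
    unfolding replace_column_def
  proof (intro continuous_on_vec_lambda)
    show "continuous_on UNIV (\<lambda>p :: (real ^ 'd ^ 'd) \<times> (real ^ 'd). if k = j then snd p $ i else fst p $ i $ k)" for i k
      by (cases "k = j") (auto intro!: continuous_intros)
  qed
  have "closed {p :: (real ^ 'd ^ 'd) \<times> (real ^ 'd). \<forall>j. 0 \<le> det (replace_column (fst p) j (snd p)) * det (fst p)}"
    by (intro closed_Collect_all closed_Collect_le continuous_intros c)
  from closed_compact_ex[OF K this] show ?thesis by simp
qed

lemma pred_Shadow: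
  fixes t z :: "real ^ 'd"
  assumes f: "bij_betw f (UNIV :: 'd set) I" and I: "I \<subseteq> {1..n}"
  shows "Measurable.pred (Pi\<^sub>M {1..n} (\<lambda>_. lborel)) (\<lambda>a. I \<in> Shadow t z n a)"
proof -
  have "range f \<subseteq> {1..n}" using f I by (simp add: bij_betw_def)
  note [measurable] = config_measurable[OF this] borel_closed[OF closed_cone_condition[of t z]]
  have "Measurable.pred (Pi\<^sub>M {1..n} (\<lambda>_. lborel)) (\<lambda>a. \<forall>i\<in>{1..n}. (\<Sum>j\<in>UNIV. coords (point_matrix f a) (a i) $ j) < 1 \<or>
       ((\<forall>j. 0 \<le> coords (point_matrix f a) (a i) $ j) \<and> (\<Sum>j\<in>UNIV. coords (point_matrix f a) (a i) $ j) = 1))"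
  proof (rule pred_intros_finite)
    fix i assume "i \<in> {1..n}"
    note [measurable] = PiM_component_borel[OF this]
    show "Measurable.pred (Pi\<^sub>M {1..n} (\<lambda>_. lborel)) (\<lambda>a. (\<Sum>j\<in>UNIV. coords (point_matrix f a) (a i) $ j) < 1 \<or>
       ((\<forall>j. 0 \<le> coords (point_matrix f a) (a i) $ j) \<and> (\<Sum>j\<in>UNIV. coords (point_matrix f a) (a i) $ j) = 1))"
      by measurable
  qed simp
  moreover have "Measurable.pred (Pi\<^sub>M {1..n} (\<lambda>_. lborel)) (\<lambda>a. det (point_matrix f a) \<noteq> 0)" by measurable
  moreover have "Measurable.pred (Pi\<^sub>M {1..n} (\<lambda>_. lborel)) (\<lambda>a. \<exists>q\<in>{q \<in> span {t, z}. norm q = 1}.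
      \<forall>j. 0 \<le> det (replace_column (point_matrix f a) j q) * det (point_matrix f a))"
  proof -
    have "Measurable.pred (Pi\<^sub>M {1..n} (\<lambda>_. lborel)) (\<lambda>a. point_matrix f a \<in> {A :: real ^ 'd ^ 'd. \<exists>q\<in>{q \<in> span {t, z}. norm q = 1}.
      \<forall>j. 0 \<le> det (replace_column A j q) * det A})" by measurable
    then show ?thesis by simp
  qed
  ultimately show ?thesis unfolding Shadow_iff[OF f I] by (intro pred_conjI)
qed

section \<open>Frames adapted to the plane\<close>

lemma ex_orthonormal_frame:
  fixes t z :: "real ^ 'd"
  assumes "t \<noteq> z" "independent {t, z}"
  shows "\<exists>(u :: 'd \<Rightarrow> real ^ 'd) k1 k2. orthonormal_frame u \<and> k1 \<noteq> k2 \<and>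
    (\<forall>q\<in>span {t, z}. \<forall>c. c \<noteq> k1 \<longrightarrow> c \<noteq> k2 \<longrightarrow> u c \<bullet> q = 0)"
proof -
  obtain B where B: "pairwise orthogonal B" "\<And>x. x \<in> B \<Longrightarrow> norm x = 1" "card B = dim (span {t, z})" "span B = span {t, z}"
    by (rule orthonormal_basis_subspace[OF subspace_span[of "{t, z}"]]) blast
  have "dim (span {t, z}) = 2" using dim_span_eq_card_independent[OF assms(2)] assms(1) by simp
  then obtain b1 b2 where b: "B = {b1, b2}" "b1 \<noteq> b2" using B(3) by (metis card_2_iff)
  obtain U where U: "U \<inter> insert 0 B = {}" "pairwise orthogonal (B \<union> U)" "span (B \<union> U) = span (B \<union> UNIV)"
    using orthogonal_extension_strong[OF B(1)] by blast
  define N where "N = (\<lambda>x. (1 / norm x) *\<^sub>R x) ` U"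
  have U0: "norm x \<noteq> 0" if "x \<in> U" for x using U(1) that by auto
  have n1: "norm x = 1" if "x \<in> B \<union> N" for x
    using that B(2) U0 by (auto simp: N_def)
  have orthBN: "orthogonal x y" if "x \<in> B" "y \<in> N" for x y
  proof -
    obtain y' where y: "y' \<in> U" "y = (1 / norm y') *\<^sub>R y'" using \<open>y \<in> N\<close> by (auto simp: N_def)
    have "x \<noteq> y'" using U(1) \<open>x \<in> B\<close> y(1) by auto
    then have "orthogonal x y'" using U(2) \<open>x \<in> B\<close> y(1) by (simp add: pairwise_def)
    then show ?thesis by (simp add: y(2) orthogonal_def)
  qed
  have "pairwise orthogonal (B \<union> N)"
  proof -
    have "orthogonal x y" if "x \<in> N" "y \<in> N" "x \<noteq> y" for x y
    proof -
      obtain x' y' where "x' \<in> U" "x = (1 / norm x') *\<^sub>R x'" "y' \<in> U" "y = (1 / norm y') *\<^sub>R y'"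
        using \<open>x \<in> N\<close> \<open>y \<in> N\<close> by (auto simp: N_def)
      moreover from this have "x' \<noteq> y'" using \<open>x \<noteq> y\<close> by auto
      ultimately show ?thesis using U(2) by (auto simp: pairwise_def orthogonal_def)
    qed
    moreover have "orthogonal y x" if "x \<in> B" "y \<in> N" for x y
      using orthBN[OF that] by (simp add: orthogonal_commute)
    ultimately show ?thesis using B(1) orthBN by (auto simp: pairwise_def)
  qed
  then have orth: "orthogonal x y" if "x \<in> B \<union> N" "y \<in> B \<union> N" "x \<noteq> y" for x y
    using that by (simp add: pairwise_def)
  have ind: "independent (B \<union> N)"
    by (rule pairwise_orthogonal_independent[OF \<open>pairwise orthogonal (B \<union> N)\<close>]) (use n1 in force)
  have "B \<union> U \<subseteq> span (B \<union> N)"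
  proof
    fix x assume "x \<in> B \<union> U"
    then show "x \<in> span (B \<union> N)"
    proof
      assume x: "x \<in> U"
      then have "x = norm x *\<^sub>R ((1 / norm x) *\<^sub>R x)" using U0 by simp
      moreover have "(1 / norm x) *\<^sub>R x \<in> B \<union> N" using x by (auto simp: N_def)
      ultimately show ?thesis by (metis span_base span_scale)
    qed (auto intro: span_base)
  qed
  then have "span (B \<union> N) = UNIV"
    using U(3) by (metis Un_UNIV_right span_UNIV span_minimal subspace_span top.extremum_uniqueI)
  then have "card (B \<union> N) = CARD('d)" using dim_span_eq_card_independent[OF ind] by simp
  moreover have fin: "finite (B \<union> N)" using ind independent_imp_finite by blast
  ultimately obtain u where u: "bij_betw u (UNIV :: 'd set) (B \<union> N)"
    by (metis finite finite_same_card_bij)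
  then have inj: "inj u" and ran: "range u = B \<union> N" by (auto simp: bij_betw_def)
  obtain k1 k2 where k: "u k1 = b1" "u k2 = b2" using ran b(1) by (metis Un_iff insertI1 insertI2 rangeE)
  have "u c \<bullet> u c' = (if c = c' then 1 else 0)" for c c'
  proof (cases "c = c'")
    case True
    have "norm (u c) = 1" using n1 ran by blast
    then show ?thesis using True by (simp add: norm_eq_1)
  next
    case False
    then have "u c \<noteq> u c'" using inj by (auto dest: injD)
    then show ?thesis using orth[of "u c" "u c'"] ran False by (auto simp: orthogonal_def)
  qed
  moreover have "k1 \<noteq> k2" using k b(2) by auto
  moreover have "u c \<bullet> q = 0" if "q \<in> span {t, z}" "c \<noteq> k1" "c \<noteq> k2" for q c
  proof -
    have "u c \<notin> B" using k b(1) inj that(2,3) by (auto dest: injD)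
    then have "orthogonal (u c) y" if "y \<in> B" for y
      using ran that orthBN[OF that] by (metis Un_iff orthogonal_commute rangeI)
    then have "orthogonal (u c) q" using that(1) B(4) orthogonal_to_span by metis
    then show ?thesis by (simp add: orthogonal_def)
  qed
  ultimately show ?thesis unfolding orthonormal_frame_def by blast
qed

text \<open>The first component of \<open>v\<close> exchanges the two axes, the second orients the
  vertical one. The horizontal axis needs no orientation because the slope enters through its
  absolute value. The four values of \<open>v\<close> are the source of the factor 4 in the final
  estimate.\<close>

definition turned_frame :: "('d \<Rightarrow> real ^ 'd) \<Rightarrow> 'd \<Rightarrow> 'd \<Rightarrow> bool \<times> bool \<Rightarrow> 'd \<Rightarrow> real ^ 'd" where
  "turned_frame u k1 k2 v c =
     (if c = k1 then (if fst v then u k2 else u k1)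
      else if c = k2 then (if snd v then 1 else - 1) *\<^sub>R (if fst v then u k1 else u k2)
      else u c)"

lemma orthonormal_turned_frame:
  "orthonormal_frame u \<Longrightarrow> k1 \<noteq> k2 \<Longrightarrow> orthonormal_frame (turned_frame u k1 k2 v)"
  unfolding orthonormal_frame_def turned_frame_def by auto

text \<open>A facet met by the plane has a normal with nonzero projection to it; turning the frame by a
  multiple of a right angle makes the facet an upper one of slope at most 1.\<close>
lemma Shadow_imp_facet_event:
  fixes u :: "'d \<Rightarrow> real ^ 'd"
  assumes u: "orthonormal_frame u" and k: "k1 \<noteq> k2"
    and perp: "\<And>q c. q \<in> span {t, z} \<Longrightarrow> c \<noteq> k1 \<Longrightarrow> c \<noteq> k2 \<Longrightarrow> u c \<bullet> q = 0"
    and f: "bij_betw f UNIV I" and I: "I \<in> Shadow t z n a"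
  shows "\<exists>v. facet_event (turned_frame u k1 k2 v) k1 k2 n f a"
proof -
  obtain q where q: "q \<in> span {t, z}" "q \<noteq> 0" and o: "I \<in> optSimp q n a"
    using I by (auto simp: Shadow_def)
  have I: "I \<subseteq> {1..n}" and li: "lin_indep_family a I"
    and fc: "(convex hull (a ` I)) facet_of (convex hull (insert 0 (a ` {1..n})))" and qc: "q \<in> cone_of a I"
    using o by (auto simp: optSimp_def)
  have d: "det (point_matrix f a) \<noteq> 0" using li lin_indep_iff_det[OF f] by simp
  obtain \<theta> where \<theta>: "\<And>w. \<theta> \<bullet> (point_matrix f a *v w) = (\<Sum>j\<in>UNIV. w $ j)" using ex_normal[OF d] by auto
  have \<theta>f: "\<theta> \<bullet> a (f j) = 1" for j using \<theta>[of "axis j 1"] by (simp add: point_matrix_axis) (simp add: axis_def)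
  have \<theta>hull: "\<theta> \<bullet> x = 1" if "x \<in> convex hull (a ` I)" for x
    using that unfolding convex_hull_eq_simplex[OF f] by (auto simp: \<theta>)
  have \<theta>le: "\<theta> \<bullet> a i \<le> 1" if "i \<in> {1..n}" for i
    using fc that \<theta>hull[of "a i"] unfolding facet_iff[OF f I li \<theta>] by force
  obtain w where w: "q = point_matrix f a *v w" "\<And>j. 0 \<le> w $ j" using qc unfolding cone_of_eq[OF f] by auto
  define L where "L = (\<Sum>j\<in>UNIV. w $ j)"
  have "0 \<le> L" unfolding L_def using w(2) by (intro sum_nonneg) auto
  \<comment> \<open>Here the exclusion of \<open>q = 0\<close> from the shadow enters; it allows the
    weights to be rescaled to sum 1, which puts a multiple of \<open>q\<close> on the facet.\<close>
  moreover have "L \<noteq> 0"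
  proof
    assume "L = 0"
    then have "w = 0" using w(2) by (simp add: L_def sum_nonneg_eq_0_iff vec_eq_iff)
    then show False using w(1) q(2) by simp
  qed
  ultimately have L: "0 < L" by simp
  define l where "l j = w $ j / L" for j
  have lp: "(\<Sum>j\<in>UNIV. l j *\<^sub>R a (f j)) = (1 / L) *\<^sub>R q"
    by (simp add: w(1) point_matrix_mult l_def scaleR_sum_right)
  have l: "0 \<le> l j" "(\<Sum>j\<in>UNIV. l j) = 1" for j
    using w(2) L by (simp_all add: l_def sum_divide_distrib[symmetric] flip: L_def)
  \<comment> \<open>As \<open>q\<close> lies in the plane and its product with \<theta> is positive,
    \<theta> has a nonzero component along \<open>u k1\<close> or \<open>u k2\<close>. The larger
    one decides which axis becomes vertical.\<close>
  have "\<theta> \<bullet> q = (\<Sum>c\<in>UNIV. (u c \<bullet> \<theta>) * (u c \<bullet> q))" by (simp add: frame_inner[OF u])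
  also have "\<dots> = (\<Sum>c\<in>{k1, k2}. (u c \<bullet> \<theta>) * (u c \<bullet> q))"
    by (rule sum.mono_neutral_right) (use perp[OF q(1)] in auto)
  finally have "L = (u k1 \<bullet> \<theta>) * (u k1 \<bullet> q) + (u k2 \<bullet> \<theta>) * (u k2 \<bullet> q)"
    using k by (simp add: w(1) \<theta> L_def)
  then have nz: "u k1 \<bullet> \<theta> \<noteq> 0 \<or> u k2 \<bullet> \<theta> \<noteq> 0" using L by auto
  define v where "v = (if \<bar>u k1 \<bullet> \<theta>\<bar> \<le> \<bar>u k2 \<bullet> \<theta>\<bar> then (False, 0 < u k2 \<bullet> \<theta>) else (True, 0 < u k1 \<bullet> \<theta>))"
  let ?u = "turned_frame u k1 k2 v"
  have "facet_event ?u k1 k2 n f a"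
  proof (rule facet_event_supporting[OF orthonormal_turned_frame[OF u k] k f li \<theta>f \<theta>le l])
    show "?u c \<bullet> (\<Sum>j\<in>UNIV. l j *\<^sub>R a (f j)) = 0" if "c \<noteq> k1" "c \<noteq> k2" for c
      using perp[OF q(1) that] that by (simp add: lp turned_frame_def)
    show "0 < ?u k2 \<bullet> \<theta>" "\<bar>?u k1 \<bullet> \<theta>\<bar> \<le> ?u k2 \<bullet> \<theta>"
      using nz k by (auto simp: turned_frame_def v_def)
  qed auto
  then show ?thesis by blast
qed

section \<open>The shadow bound\<close>

text \<open>Configurations within \<rho> of their centres are charged to chords, whose total length
  is bounded for all facets at once; this yields a factor n instead of the number of candidates.
  Only the tail is paid for once per candidate.\<close>

lemma expected_facet_count_le:
  fixes u :: "'d \<Rightarrow> real ^ 'd" and c :: "nat \<Rightarrow> real ^ 'd" and \<sigma> \<eta> \<rho> B :: real and f :: "nat set \<Rightarrow> 'd \<Rightarrow> nat"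
  assumes u: "orthonormal_frame u" and k: "k1 \<noteq> k2" and \<sigma>: "\<sigma> > 0" and \<eta>: "0 < \<eta>" "\<eta> < 1"
    and \<rho>: "0 \<le> \<rho>" and fin: "finite \<I>"
    and f: "\<And>I. I \<in> \<I> \<Longrightarrow> bij_betw (f I) UNIV I" "\<And>I. I \<in> \<I> \<Longrightarrow> I \<subseteq> {1..n}"
    and c: "\<And>i. i \<in> {1..n} \<Longrightarrow> norm (c i) \<le> 1"
    and \<delta>: "\<delta> = 3 * real CARD('d) * \<eta> * (sqrt CARD('d) + \<rho>)" "2 * \<rho> * \<delta> + \<delta>\<^sup>2 \<le> 2 * \<sigma>\<^sup>2"
  shows "(\<Sum>I\<in>\<I>. \<integral>\<^sup>+a. indicator {a. facet_event u k1 k2 n (f I) a} a \<partial>gaussian_points n \<sigma> c)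
    \<le> ennreal (exp 1 / (1 - \<eta>) ^ (CARD('d) - 1) * (CARD('d) / (\<sigma> * \<eta>)) * (2 * real n * (1 + \<sigma> * (real CARD('d) + 2)))
        + card \<I> * (2 powr ((real CARD('d))\<^sup>2 / 2) * exp (- \<rho>\<^sup>2 / (4 * \<sigma>\<^sup>2))))"
proof -
  let ?G = "gaussian_points n \<sigma> c" and ?e = "\<eta> / CARD('d)"
  let ?C = "exp 1 / (1 - \<eta>) ^ (CARD('d) - 1) * (CARD('d) / (\<sigma> * \<eta>))"
  let ?T = "2 powr ((real CARD('d))\<^sup>2 / 2) * exp (- \<rho>\<^sup>2 / (4 * \<sigma>\<^sup>2))"
  let ?m = "\<lambda>I. config u (f I) c"
  let ?R = "\<lambda>I a. indicator {a. robust_facet_event u k1 k2 ?e n (f I) a} a * ennreal (chord k1 k2 ?e (config u (f I) a))"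
  have e0: "0 < ?e" using \<eta> by simp
  have C0: "0 \<le> ?C" using \<sigma> \<eta> by simp
  have rf: "range (f I) = I" "inj (f I)" "range (f I) \<subseteq> {1..n}" if "I \<in> \<I>" for I
    using f(1)[OF that] f(2)[OF that] by (auto simp: bij_betw_def)
  have cong: "measurable ?G (borel :: ennreal measure) = measurable (Pi\<^sub>M {1..n} (\<lambda>_. lborel)) borel"
    by (rule measurable_cong_sets[OF sets_gaussian_points refl])
  have meas: "?R I \<in> borel_measurable ?G" "(\<lambda>a. indicator {a. facet_event u k1 k2 n (f I) a} a :: ennreal) \<in> borel_measurable ?G"
     "(\<lambda>a. indicator {Z. norm (Z - ?m I) \<le> \<rho>} (config u (f I) a) :: ennreal) \<in> borel_measurable ?G"
     "(\<lambda>a. indicator {Z. \<rho> < norm (Z - ?m I)} (config u (f I) a) :: ennreal) \<in> borel_measurable ?G"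
    if I: "I \<in> \<I>" for I
  proof -
    note [measurable] = config_measurable[OF rf(3)[OF I]] pred_facet_event[OF rf(3)[OF I]]
      pred_robust_facet_event[OF rf(3)[OF I] less_imp_le[OF e0]]
    show "?R I \<in> borel_measurable ?G" unfolding cong by measurable
    show "(\<lambda>a. indicator {a. facet_event u k1 k2 n (f I) a} a :: ennreal) \<in> borel_measurable ?G" unfolding cong by measurable
    show "(\<lambda>a. indicator {Z. norm (Z - ?m I) \<le> \<rho>} (config u (f I) a) :: ennreal) \<in> borel_measurable ?G" unfolding cong by measurable
    show "(\<lambda>a. indicator {Z. \<rho> < norm (Z - ?m I)} (config u (f I) a) :: ennreal) \<in> borel_measurable ?G" unfolding cong by measurable
  qed
  have one: "(\<integral>\<^sup>+a. indicator {a. facet_event u k1 k2 n (f I) a} a \<partial>?G) \<le> ennreal ?C * (\<integral>\<^sup>+a. ?R I a \<partial>?G) + ennreal ?T"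
    if I: "I \<in> \<I>" for I
  proof -
    have "(norm (?m I))\<^sup>2 = (\<Sum>i\<in>I. (norm (c i))\<^sup>2)"
      using norm_config_diff[OF f(1)[OF I] u, of c "\<lambda>_. 0"] by (simp add: config_def vec_eq_iff zero_vec_def[symmetric])
    also have "\<dots> \<le> (\<Sum>i\<in>I. 1)"
      using c f(2)[OF I] by (intro sum_mono) (auto simp: power_le_one)
    also have "\<dots> = CARD('d)" using bij_betw_same_card[OF f(1)[OF I]] by simp
    finally have mI: "norm (?m I) \<le> sqrt CARD('d)" by (rule real_le_rsqrt)
    \<comment> \<open>The admissible displacement depends on the centre of the configuration;
      \<open>\<delta>\<close> covers all facets because d centres of norm at most 1 form a matrix of
      norm at most sqrt d.\<close>
    define \<delta>' where "\<delta>' = 3 * real CARD('d) * \<eta> * (norm (?m I) + \<rho>)"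
    have \<delta>': "0 \<le> \<delta>'" "\<delta>' \<le> \<delta>"
      unfolding \<delta>'_def \<delta>(1) using \<eta> \<rho> mI by (auto intro!: mult_left_mono)
    then have "2 * \<rho> * \<delta>' + \<delta>'\<^sup>2 \<le> 2 * \<rho> * \<delta> + \<delta>\<^sup>2"
      using \<rho> by (intro add_mono mult_left_mono power_mono) auto
    then have \<delta>2: "2 * \<rho> * \<delta>' + \<delta>'\<^sup>2 \<le> 2 * \<sigma>\<^sup>2" using \<delta>(2) by simp
    have "(\<integral>\<^sup>+a. indicator {a. facet_event u k1 k2 n (f I) a} a \<partial>?G)
       \<le> (\<integral>\<^sup>+a. indicator {a. facet_event u k1 k2 n (f I) a} a * indicator {Z. norm (Z - ?m I) \<le> \<rho>} (config u (f I) a)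
            + indicator {Z. \<rho> < norm (Z - ?m I)} (config u (f I) a) \<partial>?G)"
      by (intro nn_integral_mono) (auto simp: indicator_def)
    also have "\<dots> = (\<integral>\<^sup>+a. indicator {a. facet_event u k1 k2 n (f I) a} a * indicator {Z. norm (Z - ?m I) \<le> \<rho>} (config u (f I) a) \<partial>?G)
        + (\<integral>\<^sup>+a. indicator {Z. \<rho> < norm (Z - ?m I)} (config u (f I) a) \<partial>?G)"
      using meas[OF I] by (intro nn_integral_add borel_measurable_times) auto
    also have "\<dots> \<le> ennreal ?C * (\<integral>\<^sup>+a. ?R I a \<partial>?G) + ennreal ?T"
      by (intro add_mono expected_facet_le_chord[OF rf(2,3)[OF I] u k \<sigma> \<eta> \<delta>'_def \<delta>2] gaussian_points_tail[OF rf(2,3)[OF I] u \<sigma> \<rho>])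
    finally show ?thesis .
  qed
  have "(\<Sum>I\<in>\<I>. \<integral>\<^sup>+a. ?R I a \<partial>?G) = (\<integral>\<^sup>+a. (\<Sum>I\<in>\<I>. ?R I a) \<partial>?G)"
    using meas(1) by (intro nn_integral_sum[symmetric]) auto
  also have "\<dots> \<le> (\<integral>\<^sup>+a. (\<Sum>i\<in>{1..n}. ennreal 2 * ennreal \<bar>u k1 \<bullet> a i\<bar>) \<partial>?G)"
  proof (rule nn_integral_mono)
    fix a
    let ?J = "{I \<in> \<I>. robust_facet_event u k1 k2 ?e n (f I) a}"
    have ch0: "0 \<le> chord k1 k2 ?e Z" for Z :: "real ^ 'd ^ 'd" using \<eta> by (simp add: chord_def)
    have "(\<Sum>I\<in>\<I>. ?R I a) = (\<Sum>I\<in>?J. ennreal (chord k1 k2 ?e (config u (f I) a)))"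
      using fin by (intro sum.mono_neutral_cong_right) (auto simp: indicator_def)
    also have "\<dots> = ennreal (\<Sum>I\<in>?J. chord k1 k2 ?e (config u (f I) a))"
      using ch0 by (simp add: sum_ennreal)
    also have "\<dots> \<le> ennreal (2 * (\<Sum>i\<in>{1..n}. \<bar>u k1 \<bullet> a i\<bar>))"
      using fin f by (intro ennreal_leI sum_chord_le[OF k e0]) auto
    also have "\<dots> = (\<Sum>i\<in>{1..n}. ennreal 2 * ennreal \<bar>u k1 \<bullet> a i\<bar>)"
      by (simp add: sum_distrib_left ennreal_mult[symmetric] sum_ennreal del: ennreal_numeral)
    finally show "(\<Sum>I\<in>\<I>. ?R I a) \<le> (\<Sum>i\<in>{1..n}. ennreal 2 * ennreal \<bar>u k1 \<bullet> a i\<bar>)" .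
  qed
  also have "\<dots> = (\<Sum>i\<in>{1..n}. ennreal 2 * (\<integral>\<^sup>+a. ennreal \<bar>u k1 \<bullet> a i\<bar> \<partial>?G))"
  proof -
    have m: "(\<lambda>a. ennreal \<bar>u k1 \<bullet> a i\<bar>) \<in> borel_measurable ?G" if "i \<in> {1..n}" for i
    proof -
      note [measurable] = PiM_component_borel[OF that]
      show ?thesis unfolding cong by measurable
    qed
    then have "(\<integral>\<^sup>+a. (\<Sum>i\<in>{1..n}. ennreal 2 * ennreal \<bar>u k1 \<bullet> a i\<bar>) \<partial>?G) = (\<Sum>i\<in>{1..n}. \<integral>\<^sup>+a. ennreal 2 * ennreal \<bar>u k1 \<bullet> a i\<bar> \<partial>?G)"
      by (intro nn_integral_sum borel_measurable_times) auto
    also have "\<dots> = (\<Sum>i\<in>{1..n}. ennreal 2 * (\<integral>\<^sup>+a. ennreal \<bar>u k1 \<bullet> a i\<bar> \<partial>?G))"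
      using m by (intro sum.cong nn_integral_cmult) auto
    finally show ?thesis .
  qed
  also have "\<dots> \<le> (\<Sum>i\<in>{1..n}. ennreal 2 * ennreal (1 + \<sigma> * (real CARD('d) + 2)))"
  proof (intro sum_mono mult_left_mono nn_integral_gaussian_points_inner \<sigma> c)
    show "norm (u k1) \<le> 1" using u by (simp add: orthonormal_frame_def norm_eq_sqrt_inner)
  qed auto
  also have "\<dots> = (\<Sum>i\<in>{1..n}. ennreal (2 * (1 + \<sigma> * (real CARD('d) + 2))))"
    using \<sigma> by (intro sum.cong refl ennreal_mult[symmetric]) auto
  also have "\<dots> = ennreal (\<Sum>i\<in>{1..n}. 2 * (1 + \<sigma> * (real CARD('d) + 2)))"
    using \<sigma> by (intro sum_ennreal) auto
  also have "(\<Sum>i\<in>{1..n}. 2 * (1 + \<sigma> * (real CARD('d) + 2))) = 2 * real n * (1 + \<sigma> * (real CARD('d) + 2))"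
    by simp
  finally have R: "(\<Sum>I\<in>\<I>. \<integral>\<^sup>+a. ?R I a \<partial>?G) \<le> ennreal (2 * real n * (1 + \<sigma> * (real CARD('d) + 2)))" .
  have "(\<Sum>I\<in>\<I>. \<integral>\<^sup>+a. indicator {a. facet_event u k1 k2 n (f I) a} a \<partial>?G)
     \<le> (\<Sum>I\<in>\<I>. ennreal ?C * (\<integral>\<^sup>+a. ?R I a \<partial>?G) + ennreal ?T)"
    by (intro sum_mono one)
  also have "\<dots> = ennreal ?C * (\<Sum>I\<in>\<I>. \<integral>\<^sup>+a. ?R I a \<partial>?G) + ennreal (card \<I> * ?T)"
    by (simp add: sum.distrib sum_distrib_left ennreal_mult ennreal_of_nat_eq_real_of_nat)
  also have "\<dots> \<le> ennreal ?C * ennreal (2 * real n * (1 + \<sigma> * (real CARD('d) + 2))) + ennreal (card \<I> * ?T)"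
    by (intro add_mono mult_left_mono R) auto
  also have "\<dots> = ennreal (?C * (2 * real n * (1 + \<sigma> * (real CARD('d) + 2))) + card \<I> * ?T)"
  proof -
    have X0: "0 \<le> 2 * real n * (1 + \<sigma> * (real CARD('d) + 2))" using \<sigma> by simp
    show ?thesis
      unfolding ennreal_mult[OF C0 X0, symmetric]
      by (rule ennreal_plus[symmetric]) (use mult_nonneg_nonneg[OF C0 X0] in auto)
  qed
  finally show ?thesis .
qed

text \<open>With \<rho> = \<sigma> \<tau>, the choice of \<tau> makes the tail factor
  exp(-\<rho>^2/(4 \<sigma>^2)) equal to n^(-d^2), which beats the at most n^d candidates and
  2^(d^2/2) \<le> n^(d^2/4). Then \<eta> is the value for which \<delta> = \<sigma>/(2 \<tau>), so
  that 2 \<rho> \<delta> = \<sigma>^2 and \<delta>^2 \<le> \<sigma>^2.\<close>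

lemma shadow_bound_numeric:
  fixes n d :: nat and \<sigma> \<tau> \<eta> \<delta> :: real
  assumes d: "3 \<le> d" and n: "d < n" and \<sigma>: "\<sigma> > 0"
  defines "\<tau> \<equiv> 2 * real d * sqrt (ln (real n))"
  defines "\<eta> \<equiv> \<sigma> / (6 * real d * \<tau> * (sqrt d + \<sigma> * \<tau>))"
  defines "\<delta> \<equiv> 3 * real d * \<eta> * (sqrt d + \<sigma> * \<tau>)"
  shows "0 < \<tau>" "0 < \<eta>" "\<eta> < 1" "2 * (\<sigma> * \<tau>) * \<delta> + \<delta>\<^sup>2 \<le> 2 * \<sigma>\<^sup>2"
    "4 * (exp 1 / (1 - \<eta>) ^ (d - 1) * (d / (\<sigma> * \<eta>)) * (2 * real n * (1 + \<sigma> * (real d + 2)))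
      + (n choose d) * (2 powr ((real d)\<^sup>2 / 2) * exp (- (\<sigma> * \<tau>)\<^sup>2 / (4 * \<sigma>\<^sup>2)))) \<le> shadow_bound n d \<sigma>"
proof -
  have n4: "4 \<le> real n" and d3: "3 \<le> real d" using d n by auto
  have "exp (1::real) \<le> 3" by (rule exp_le)
  then have ln1: "1 \<le> ln (real n)" using n4 ln_ge_iff[of "real n" 1] by simp
  have sl1: "1 \<le> sqrt (ln (real n))" using ln1 by simp
  have \<tau>6: "6 \<le> \<tau>" unfolding \<tau>_def using mult_mono[of 6 "2 * real d" 1 "sqrt (ln (real n))"] d3 sl1 by simp
  then show \<tau>0: "0 < \<tau>" by simp
  have sd1: "1 \<le> sqrt (real d)" using d3 by simp
  have M0: "0 < sqrt d + \<sigma> * \<tau>" using sd1 \<sigma> \<tau>0 by (simp add: add_pos_pos)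
  show \<eta>0: "0 < \<eta>" unfolding \<eta>_def using \<sigma> d3 \<tau>0 M0 by simp
  have \<delta>e: "\<delta> = \<sigma> / (2 * \<tau>)" 
  proof -
    have "3 * real d * (\<sigma> / (6 * real d * \<tau> * M)) * M = \<sigma> / (2 * \<tau>)" if "M \<noteq> 0" for M
      using d3 \<tau>0 that by (simp add: field_simps)
    then show ?thesis unfolding \<delta>_def \<eta>_def using M0 by simp
  qed
  \<comment> \<open>This keeps (1 - \<eta>)^(d-1) above 1/2 by Bernoulli's inequality. Dropping sqrt
    d from the denominator of \<eta> makes \<sigma> cancel.\<close>
  have \<eta>d: "\<eta> * real d \<le> 1 / 2"
  proof -
    have "\<eta> \<le> \<sigma> / (6 * d * \<tau> * (\<sigma> * \<tau>))"
      unfolding \<eta>_def using \<sigma> d3 \<tau>0 M0 sd1 by (intro divide_left_mono mult_left_mono) (auto intro!: mult_pos_pos)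
    also have "\<dots> = 1 / (6 * d * \<tau>\<^sup>2)" using \<sigma> \<tau>0 d3 by (simp add: field_simps power2_eq_square)
    finally have "\<eta> * real d \<le> 1 / (6 * \<tau>\<^sup>2)" using d3 \<tau>0 by (simp add: field_simps)
    also have "\<dots> \<le> 1 / 2"
      using power_mono[of 6 \<tau> 2] \<tau>6 by (simp add: field_simps)
    finally show ?thesis .
  qed
  have "\<eta> * 3 \<le> \<eta> * real d" using \<eta>0 d3 by (intro mult_left_mono) auto
  then show \<eta>1: "\<eta> < 1" using \<eta>d by linarith
  show "2 * (\<sigma> * \<tau>) * \<delta> + \<delta>\<^sup>2 \<le> 2 * \<sigma>\<^sup>2"
  proof -
    have "2 * (\<sigma> * \<tau>) * \<delta> = \<sigma>\<^sup>2" unfolding \<delta>e using \<tau>0 by (simp add: power2_eq_square)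
    moreover have "\<delta>\<^sup>2 \<le> \<sigma>\<^sup>2"
      unfolding \<delta>e using \<tau>6 \<sigma> by (intro power_mono) (auto simp: divide_le_eq)
    ultimately show ?thesis by simp
  qed
  define s where "s = min \<sigma> (1 / (3 * sqrt (real d * ln (real n))))"
  \<comment> \<open>All quantities are measured in powers of r, the reciprocal of the minimum in
    \<open>shadow_bound\<close>: it dominates 1/\<sigma> as well as 3 sqrt(d ln n), hence also
    \<tau>/sqrt d.\<close>
  define r where "r = 1 / s"
  have sdl: "sqrt (real d * ln (real n)) = sqrt d * sqrt (ln n)" by (simp add: real_sqrt_mult)
  have sdl0: "0 < sqrt d * sqrt (ln (real n))" using sd1 sl1 by (simp add: mult_pos_pos)
  have s0: "0 < s" unfolding s_def sdl using \<sigma> sdl0 by simp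
  have r0: "0 < r" using s0 by (simp add: r_def)
  have r1: "1 / \<sigma> \<le> r" unfolding r_def using s0 \<sigma> by (intro divide_left_mono) (auto simp: s_def)
  have r2: "3 * (sqrt d * sqrt (ln n)) \<le> r"
  proof -
    have "s \<le> 1 / (3 * (sqrt d * sqrt (ln n)))" by (simp add: s_def sdl)
    then have "s * (3 * (sqrt d * sqrt (ln n))) \<le> 1" using sdl0 by (simp add: field_simps)
    then show ?thesis unfolding r_def using s0 by (simp add: field_simps)
  qed
  have dd: "sqrt (real d) * sqrt (real d) = d" by simp
  have \<tau>r: "\<tau> \<le> sqrt d * r"
  proof -
    have "\<tau> = sqrt d * (2 * (sqrt d * sqrt (ln n)))" unfolding \<tau>_def using dd by (simp add: mult.assoc[symmetric])
    also have "\<dots> \<le> sqrt d * r" using r2 sdl0 sd1 by (intro mult_left_mono) auto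
    finally show ?thesis .
  qed
  have dr: "9 * real d \<le> r\<^sup>2"
  proof -
    have "3 * (sqrt d * 1) \<le> 3 * (sqrt d * sqrt (ln n))" using sl1 sd1 by (intro mult_left_mono) auto
    then have "3 * sqrt d \<le> r" using r2 by simp
    then have "(3 * sqrt d)\<^sup>2 \<le> r\<^sup>2" using sd1 by (intro power_mono) auto
    then show ?thesis by (simp add: power_mult_distrib)
  qed
  have r5: "5 \<le> r"
  proof -
    have "5\<^sup>2 \<le> r\<^sup>2" using dr d3 by simp
    then show ?thesis by (rule power2_le_imp_le) (use r0 in simp)
  qed
  have A: "(sqrt d + \<sigma> * \<tau>) / \<sigma> \<le> 2 * sqrt d * r"
  proof -
    have "(sqrt d + \<sigma> * \<tau>) / \<sigma> = sqrt d * (1 / \<sigma>) + \<tau>" using \<sigma> by (simp add: add_divide_distrib)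
    also have "\<dots> \<le> sqrt d * r + sqrt d * r" using r1 \<tau>r sd1 by (intro add_mono mult_left_mono) auto
    finally show ?thesis by (simp add: mult_ac)
  qed
  have B: "(1 + \<sigma> * (real d + 2)) / \<sigma> \<le> r\<^sup>2"
  proof -
    have "(1 + \<sigma> * (real d + 2)) / \<sigma> = 1 / \<sigma> + real d + 2" using \<sigma> by (simp add: add_divide_distrib)
    also have "\<dots> \<le> r + real d + 2" using r1 by simp
    also have "\<dots> \<le> r\<^sup>2" 
    proof -
      have "5 * r \<le> r\<^sup>2" using mult_right_mono[OF r5, of r] r0 by (simp add: power2_eq_square)
      then show ?thesis using dr r5 d3 by linarith
    qed
    finally show ?thesis .
  qed
  have pw: "1 / 2 \<le> (1 - \<eta>) ^ (d - 1)"
  proof -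
    have "1 + real (d - 1) * (- \<eta>) \<le> (1 + (- \<eta>)) ^ (d - 1)" by (rule Bernoulli_inequality) (use \<eta>1 in simp)
    moreover have "real (d - 1) * \<eta> \<le> \<eta> * real d" using \<eta>0 by (simp add: mult.commute)
    ultimately show ?thesis using \<eta>d by simp
  qed
  have E: "exp 1 / (1 - \<eta>) ^ (d - 1) \<le> 6"
  proof -
    have "exp 1 / (1 - \<eta>) ^ (d - 1) \<le> 3 / (1 / 2)" using pw exp_le by (intro frac_le) auto
    then show ?thesis by simp
  qed
  \<comment> \<open>Of r^4, one power comes from \<tau>, one from \<open>A\<close> and two from
    \<open>B\<close>. The constant is 6 from \<open>E\<close>, times 12 from the 6 in \<eta> and the
    2 in 2n, times 2 from \<open>A\<close>.\<close>
  have main: "exp 1 / (1 - \<eta>) ^ (d - 1) * (d / (\<sigma> * \<eta>)) * (2 * real n * (1 + \<sigma> * (real d + 2))) \<le> 144 * n * d ^ 3 * r ^ 4"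
  proof -
    have eq: "d / (\<sigma> * \<eta>) * (2 * real n * (1 + \<sigma> * (real d + 2)))
        = 12 * n * d\<^sup>2 * (\<tau> * ((sqrt d + \<sigma> * \<tau>) / \<sigma>) * ((1 + \<sigma> * (real d + 2)) / \<sigma>))"
      unfolding \<eta>_def using \<sigma> d3 \<tau>0 M0 by (simp add: field_simps power2_eq_square)
    have "\<tau> * ((sqrt d + \<sigma> * \<tau>) / \<sigma>) * ((1 + \<sigma> * (real d + 2)) / \<sigma>) \<le> (sqrt d * r) * (2 * sqrt d * r) * r\<^sup>2"
      using \<tau>r A B \<tau>0 \<sigma> M0 r0 sd1 by (intro mult_mono) auto
    also have "\<dots> = 2 * d * r ^ 4" using dd by (simp add: power2_eq_square power4_eq_xxxx)
    finally have le: "d / (\<sigma> * \<eta>) * (2 * real n * (1 + \<sigma> * (real d + 2))) \<le> 12 * n * d\<^sup>2 * (2 * d * r ^ 4)"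
      unfolding eq by (intro mult_left_mono) auto
    have "exp 1 / (1 - \<eta>) ^ (d - 1) * (d / (\<sigma> * \<eta>) * (2 * real n * (1 + \<sigma> * (real d + 2)))) \<le> 6 * (12 * n * d\<^sup>2 * (2 * d * r ^ 4))"
      by (rule mult_mono[OF E le]) (use \<sigma> \<eta>0 in auto)
    also have "\<dots> = 144 * n * d ^ 3 * r ^ 4" by (simp add: power2_eq_square power3_eq_cube)
    finally show ?thesis by (simp add: mult.assoc)
  qed
  have tail: "(n choose d) * (2 powr ((real d)\<^sup>2 / 2) * exp (- (\<sigma> * \<tau>)\<^sup>2 / (4 * \<sigma>\<^sup>2))) \<le> 1"
  proof -
    have "real (n choose d) \<le> real (n ^ d)" using binomial_le_pow[of d n] n by (intro of_nat_mono) auto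
    also have "\<dots> = n powr d" using n4 by (simp add: powr_realpow)
    finally have 1: "real (n choose d) \<le> n powr d" .
    have 2: "2 powr ((real d)\<^sup>2 / 2) \<le> n powr ((real d)\<^sup>2 / 4)"
    proof -
      have "(2::real) powr ((real d)\<^sup>2 / 2) = (2 powr 2) powr ((real d)\<^sup>2 / 4)" unfolding powr_powr by simp
      also have "\<dots> \<le> n powr ((real d)\<^sup>2 / 4)" using n4 by (intro powr_mono2) auto
      finally show ?thesis .
    qed
    have "(\<sigma> * \<tau>)\<^sup>2 / (4 * \<sigma>\<^sup>2) = (real d)\<^sup>2 * ln n"
      unfolding \<tau>_def using \<sigma> ln1 by (simp add: power_mult_distrib)
    then have 3: "exp (- (\<sigma> * \<tau>)\<^sup>2 / (4 * \<sigma>\<^sup>2)) = n powr (- (real d)\<^sup>2)" using n4 by (simp add: powr_def)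
    have "(n choose d) * (2 powr ((real d)\<^sup>2 / 2) * exp (- (\<sigma> * \<tau>)\<^sup>2 / (4 * \<sigma>\<^sup>2)))
       \<le> n powr d * (n powr ((real d)\<^sup>2 / 4) * n powr (- (real d)\<^sup>2))"
      unfolding 3 using 1 2 by (intro mult_mono) auto
    also have "\<dots> = n powr (d + ((real d)\<^sup>2 / 4 + - (real d)\<^sup>2))" by (simp only: powr_add)
    also have "\<dots> \<le> n powr 0"
    proof (rule powr_mono)
      have "3 * real d \<le> (real d)\<^sup>2" using d3 by (simp add: power2_eq_square)
      then show "d + ((real d)\<^sup>2 / 4 + - (real d)\<^sup>2) \<le> 0" by simp
    qed (use n4 in simp)
    finally show ?thesis using n4 by simp
  qed
  have big: "1 \<le> n * d ^ 3 * r ^ 4"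
  proof -
    have d1: "1 \<le> real d ^ 3" and r1: "1 \<le> r ^ 4" using d3 r5 by (auto intro: one_le_power)
    have "1 * 1 \<le> real n * real d ^ 3" using n4 d1 by (intro mult_mono) auto
    then have "1 * 1 \<le> real n * real d ^ 3 * r ^ 4" using r1 by (intro mult_mono) auto
    then show ?thesis by simp
  qed
  have "4 * (exp 1 / (1 - \<eta>) ^ (d - 1) * (d / (\<sigma> * \<eta>)) * (2 * real n * (1 + \<sigma> * (real d + 2)))
      + (n choose d) * (2 powr ((real d)\<^sup>2 / 2) * exp (- (\<sigma> * \<tau>)\<^sup>2 / (4 * \<sigma>\<^sup>2)))) \<le> 4 * (144 * n * d ^ 3 * r ^ 4 + 1)"
    using main tail by (intro mult_left_mono add_mono) auto
  \<comment> \<open>The tail contribution 1 is absorbed by \<open>big\<close>: 4 (144 + 1) =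
    580.\<close>
  also have "\<dots> \<le> 580 * (n * d ^ 3 * r ^ 4)"
  proof -
    define X where "X = real (n * d ^ 3) * r ^ 4"
    have "real (144 * n * d ^ 3) * r ^ 4 = 144 * X" by (simp add: X_def)
    moreover have "1 \<le> X" using big by (simp add: X_def)
    ultimately show ?thesis unfolding X_def[symmetric] by simp
  qed
  also have "\<dots> \<le> 58888678 * (n * d ^ 3 * r ^ 6)"
  proof (intro mult_mono)
    show "r ^ 4 \<le> r ^ 6" using r5 by (intro power_increasing) auto
  qed (use r0 in auto)
  also have "\<dots> = shadow_bound n d \<sigma>"
    by (simp add: shadow_bound_def s_def[symmetric] r_def power_divide)
  finally show "4 * (exp 1 / (1 - \<eta>) ^ (d - 1) * (d / (\<sigma> * \<eta>)) * (2 * real n * (1 + \<sigma> * (real d + 2)))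
      + (n choose d) * (2 powr ((real d)\<^sup>2 / 2) * exp (- (\<sigma> * \<tau>)\<^sup>2 / (4 * \<sigma>\<^sup>2)))) \<le> shadow_bound n d \<sigma>" .
qed

text \<open>Integrability is asserted separately because the Bochner integral of a nonintegrable
  function is 0 by convention, so the inequality alone would not bound an expectation.\<close>

theorem mainTheorem2:
  fixes t z :: "real ^ 'd" and c :: "nat \<Rightarrow> real ^ 'd" and n :: nat and \<sigma> :: real
  assumes "CARD('d) \<ge> 3" and "n > CARD('d)"
    and "t \<noteq> z" and "independent {t, z}"
    and "\<sigma> > 0"
    and "\<forall>i\<in>{1..n}. norm (c i) \<le> 1"
  shows "integrable (gaussian_points n \<sigma> c) (\<lambda>a. real (card (Shadow t z n a))) \<and>
         (LINT a|gaussian_points n \<sigma> c. real (card (Shadow t z n a))) \<le> shadow_bound n CARD('d) \<sigma>"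
proof -
  let ?G = "gaussian_points n \<sigma> c" and ?d = "CARD('d)"
  interpret G: prob_space ?G by (rule prob_space_gaussian_points[OF assms(5)])
  define \<I> where "\<I> = {I. I \<subseteq> {1..n} \<and> card I = ?d}"
  have fin: "finite \<I>" unfolding \<I>_def by simp
  have card\<I>: "card \<I> = n choose ?d" using n_subsets[of "{1..n}" ?d] by (simp add: \<I>_def)
  have "\<exists>g :: 'd \<Rightarrow> nat. bij_betw g UNIV I" if "I \<in> \<I>" for I
    using that finite_same_card_bij[of "UNIV :: 'd set" I] by (auto simp: \<I>_def intro: finite_subset)
  then obtain f :: "nat set \<Rightarrow> 'd \<Rightarrow> nat" where f: "\<And>I. I \<in> \<I> \<Longrightarrow> bij_betw (f I) UNIV I" by metis
  have sub: "I \<subseteq> {1..n}" if "I \<in> \<I>" for I using that by (simp add: \<I>_def)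
  have Sh: "Shadow t z n a \<subseteq> \<I>" for a by (auto simp: Shadow_def optSimp_def \<I>_def)
  have count: "real (card (Shadow t z n a)) = (\<Sum>I\<in>\<I>. indicator {a. I \<in> Shadow t z n a} a)" for a
  proof -
    have "(\<Sum>I\<in>\<I>. indicator {a. I \<in> Shadow t z n a} a :: real) = (\<Sum>I\<in>\<I>. if I \<in> Shadow t z n a then 1 else 0)"
      by (rule sum.cong) (auto simp: indicator_def)
    also have "\<dots> = (\<Sum>I\<in>\<I> \<inter> Shadow t z n a. 1)"
      by (rule sum.inter_restrict[OF fin, symmetric])
    also have "\<I> \<inter> Shadow t z n a = Shadow t z n a" using Sh by blast
    finally show ?thesis by simp
  qed
  have meas: "(\<lambda>a. real (card (Shadow t z n a))) \<in> borel_measurable ?G"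
    unfolding count
  proof (rule borel_measurable_sum)
    fix I assume I: "I \<in> \<I>"
    note [measurable] = pred_Shadow[OF f[OF I] sub[OF I], of t z]
    have "(\<lambda>a. indicator {a. I \<in> Shadow t z n a} a :: real) \<in> borel_measurable (Pi\<^sub>M {1..n} (\<lambda>_. lborel))" by measurable
    then show "(\<lambda>a. indicator {a. I \<in> Shadow t z n a} a :: real) \<in> borel_measurable ?G"
      by (simp add: measurable_cong_sets[OF sets_gaussian_points refl])
  qed
  have "integrable ?G (\<lambda>a. real (card (Shadow t z n a)))"
    by (rule G.integrable_const_bound[where B="real (card \<I>)", OF _ meas]) (auto intro!: AE_I2 card_mono[OF fin Sh])
  moreover have "(\<integral>\<^sup>+a. ennreal (real (card (Shadow t z n a))) \<partial>?G) \<le> ennreal (shadow_bound n ?d \<sigma>)"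
  proof -
    obtain u :: "'d \<Rightarrow> real ^ 'd" and k1 k2 where u: "orthonormal_frame u" and k: "k1 \<noteq> k2"
      and perp: "\<And>q c. q \<in> span {t, z} \<Longrightarrow> c \<noteq> k1 \<Longrightarrow> c \<noteq> k2 \<Longrightarrow> u c \<bullet> q = 0"
      using ex_orthonormal_frame[OF assms(3,4)] by blast
    let ?u = "turned_frame u k1 k2"
    define \<tau> where "\<tau> = 2 * real ?d * sqrt (ln (real n))"
    define \<eta> where "\<eta> = \<sigma> / (6 * real ?d * \<tau> * (sqrt ?d + \<sigma> * \<tau>))"
    define \<delta> where "\<delta> = 3 * real ?d * \<eta> * (sqrt ?d + \<sigma> * \<tau>)"
    note num = shadow_bound_numeric[OF assms(1,2,5), folded \<tau>_def, folded \<eta>_def, folded \<delta>_def]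
    let ?b = "exp 1 / (1 - \<eta>) ^ (?d - 1) * (?d / (\<sigma> * \<eta>)) * (2 * real n * (1 + \<sigma> * (real ?d + 2)))
        + (n choose ?d) * (2 powr ((real ?d)\<^sup>2 / 2) * exp (- (\<sigma> * \<tau>)\<^sup>2 / (4 * \<sigma>\<^sup>2)))"
    let ?F = "\<lambda>v I a. indicator {a. facet_event (?u v) k1 k2 n (f I) a} a :: ennreal"
    have Fm: "?F v I \<in> borel_measurable ?G" if I: "I \<in> \<I>" for v I
    proof -
      have "range (f I) \<subseteq> {1..n}" using f[OF I] sub[OF I] by (simp add: bij_betw_def)
      note [measurable] = pred_facet_event[OF this]
      have "?F v I \<in> borel_measurable (Pi\<^sub>M {1..n} (\<lambda>_. lborel))" by measurable
      then show ?thesis by (simp add: measurable_cong_sets[OF sets_gaussian_points refl])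
    qed
    have "(\<integral>\<^sup>+a. ennreal (real (card (Shadow t z n a))) \<partial>?G) \<le> (\<integral>\<^sup>+a. (\<Sum>v\<in>UNIV. \<Sum>I\<in>\<I>. ?F v I a) \<partial>?G)"
    proof (rule nn_integral_mono)
      fix a
      \<comment> \<open>A union bound over the four frames: a facet of the shadow may be counted in
        several of them, but is counted in at least one.\<close>
      have "indicator {a. I \<in> Shadow t z n a} a \<le> (\<Sum>v\<in>UNIV. ?F v I a)" if I: "I \<in> \<I>" for I
      proof (cases "I \<in> Shadow t z n a")
        case True
        then obtain v where "facet_event (?u v) k1 k2 n (f I) a"
          using Shadow_imp_facet_event[OF u k perp f[OF I]] by blast
        then have "1 \<le> ?F v I a" by simp
        also have "\<dots> \<le> (\<Sum>v\<in>UNIV. ?F v I a)" by (rule member_le_sum) auto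
        finally show ?thesis using True by simp
      qed simp
      then have "(\<Sum>I\<in>\<I>. indicator {a. I \<in> Shadow t z n a} a) \<le> (\<Sum>I\<in>\<I>. \<Sum>v\<in>UNIV. ?F v I a)"
        by (rule sum_mono)
      moreover have "ennreal (real (card (Shadow t z n a))) = (\<Sum>I\<in>\<I>. indicator {a. I \<in> Shadow t z n a} a)"
        unfolding count ennreal_indicator[symmetric] by (rule sum_ennreal[symmetric]) simp
      ultimately show "ennreal (real (card (Shadow t z n a))) \<le> (\<Sum>v\<in>UNIV. \<Sum>I\<in>\<I>. ?F v I a)"
        by (subst sum.swap) simp
    qed
    also have "\<dots> = (\<Sum>v\<in>UNIV. \<Sum>I\<in>\<I>. \<integral>\<^sup>+a. ?F v I a \<partial>?G)"
      using Fm by (simp add: nn_integral_sum borel_measurable_sum)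
    also have "\<dots> \<le> (\<Sum>v\<in>(UNIV :: (bool \<times> bool) set). ennreal ?b)"
    proof (rule sum_mono)
      fix v
      show "(\<Sum>I\<in>\<I>. \<integral>\<^sup>+a. ?F v I a \<partial>?G) \<le> ennreal ?b"
        unfolding card\<I>[symmetric]
        by (rule expected_facet_count_le[OF orthonormal_turned_frame[OF u k] k assms(5) num(2,3) _ fin f sub _ \<delta>_def num(4)])
          (use assms(5,6) num(1) in auto)
    qed
    also have "\<dots> = ennreal (4 * ?b)"
    proof -
      have "0 \<le> ?b" using num(2,3) assms(5) by (intro add_nonneg_nonneg mult_nonneg_nonneg) auto
      then have "(\<Sum>v\<in>(UNIV :: (bool \<times> bool) set). ennreal ?b) = ennreal (\<Sum>v\<in>(UNIV :: (bool \<times> bool) set). ?b)"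
        by (intro sum_ennreal)
      moreover have "card (UNIV :: (bool \<times> bool) set) = 4" by simp
      ultimately show ?thesis by (simp only: sum_constant) simp
    qed
    also have "\<dots> \<le> ennreal (shadow_bound n ?d \<sigma>)" by (intro ennreal_leI num(5))
    finally show ?thesis .
  qed
  moreover have "0 \<le> shadow_bound n ?d \<sigma>" by (simp add: shadow_bound_def)
  ultimately show ?thesis by (auto intro: integral_real_bounded)
qed

end
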